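(* Let $\mathcal X_\pm,\mathcal U,\mathcal Y$ be (possibly infinite-dimensional) complex Hilbert spaces and let $\Sigma=(\Sigma_+,\Sigma_-)$ be a bicausal linear system with bounded operators $\widetilde A_\pm\in\mathcal L(\mathcal X_\pm)$, $\widetilde B_\pm\in\mathcal L(\mathcal U,\mathcal X_\pm)$, $\widetilde C_\pm\in\mathcal L(\mathcal X_\pm,\mathcal Y)$, $\widetilde D\in\mathcal L(\mathcal U,\mathcal Y)$, where $\widetilde A_+$ and $\widetilde A_-$ are both exponentially stable, with transfer function $$F_\Sigma(z)=\widetilde C_-(I-z^{-1}\widetilde A_-)^{-1}\widetilde B_-+\widetilde D+z\widetilde C_+(I-z\widetilde A_+)^{-1}\widetilde B_+,\qquad \|F_\Sigma\|_{\infty,\mathbb T}=\sup_{z\in\mathbb T}\|F_\Sigma(z)\|.$$ (1) Assume that $\Sigma$ is $\ell^2$-exactly minimal, i.e. the operators $\mathbf W_c^+,\mathbf W_c^-,(\mathbf W_o^+)^*,(\mathbf W_o^-)^*$ are all surjective. Then $\|F_\Sigma\|_{\infty,\mathbb T}\le1$ if and only if there exists a bounded and boundedly invertible selfadjoint solution $H=\begin{bmatrix}H_-&H_0\\H_0^*&H_+\end{bmatrix}$ on $\mathcal X_-\oplus\mathcal X_+$ of the bicausal KYP-inequality. (2) (Without the minimality assumption.) $\|F_\Sigma\|_{\infty,\mathbb T}<1$ if and only if there exists a bounded and boundedly invertible selfadjoint solution $H=\begin{bmatrix}H_-&H_0\\H_0^*&H_+\end{bmatrix}$ on $\mathcal X_-\oplus\mathcal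 X_+$ of the strict bicausal KYP-inequality.
   Context: A bicausal system consists of $\Sigma_-$: $\mathbf x_-(n)=\widetilde A_-\mathbf x_-(n+1)+\widetilde B_-\mathbf u(n)$, $\mathbf y_-(n)=\widetilde C_-\mathbf x_-(n)$, and $\Sigma_+$: $\mathbf x_+(n+1)=\widetilde A_+\mathbf x_+(n)+\widetilde B_+\mathbf u(n)$, $\mathbf y_+(n)=\widetilde C_+\mathbf x_+(n)+\widetilde D\mathbf u(n)$ ($n\in\mathbb Z$), with output $\mathbf y=\mathbf y_-+\mathbf y_+$. Exponentially stable means spectrum contained in the open unit disk. With $\mathbb Z_+=\{0,1,\dots\}$, $\mathbb Z_-=\{-1,-2,\dots\}$: $\mathbf W_c^+=\operatorname{row}_{j\in\mathbb Z_-}[\widetilde A_+^{-j-1}\widetilde B_+]:\ell^2_{\mathcal U}(\mathbb Z_-)\to\mathcal X_+$, $\mathbf W_c^-=\operatorname{row}_{j\in\mathbb Z_+}[\widetilde A_-^{j}\widetilde B_-]:\ell^2_{\mathcal U}(\mathbb Z_+)\to\mathcal X_-$, $\mathbf W_o^+=\operatorname{col}_{i\in\mathbb Z_+}[\widetilde C_+\widetilde A_+^i]:\mathcal X_+\to\ell^2_{\mathcal Y}(\mathbb Z_+)$, $\mathbf W_o^-=\operatorname{col}_{i\in\mathbb Z_-}[\widetilde C_-\widetilde A_-^{-i}]:\mathcal X_-\to\ell^2_{\mathcal Y}(\mathbb Z_-)$ (all bounded). $X\preceq Y$ means $Y-X$ is positive-semidefinite. Put $$L=\begin{bmatrix}I&0&0\\0&\widetilde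 A_+&\widetilde B_+\\\widetilde C_-\widetilde A_-&\widetilde C_+&\widetilde C_-\widetilde B_-+\widetilde D\end{bmatrix}:\mathcal X_-\oplus\mathcal X_+\oplus\mathcal U\to\mathcal X_-\oplus\mathcal X_+\oplus\mathcal Y,$$ $$R=\begin{bmatrix}\widetilde A_-&0&\widetilde B_-\\0&I&0\\0&0&I\end{bmatrix}\ \text{on}\ \mathcal X_-\oplus\mathcal X_+\oplus\mathcal U.$$ The bicausal KYP-inequality for $H$ is $$L^*\begin{bmatrix}H&0\\0&I_{\mathcal Y}\end{bmatrix}L\preceq R^*\begin{bmatrix}H&0\\0&I_{\mathcal U}\end{bmatrix}R;$$ the strict bicausal KYP-inequality is: for some $\epsilon>0$, $$L^*\begin{bmatrix}H&0\\0&I_{\mathcal Y}\end{bmatrix}L+\epsilon^2R^*R\preceq R^*\begin{bmatrix}H&0\\0&I_{\mathcal U}\end{bmatrix}R.$$ *)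

theory Defs
  imports "HOL-Analysis.Analysis"
begin

section \<open>Complex Hilbert spaces\<close>

class complex_vector = real_vector +
  fixes scaleC :: "complex \<Rightarrow> 'a \<Rightarrow> 'a"  (infixr \<open>*\<^sub>C\<close> 75)
  assumes scaleC_add_right: "a *\<^sub>C (x + y) = a *\<^sub>C x + a *\<^sub>C y"
    and scaleC_add_left: "(a + b) *\<^sub>C x = a *\<^sub>C x + b *\<^sub>C x"
    and scaleC_scaleC: "a *\<^sub>C b *\<^sub>C x = (a * b) *\<^sub>C x"
    and scaleC_one: "1 *\<^sub>C x = x"
    and scaleR_scaleC: "scaleR r x = complex_of_real r *\<^sub>C x"

text \<open>
  The inner product is linear in its first argument. Its real part is the inner product inherited
  from \<^class>\<open>real_inner\<close>, so norm, topology and positive definiteness come from that class.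
\<close>

class complex_inner = complex_vector + real_inner +
  fixes cinner :: "'a \<Rightarrow> 'a \<Rightarrow> complex"
  assumes cinner_commute: "cinner x y = cnj (cinner y x)"
    and cinner_add_left: "cinner (x + y) z = cinner x z + cinner y z"
    and cinner_scaleC_left: "cinner (a *\<^sub>C x) y = a * cinner x y"
    and inner_eq_Re_cinner: "inner x y = Re (cinner x y)"

class chilbert_space = complex_inner + complete_space

lemma cinner_self: "cinner x x = complex_of_real ((norm x)\<^sup>2)"
proof (rule complex_eqI)
  show "Re (cinner x x) = Re (complex_of_real ((norm x)\<^sup>2))"
    by (simp add: power2_norm_eq_inner inner_eq_Re_cinner)
  have "Im (cinner x x) = - Im (cinner x x)"
    by (subst (1) cinner_commute) simp
  then show "Im (cinner x x) = Im (complex_of_real ((norm x)\<^sup>2))" by simp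
qed

lemma norm_scaleC: "norm (a *\<^sub>C x) = cmod a * norm (x :: 'a::complex_inner)"
proof -
  have "cinner (a *\<^sub>C x) (a *\<^sub>C x) = a * cnj a * cinner x x"
    by (metis cinner_commute cinner_scaleC_left complex_cnj_cnj complex_cnj_mult mult.assoc mult.commute)
  then have "complex_of_real ((norm (a *\<^sub>C x))\<^sup>2) = complex_of_real ((cmod a * norm x)\<^sup>2)"
    by (simp add: cinner_self power_mult_distrib flip: complex_norm_square)
  then have "(norm (a *\<^sub>C x))\<^sup>2 = (cmod a * norm x)\<^sup>2"
    using of_real_eq_iff by blast
  then show ?thesis
    by (simp add: power2_eq_iff_nonneg)
qed

lemma Im_cinner: "Im (cinner x y) = inner (- \<i> *\<^sub>C x) (y :: 'a::complex_inner)"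
  by (simp add: inner_eq_Re_cinner cinner_scaleC_left)

lemma cmod_cinner_le: "cmod (cinner x y) \<le> (norm x)\<^sup>2 + (norm (y :: 'a::complex_inner))\<^sup>2"
proof -
  have "cmod (cinner x y) \<le> \<bar>Re (cinner x y)\<bar> + \<bar>Im (cinner x y)\<bar>"
    by (rule cmod_le)
  also have "\<bar>Re (cinner x y)\<bar> \<le> norm x * norm y"
    using Cauchy_Schwarz_ineq2[of x y] by (simp add: inner_eq_Re_cinner)
  also have "\<bar>Im (cinner x y)\<bar> \<le> norm x * norm y"
    using Cauchy_Schwarz_ineq2[of "- \<i> *\<^sub>C x" y] by (simp add: Im_cinner norm_scaleC)
  also have "norm x * norm y + norm x * norm y \<le> (norm x)\<^sup>2 + (norm y)\<^sup>2"
    using sum_squares_bound[of "norm x" "norm y"] by simp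
  finally show ?thesis by simp
qed

subsection \<open>Direct sums\<close>

instantiation prod :: (complex_vector, complex_vector) complex_vector
begin
definition scaleC_prod :: "complex \<Rightarrow> 'a \<times> 'b \<Rightarrow> 'a \<times> 'b"
  where "scaleC_prod a x = (a *\<^sub>C fst x, a *\<^sub>C snd x)"
instance
  by standard
    (auto simp: scaleC_prod_def scaleC_add_right scaleC_add_left scaleC_scaleC scaleC_one
      scaleR_scaleC prod_eq_iff)
end

instantiation prod :: (complex_inner, complex_inner) complex_inner
begin
definition cinner_prod :: "'a \<times> 'b \<Rightarrow> 'a \<times> 'b \<Rightarrow> complex"
  where "cinner_prod x y = cinner (fst x) (fst y) + cinner (snd x) (snd y)"
instance
proof
  fix x y z :: "'a \<times> 'b" and a :: complex
  show "cinner x y = cnj (cinner y x)"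
    unfolding cinner_prod_def complex_cnj_add
    by (rule arg_cong2[where f = plus]) (rule cinner_commute)+
qed (auto simp: cinner_prod_def scaleC_prod_def cinner_add_left cinner_scaleC_left inner_prod_def
      inner_eq_Re_cinner algebra_simps)
end

instance prod :: (chilbert_space, chilbert_space) chilbert_space ..

subsection \<open>Square-summable families\<close>

typedef (overloaded) ('i, 'a::complex_inner) ell2 =
  "{f :: 'i \<Rightarrow> 'a. (\<lambda>i. (norm (f i))\<^sup>2) summable_on UNIV}"
  morphisms ell2_nth Abs_ell2
  by (rule exI[of _ "\<lambda>_. 0"]) simp

setup_lifting type_definition_ell2

lemma ell2_summable: "(\<lambda>i. (norm (ell2_nth f i))\<^sup>2) summable_on UNIV"
  using ell2_nth[of f] by simp

lemma square_summable_add: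
  fixes f g :: "'i \<Rightarrow> 'a::real_normed_vector"
  assumes "(\<lambda>i. (norm (f i))\<^sup>2) summable_on UNIV" "(\<lambda>i. (norm (g i))\<^sup>2) summable_on UNIV"
  shows "(\<lambda>i. (norm (f i + g i))\<^sup>2) summable_on UNIV"
proof (rule summable_on_comparison_test)
  show "(\<lambda>i. 2 * ((norm (f i))\<^sup>2 + (norm (g i))\<^sup>2)) summable_on UNIV"
    by (intro summable_on_cmult_right summable_on_add assms)
  fix i
  have "(norm (f i + g i))\<^sup>2 \<le> (norm (f i) + norm (g i))\<^sup>2"
    by (intro power_mono norm_triangle_ineq) simp
  also have "\<dots> \<le> 2 * ((norm (f i))\<^sup>2 + (norm (g i))\<^sup>2)"
    using sum_squares_bound[of "norm (f i)" "norm (g i)"] by (simp add: power2_sum)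
  finally show "(norm (f i + g i))\<^sup>2 \<le> 2 * ((norm (f i))\<^sup>2 + (norm (g i))\<^sup>2)" .
qed simp

lemma square_summable_scaleC:
  fixes f :: "'i \<Rightarrow> 'a::complex_inner"
  assumes "(\<lambda>i. (norm (f i))\<^sup>2) summable_on UNIV"
  shows "(\<lambda>i. (norm (a *\<^sub>C f i))\<^sup>2) summable_on UNIV"
  using summable_on_cmult_right[OF assms] by (simp add: norm_scaleC power_mult_distrib)

lemma ell2_cinner_summable:
  fixes f g :: "('i, 'a::complex_inner) ell2"
  shows "(\<lambda>i. cinner (ell2_nth f i) (ell2_nth g i)) summable_on UNIV"
proof (rule abs_summable_summable, rule Infinite_Sum.abs_summable_on_comparison_test')
  show "(\<lambda>i. (norm (ell2_nth f i))\<^sup>2 + (norm (ell2_nth g i))\<^sup>2) summable_on UNIV"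
    by (intro summable_on_add ell2_summable)
qed (rule cmod_cinner_le)

lemma ell2_Re_cinner_self:
  fixes f :: "('i, 'a::complex_inner) ell2"
  shows "Re (\<Sum>\<^sub>\<infinity>i. cinner (ell2_nth f i) (ell2_nth f i)) = (\<Sum>\<^sub>\<infinity>i. (norm (ell2_nth f i))\<^sup>2)"
  by (subst infsum_Re[OF ell2_cinner_summable, symmetric]) (simp add: cinner_self del: of_real_power)

instantiation ell2 :: (type, complex_inner) complex_vector
begin

lift_definition zero_ell2 :: "('a, 'b) ell2" is "\<lambda>_. 0" by simp

lift_definition plus_ell2 :: "('a, 'b) ell2 \<Rightarrow> ('a, 'b) ell2 \<Rightarrow> ('a, 'b) ell2"
  is "\<lambda>f g i. f i + g i" by (rule square_summable_add)

lift_definition uminus_ell2 :: "('a, 'b) ell2 \<Rightarrow> ('a, 'b) ell2"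
  is "\<lambda>f i. - f i" by simp

lift_definition minus_ell2 :: "('a, 'b) ell2 \<Rightarrow> ('a, 'b) ell2 \<Rightarrow> ('a, 'b) ell2"
  is "\<lambda>f g i. f i - g i"
  subgoal for f g using square_summable_add[of f "\<lambda>i. - g i"] by simp
  done

lift_definition scaleC_ell2 :: "complex \<Rightarrow> ('a, 'b) ell2 \<Rightarrow> ('a, 'b) ell2"
  is "\<lambda>a f i. a *\<^sub>C f i" by (rule square_summable_scaleC)

lift_definition scaleR_ell2 :: "real \<Rightarrow> ('a, 'b) ell2 \<Rightarrow> ('a, 'b) ell2"
  is "\<lambda>r f i. r *\<^sub>R f i" unfolding scaleR_scaleC by (rule square_summable_scaleC)

instance
  by standard
    (transfer; simp add: fun_eq_iff scaleC_add_right scaleC_add_left scaleC_scaleC scaleC_one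
      scaleR_scaleC algebra_simps scaleR_add_left scaleR_add_right)+

end

instantiation ell2 :: (type, complex_inner) complex_inner
begin

definition cinner_ell2 :: "('a, 'b) ell2 \<Rightarrow> ('a, 'b) ell2 \<Rightarrow> complex"
  where "cinner_ell2 f g = (\<Sum>\<^sub>\<infinity>i. cinner (ell2_nth f i) (ell2_nth g i))"

definition inner_ell2 :: "('a, 'b) ell2 \<Rightarrow> ('a, 'b) ell2 \<Rightarrow> real"
  where "inner_ell2 f g = Re (cinner f g)"

definition norm_ell2 :: "('a, 'b) ell2 \<Rightarrow> real"
  where "norm_ell2 f = sqrt (inner f f)"

definition dist_ell2 :: "('a, 'b) ell2 \<Rightarrow> ('a, 'b) ell2 \<Rightarrow> real"
  where "dist_ell2 f g = norm (f - g)"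

definition sgn_ell2 :: "('a, 'b) ell2 \<Rightarrow> ('a, 'b) ell2"
  where "sgn_ell2 f = f /\<^sub>R norm f"

definition uniformity_ell2 :: "(('a, 'b) ell2 \<times> ('a, 'b) ell2) filter"
  where "uniformity_ell2 = (INF e\<in>{0<..}. principal {(f, g). dist f g < e})"

definition open_ell2 :: "('a, 'b) ell2 set \<Rightarrow> bool"
  where "open_ell2 U \<longleftrightarrow>
    (\<forall>f\<in>U. eventually (\<lambda>(f', g). f' = f \<longrightarrow> g \<in> U) uniformity)"

instance
proof
  fix f g h :: "('a, 'b) ell2" and a :: complex and r :: real
  show cadd: "cinner (f + g) h = cinner f h + cinner g h" for f g h :: "('a, 'b) ell2"
    by (simp add: cinner_ell2_def plus_ell2.rep_eq cinner_add_left infsum_add ell2_cinner_summable)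
  show cscale: "cinner (a *\<^sub>C f) g = a * cinner f g" for a and f g :: "('a, 'b) ell2"
    by (simp add: cinner_ell2_def scaleC_ell2.rep_eq cinner_scaleC_left infsum_cmult_right
        ell2_cinner_summable)
  show ccom: "cinner f g = cnj (cinner g f)" for f g :: "('a, 'b) ell2"
    unfolding cinner_ell2_def infsum_cnj[symmetric] by (rule infsum_cong) (rule cinner_commute)
  show "inner f g = Re (cinner f g)" by (rule inner_ell2_def)
  show "dist f g = norm (f - g)" by (rule dist_ell2_def)
  show "sgn f = f /\<^sub>R norm f" by (rule sgn_ell2_def)
  show "(uniformity :: (('a, 'b) ell2 \<times> ('a, 'b) ell2) filter) =
      (INF e\<in>{0<..}. principal {(f, g). dist f g < e})"
    by (rule uniformity_ell2_def)
  show "open U = (\<forall>f\<in>U. \<forall>\<^sub>F (f', g) in uniformity. f' = f \<longrightarrow> g \<in> U)"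
    for U :: "('a, 'b) ell2 set"
    by (rule open_ell2_def)
  show "inner f g = inner g f"
    unfolding inner_ell2_def by (subst ccom) simp
  show "inner (f + g) h = inner f h + inner g h"
    by (simp add: inner_ell2_def cadd)
  show "inner (r *\<^sub>R f) g = r * inner f g"
    by (simp add: inner_ell2_def scaleR_scaleC cscale)
  show "norm f = sqrt (inner f f)" by (rule norm_ell2_def)
  have eq: "inner f f = (\<Sum>\<^sub>\<infinity>i. (norm (ell2_nth f i))\<^sup>2)"
    unfolding inner_ell2_def cinner_ell2_def by (rule ell2_Re_cinner_self)
  show "0 \<le> inner f f"
    unfolding eq by (rule infsum_nonneg) simp
  show "inner f f = 0 \<longleftrightarrow> f = 0"
  proof
    assume "inner f f = 0"
    then have "(norm (ell2_nth f i))\<^sup>2 = 0" for i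
      using nonneg_infsum_le_0D[of "\<lambda>i. (norm (ell2_nth f i))\<^sup>2" UNIV i] ell2_summable[of f]
      by (simp add: eq)
    then have "ell2_nth f = (\<lambda>_. 0)" by (simp add: fun_eq_iff)
    then show "f = 0" by (simp add: zero_ell2.rep_eq flip: ell2_nth_inject)
  next
    assume "f = 0"
    then have "ell2_nth f = (\<lambda>_. 0)" by (simp add: zero_ell2.rep_eq)
    then show "inner f f = 0" unfolding eq by simp
  qed
qed

end

lemma norm_ell2_sq: "(norm (f :: ('i, 'a::complex_inner) ell2))\<^sup>2 = (\<Sum>\<^sub>\<infinity>i. (norm (ell2_nth f i))\<^sup>2)"
  by (simp only: power2_norm_eq_inner[of f] inner_ell2_def cinner_ell2_def ell2_Re_cinner_self)

lemma sum_le_norm_ell2_sq: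
  fixes f :: "('i, 'a::complex_inner) ell2"
  assumes "finite I"
  shows "(\<Sum>i\<in>I. (norm (ell2_nth f i))\<^sup>2) \<le> (norm f)\<^sup>2"
  unfolding norm_ell2_sq by (rule finite_sum_le_infsum) (auto simp: assms ell2_summable)

lemma norm_ell2_nth_le: "norm (ell2_nth f i) \<le> norm (f :: ('i, 'a::complex_inner) ell2)"
  by (rule power2_le_imp_le) (use sum_le_norm_ell2_sq[of "{i}" f] in simp_all)

instance ell2 :: (type, chilbert_space) chilbert_space
proof
  fix X :: "nat \<Rightarrow> ('a, 'b) ell2"
  assume X: "Cauchy X"
  have "Cauchy (\<lambda>n. ell2_nth (X n) i)" for i
  proof (rule CauchyI)
    fix e :: real assume "0 < e"
    then obtain M where M: "\<forall>m\<ge>M. \<forall>n\<ge>M. norm (X m - X n) < e"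
      using X by (auto dest: CauchyD)
    have "norm (ell2_nth (X m) i - ell2_nth (X n) i) \<le> norm (X m - X n)" for m n
      using norm_ell2_nth_le[of "X m - X n" i] by (simp add: minus_ell2.rep_eq)
    with M show "\<exists>M. \<forall>m\<ge>M. \<forall>n\<ge>M. norm (ell2_nth (X m) i - ell2_nth (X n) i) < e"
      by (meson le_less_trans)
  qed
  then have "\<exists>l. (\<lambda>n. ell2_nth (X n) i) \<longlonglongrightarrow> l" for i
    using Cauchy_convergent convergent_def by blast
  then obtain f where f: "\<And>i. (\<lambda>n. ell2_nth (X n) i) \<longlonglongrightarrow> f i"
    by metis
  have fin: "\<exists>M. \<forall>m\<ge>M. \<forall>I. finite I \<longrightarrow> (\<Sum>i\<in>I. (norm (ell2_nth (X m) i - f i))\<^sup>2) \<le> e\<^sup>2"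
    if e: "0 < e" for e :: real
  proof -
    obtain M where M: "\<forall>m\<ge>M. \<forall>n\<ge>M. norm (X m - X n) < e"
      using X e by (auto dest: CauchyD)
    have "(\<Sum>i\<in>I. (norm (ell2_nth (X m) i - f i))\<^sup>2) \<le> e\<^sup>2" if "m \<ge> M" "finite I" for m I
    proof (rule tendsto_upperbound)
      show "(\<lambda>n. \<Sum>i\<in>I. (norm (ell2_nth (X m) i - ell2_nth (X n) i))\<^sup>2)
          \<longlonglongrightarrow> (\<Sum>i\<in>I. (norm (ell2_nth (X m) i - f i))\<^sup>2)"
        by (intro tendsto_intros f)
      show "\<forall>\<^sub>F n in sequentially.
          (\<Sum>i\<in>I. (norm (ell2_nth (X m) i - ell2_nth (X n) i))\<^sup>2) \<le> e\<^sup>2"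
      proof (rule eventually_sequentiallyI)
        fix n assume "n \<ge> M"
        then have "norm (X m - X n) \<le> e" using M \<open>m \<ge> M\<close> by (simp add: less_imp_le)
        then have "(norm (X m - X n))\<^sup>2 \<le> e\<^sup>2" by (rule power_mono) simp
        with sum_le_norm_ell2_sq[OF \<open>finite I\<close>, of "X m - X n"]
        show "(\<Sum>i\<in>I. (norm (ell2_nth (X m) i - ell2_nth (X n) i))\<^sup>2) \<le> e\<^sup>2"
          by (simp add: minus_ell2.rep_eq)
      qed
    qed simp
    then show ?thesis by blast
  qed
  have summ: "(\<lambda>i. (norm (ell2_nth (X m) i - f i))\<^sup>2) summable_on UNIV"
    if "\<forall>I. finite I \<longrightarrow> (\<Sum>i\<in>I. (norm (ell2_nth (X m) i - f i))\<^sup>2) \<le> c" for m c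
    by (rule nonneg_bdd_above_summable_on) (use that in \<open>auto intro!: bdd_aboveI[of _ c]\<close>)
  obtain M where "\<forall>I. finite I \<longrightarrow> (\<Sum>i\<in>I. (norm (ell2_nth (X M) i - f i))\<^sup>2) \<le> 1\<^sup>2"
    using fin[of 1] by auto
  from summ[OF this] have "(\<lambda>i. (norm (f i - ell2_nth (X M) i))\<^sup>2) summable_on UNIV"
    by (simp add: norm_minus_commute)
  from square_summable_add[OF this ell2_summable[of "X M"]]
  have mem: "(\<lambda>i. (norm (f i))\<^sup>2) summable_on UNIV" by simp
  define L where "L = Abs_ell2 f"
  have L: "ell2_nth L = f" unfolding L_def by (rule Abs_ell2_inverse) (simp add: mem)
  have "X \<longlonglongrightarrow> L"
  proof (rule LIMSEQ_I)
    fix r :: real assume r: "0 < r"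
    obtain M where M: "\<forall>m\<ge>M. \<forall>I. finite I \<longrightarrow>
        (\<Sum>i\<in>I. (norm (ell2_nth (X m) i - f i))\<^sup>2) \<le> (r/2)\<^sup>2"
      using fin[of "r/2"] r by auto
    have "norm (X m - L) < r" if "m \<ge> M" for m
    proof -
      have "(norm (X m - L))\<^sup>2 \<le> (r/2)\<^sup>2"
        unfolding norm_ell2_sq
        by (rule infsum_le_finite_sums[OF ell2_summable])
          (use M that in \<open>simp add: minus_ell2.rep_eq L\<close>)
      then have "norm (X m - L) \<le> r/2"
        by (rule power2_le_imp_le) (use r in simp)
      with r show ?thesis by simp
    qed
    then show "\<exists>no. \<forall>n\<ge>no. norm (X n - L) < r" by blast
  qed
  then show "convergent X" by (rule convergentI)
qed

section \<open>Bounded operators\<close>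

definition bounded_clinear :: "('a::complex_inner \<Rightarrow> 'b::complex_inner) \<Rightarrow> bool"
  where "bounded_clinear T \<longleftrightarrow> bounded_linear T \<and> (\<forall>c x. T (c *\<^sub>C x) = c *\<^sub>C T x)"

definition boundedly_invertible :: "('a::complex_inner \<Rightarrow> 'b::complex_inner) \<Rightarrow> bool"
  where "boundedly_invertible T \<longleftrightarrow>
    bounded_clinear T \<and> (\<exists>S. bounded_clinear S \<and> S \<circ> T = id \<and> T \<circ> S = id)"

definition op_spectrum :: "('a::complex_inner \<Rightarrow> 'a) \<Rightarrow> complex set"
  where "op_spectrum A = {l. \<not> boundedly_invertible (\<lambda>x. l *\<^sub>C x - A x)}"

definition exp_stable :: "('a::complex_inner \<Rightarrow> 'a) \<Rightarrow> bool"
  where "exp_stable A \<longleftrightarrow> op_spectrum A \<subseteq> ball 0 1"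

text \<open>On Hilbert spaces the adjoint of a bounded operator exists and is unique.\<close>

definition cadjoint :: "('a::complex_inner \<Rightarrow> 'b::complex_inner) \<Rightarrow> 'b \<Rightarrow> 'a"
  where "cadjoint T = (SOME S. \<forall>x y. cinner (T x) y = cinner x (S y))"

definition selfadjoint :: "('a::complex_inner \<Rightarrow> 'a) \<Rightarrow> bool"
  where "selfadjoint T \<longleftrightarrow> bounded_clinear T \<and> cadjoint T = T"

definition pos_semidef :: "('a::complex_inner \<Rightarrow> 'a) \<Rightarrow> bool"
  where "pos_semidef T \<longleftrightarrow> selfadjoint T \<and> (\<forall>x. cinner (T x) x \<in> \<real>\<^sub>\<ge>\<^sub>0)"

definition op_le :: "('a::complex_inner \<Rightarrow> 'a) \<Rightarrow> ('a \<Rightarrow> 'a) \<Rightarrow> bool"  (infix \<open>\<preceq>\<close> 50)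
  where "S \<preceq> T \<longleftrightarrow> pos_semidef (\<lambda>x. T x - S x)"

section \<open>Bicausal systems\<close>

record ('xm, 'xp, 'u, 'y) bicausal =
  A_minus :: "'xm \<Rightarrow> 'xm"
  B_minus :: "'u \<Rightarrow> 'xm"
  C_minus :: "'xm \<Rightarrow> 'y"
  A_plus :: "'xp \<Rightarrow> 'xp"
  B_plus :: "'u \<Rightarrow> 'xp"
  C_plus :: "'xp \<Rightarrow> 'y"
  D_op :: "'u \<Rightarrow> 'y"

definition bicausal_system ::
    "('xm::chilbert_space, 'xp::chilbert_space, 'u::chilbert_space, 'y::chilbert_space) bicausal \<Rightarrow> bool"
  where "bicausal_system \<Sigma> \<longleftrightarrow>
    bounded_clinear (A_minus \<Sigma>) \<and> bounded_clinear (B_minus \<Sigma>) \<and> bounded_clinear (C_minus \<Sigma>) \<and>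
    bounded_clinear (A_plus \<Sigma>) \<and> bounded_clinear (B_plus \<Sigma>) \<and> bounded_clinear (C_plus \<Sigma>) \<and>
    bounded_clinear (D_op \<Sigma>)"

text \<open>
  For exponentially stable state operators and \<open>z\<close> on the unit circle the maps under \<^const>\<open>inv\<close>
  are bijective, and the operator norms are bounded uniformly in \<open>z\<close>, so the real supremum below is
  the true one.
\<close>

definition transfer_fun ::
    "('xm::chilbert_space, 'xp::chilbert_space, 'u::chilbert_space, 'y::chilbert_space) bicausal
      \<Rightarrow> complex \<Rightarrow> 'u \<Rightarrow> 'y"
  where "transfer_fun \<Sigma> z u =
    C_minus \<Sigma> (inv (\<lambda>x. x - inverse z *\<^sub>C A_minus \<Sigma> x) (B_minus \<Sigma> u))
    + D_op \<Sigma> u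
    + z *\<^sub>C C_plus \<Sigma> (inv (\<lambda>x. x - z *\<^sub>C A_plus \<Sigma> x) (B_plus \<Sigma> u))"

definition sup_norm_circle :: "(complex \<Rightarrow> 'u::chilbert_space \<Rightarrow> 'y::chilbert_space) \<Rightarrow> real"
  where "sup_norm_circle F = (SUP z\<in>sphere 0 1. onorm (F z))"

subsection \<open>Controllability and observability operators\<close>

text \<open>
  \<^typ>\<open>nat\<close> plays the role of the index set \<open>{0, 1, \<dots>}\<close>, and the following type that of
  \<open>{-1, -2, \<dots>}\<close>. When the state operators are exponentially stable, the sums in
  \<open>Wc_plus\<close> and \<open>Wc_minus\<close> converge absolutely and the families in \<open>Wo_plus\<close> and \<open>Wo_minus\<close>
  are square-summable, so no default value is involved.
\<close>

typedef neg_int = "{n::int. n < 0}"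
  morphisms int_of_neg neg_of_int
  by (rule exI[of _ "-1"]) simp

definition Wc_plus ::
    "('xm::chilbert_space, 'xp::chilbert_space, 'u::chilbert_space, 'y::chilbert_space) bicausal
      \<Rightarrow> (neg_int, 'u) ell2 \<Rightarrow> 'xp"
  where "Wc_plus \<Sigma> u =
    (\<Sum>\<^sub>\<infinity>j. (A_plus \<Sigma> ^^ nat (- int_of_neg j - 1)) (B_plus \<Sigma> (ell2_nth u j)))"

definition Wc_minus ::
    "('xm::chilbert_space, 'xp::chilbert_space, 'u::chilbert_space, 'y::chilbert_space) bicausal
      \<Rightarrow> (nat, 'u) ell2 \<Rightarrow> 'xm"
  where "Wc_minus \<Sigma> u = (\<Sum>\<^sub>\<infinity>j. (A_minus \<Sigma> ^^ j) (B_minus \<Sigma> (ell2_nth u j)))"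

definition Wo_plus ::
    "('xm::chilbert_space, 'xp::chilbert_space, 'u::chilbert_space, 'y::chilbert_space) bicausal
      \<Rightarrow> 'xp \<Rightarrow> (nat, 'y) ell2"
  where "Wo_plus \<Sigma> x = Abs_ell2 (\<lambda>i. C_plus \<Sigma> ((A_plus \<Sigma> ^^ i) x))"

definition Wo_minus ::
    "('xm::chilbert_space, 'xp::chilbert_space, 'u::chilbert_space, 'y::chilbert_space) bicausal
      \<Rightarrow> 'xm \<Rightarrow> (neg_int, 'y) ell2"
  where "Wo_minus \<Sigma> x = Abs_ell2 (\<lambda>i. C_minus \<Sigma> ((A_minus \<Sigma> ^^ nat (- int_of_neg i)) x))"

definition l2_exactly_minimal ::
    "('xm::chilbert_space, 'xp::chilbert_space, 'u::chilbert_space, 'y::chilbert_space) bicausal \<Rightarrow> bool"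
  where "l2_exactly_minimal \<Sigma> \<longleftrightarrow>
    surj (Wc_plus \<Sigma>) \<and> surj (Wc_minus \<Sigma>) \<and>
    surj (cadjoint (Wo_plus \<Sigma>)) \<and> surj (cadjoint (Wo_minus \<Sigma>))"

subsection \<open>The bicausal KYP-inequalities\<close>

text \<open>
  The threefold sums are bracketed as \<open>(X_- \<oplus> X_+) \<oplus> U\<close> and \<open>(X_- \<oplus> X_+) \<oplus> Y\<close>, so that an
  operator \<open>H\<close> on \<open>X_- \<oplus> X_+\<close> is a diagonal block.
\<close>

definition L_op ::
    "('xm::chilbert_space, 'xp::chilbert_space, 'u::chilbert_space, 'y::chilbert_space) bicausal
      \<Rightarrow> ('xm \<times> 'xp) \<times> 'u \<Rightarrow> ('xm \<times> 'xp) \<times> 'y"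
  where "L_op \<Sigma> = (\<lambda>((xm, xp), u).
    ((xm, A_plus \<Sigma> xp + B_plus \<Sigma> u),
     C_minus \<Sigma> (A_minus \<Sigma> xm) + C_plus \<Sigma> xp + (C_minus \<Sigma> (B_minus \<Sigma> u) + D_op \<Sigma> u)))"

definition R_op ::
    "('xm::chilbert_space, 'xp::chilbert_space, 'u::chilbert_space, 'y::chilbert_space) bicausal
      \<Rightarrow> ('xm \<times> 'xp) \<times> 'u \<Rightarrow> ('xm \<times> 'xp) \<times> 'u"
  where "R_op \<Sigma> = (\<lambda>((xm, xp), u). ((A_minus \<Sigma> xm + B_minus \<Sigma> u, xp), u))"

definition diag_id :: "('x \<Rightarrow> 'x) \<Rightarrow> 'x \<times> 'v \<Rightarrow> 'x \<times> 'v"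
  where "diag_id H = (\<lambda>(x, v). (H x, v))"

definition block_op :: "('a::plus \<Rightarrow> 'a) \<Rightarrow> ('b::plus \<Rightarrow> 'a) \<Rightarrow> ('a \<Rightarrow> 'b) \<Rightarrow> ('b \<Rightarrow> 'b) \<Rightarrow> 'a \<times> 'b \<Rightarrow> 'a \<times> 'b"
  where "block_op P Q S T = (\<lambda>(x, y). (P x + Q y, S x + T y))"

definition bicausal_KYP ::
    "('xm::chilbert_space, 'xp::chilbert_space, 'u::chilbert_space, 'y::chilbert_space) bicausal
      \<Rightarrow> ('xm \<times> 'xp \<Rightarrow> 'xm \<times> 'xp) \<Rightarrow> bool"
  where "bicausal_KYP \<Sigma> H \<longleftrightarrow>
    cadjoint (L_op \<Sigma>) \<circ> diag_id H \<circ> L_op \<Sigma> \<preceq> cadjoint (R_op \<Sigma>) \<circ> diag_id H \<circ> R_op \<Sigma>"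

definition strict_bicausal_KYP ::
    "('xm::chilbert_space, 'xp::chilbert_space, 'u::chilbert_space, 'y::chilbert_space) bicausal
      \<Rightarrow> ('xm \<times> 'xp \<Rightarrow> 'xm \<times> 'xp) \<Rightarrow> bool"
  where "strict_bicausal_KYP \<Sigma> H \<longleftrightarrow> (\<exists>\<epsilon>>0.
    (\<lambda>w. (cadjoint (L_op \<Sigma>) \<circ> diag_id H \<circ> L_op \<Sigma>) w
        + \<epsilon>\<^sup>2 *\<^sub>R (cadjoint (R_op \<Sigma>) \<circ> R_op \<Sigma>) w)
    \<preceq> cadjoint (R_op \<Sigma>) \<circ> diag_id H \<circ> R_op \<Sigma>)"

definition admissible_H ::
    "('xm::chilbert_space \<times> 'xp::chilbert_space \<Rightarrow> 'xm \<times> 'xp) \<Rightarrow> bool"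
  where "admissible_H H \<longleftrightarrow> bounded_clinear H \<and> boundedly_invertible H \<and> selfadjoint H \<and>
    (\<exists>H_minus H_zero H_plus.
      bounded_clinear H_minus \<and> bounded_clinear H_zero \<and> bounded_clinear H_plus \<and>
      H = block_op H_minus H_zero (cadjoint H_zero) H_plus)"

end

theory Submission
  imports Defs
begin

text \<open>
  If \<open>H\<close> solves the KYP-inequality, inserting the trajectory \<open>z\<^sup>-\<^sup>n (\<eta>, \<xi>)\<close> driven by the input
  \<open>z\<^sup>-\<^sup>n u\<close> with \<open>|z| = 1\<close> cancels the storage terms and leaves \<open>\<parallel>F(z) u\<parallel> \<le> \<parallel>u\<parallel>\<close>.

  Conversely, let \<open>S(x\<^sub>-, x\<^sub>+)\<close> be the available storage, the supremum of \<open>\<Sum> \<parallel>y(n)\<parallel>\<^sup>2 - \<parallel>u(n)\<parallel>\<^sup>2\<close> over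
  \<open>n \<ge> 0\<close> and all square-summable inputs steering the anticausal part to \<open>x\<^sub>-\<close> at time \<open>0\<close>. It satisfies
  a parallelogram inequality, so it is the quadratic form of an operator \<open>H\<close>, and prepending one input
  value gives the KYP-inequality. Contractivity of the input-output map on \<open>\<int>\<close>, obtained from that of
  \<open>F\<close> by comparing with periodic steady states and the finite Fourier transform, yields
  \<open>S(0, x\<^sub>+) \<ge> c \<parallel>x\<^sub>+\<parallel>\<^sup>2\<close> and \<open>S(x\<^sub>-, 0) \<le> -c \<parallel>x\<^sub>-\<parallel>\<^sup>2\<close>; hence \<open>diag(-I, I) H\<close> is coercive and \<open>H\<close> is
  invertible. The strict case follows by adjoining small inputs and outputs that make any system
  exactly minimal.
\<close>

text \<open>The anticausal state at time 0 is itself a function of the inputs at times n \<ge> 0, so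
  x_- is a linear constraint on those inputs, while x_+ is a free initial condition. Linearity of
  the constraint lets sums and differences of inputs compete with each other, which makes the
  supremum a quadratic form. The constraint also explains the two signs: x_+ alone shows its
  observability energy under zero future input, whereas for x_- alone, with zero past input, that
  energy appears at negative times and contractivity charges it to the future. Two obstacles shape
  the preparations. Contractivity of F is a condition at single points of the circle, but the
  storage needs an energy inequality in time; working with finite windows and roots of unity keeps
  everything within finite sums, and the price is a mismatch at the ends of the window. That
  mismatch has to die out geometrically, although stability is given only through the spectrum.
  Since x_-(n) depends on x_-(n+1), one time step is parametrised by x_-(n+1), x_+(n) and u(n);
  these are the variables on which L and R act.\<close>

instance chilbert_space \<subseteq> banach ..

section \<open>Operator algebra and adjoints through the real inner product\<close>

section \<open>Complex-linear operators on Hilbert spaces\<close>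

lemma scaleC_zero_right [simp]: "a *\<^sub>C (0 :: 'a::complex_vector) = 0"
  using scaleC_add_right[of a "0 :: 'a" 0] by simp

lemma scaleC_zero_left [simp]: "0 *\<^sub>C (x :: 'a::complex_vector) = 0"
  using scaleC_add_left[of 0 0 x] by simp

lemma scaleC_minus_right: "a *\<^sub>C (- x) = - (a *\<^sub>C (x :: 'a::complex_vector))"
  using scaleC_add_right[of a x "- x"] by (simp add: add_eq_0_iff)

lemma scaleC_diff_right: "a *\<^sub>C (x - y) = a *\<^sub>C x - a *\<^sub>C (y :: 'a::complex_vector)"
  using scaleC_add_right[of a x "- y"] by (simp add: scaleC_minus_right)

lemma scaleC_sum_right: "a *\<^sub>C (\<Sum>i\<in>I. f i) = (\<Sum>i\<in>I. a *\<^sub>C (f i :: 'a::complex_vector))"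
  by (induction I rule: infinite_finite_induct) (auto simp: scaleC_add_right)

lemma scaleC_sum_left: "(\<Sum>i\<in>I. f i) *\<^sub>C x = (\<Sum>i\<in>I. f i *\<^sub>C (x :: 'a::complex_vector))"
  by (induction I rule: infinite_finite_induct) (auto simp: scaleC_add_left)

lemma scaleC_fst [simp]: "fst (a *\<^sub>C p) = a *\<^sub>C fst p"
  and scaleC_snd [simp]: "snd (a *\<^sub>C p) = a *\<^sub>C snd p"
  by (simp_all add: scaleC_prod_def)

lemma scaleC_Pair: "a *\<^sub>C (x, y) = (a *\<^sub>C x, a *\<^sub>C y)"
  by (simp add: scaleC_prod_def)

lemma cinner_scaleC_right: "cinner x (a *\<^sub>C y) = cnj a * cinner x (y :: 'a::complex_inner)"
  by (metis cinner_commute cinner_scaleC_left complex_cnj_cnj complex_cnj_mult)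

lemma cinner_sum_left: "cinner (\<Sum>i\<in>I. f i) y = (\<Sum>i\<in>I. cinner (f i) (y :: 'a::complex_inner))"
proof (induction I rule: infinite_finite_induct)
  have "cinner (0 :: 'a) y = 0" using cinner_scaleC_left[of 0 "0 :: 'a" y] by simp
  then show "\<And>A. infinite A \<Longrightarrow> cinner (\<Sum>i\<in>A. f i) y = (\<Sum>i\<in>A. cinner (f i) y)"
    and "cinner (\<Sum>i\<in>{}. f i) y = (\<Sum>i\<in>{}. cinner (f i) y)" by simp_all
qed (simp add: cinner_add_left)

lemma cinner_sum_right: "cinner x (\<Sum>i\<in>I. f i) = (\<Sum>i\<in>I. cinner x (f i :: 'a::complex_inner))"
  by (subst cinner_commute, subst cinner_sum_left) (simp flip: cinner_commute)

lemma inner_scaleC_left: "inner (a *\<^sub>C x) y = inner x (cnj a *\<^sub>C (y :: 'a::complex_inner))"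
  by (simp add: inner_eq_Re_cinner cinner_scaleC_left cinner_scaleC_right)

lemma bounded_clinearD:
  assumes "bounded_clinear T"
  shows bounded_clinear_linear: "bounded_linear T"
    and bounded_clinear_add: "T (x + y) = T x + T y"
    and bounded_clinear_diff: "T (x - y) = T x - T y"
    and bounded_clinear_scaleC: "T (a *\<^sub>C x) = a *\<^sub>C T x"
    and bounded_clinear_zero: "T 0 = 0"
    and bounded_clinear_sum: "T (\<Sum>i\<in>I. f i) = (\<Sum>i\<in>I. T (f i))"
proof -
  show bl: "bounded_linear T" using assms by (simp add: bounded_clinear_def)
  interpret bounded_linear T by (rule bl)
  show "T (x + y) = T x + T y" "T (x - y) = T x - T y" "T 0 = 0"
     "T (\<Sum>i\<in>I. f i) = (\<Sum>i\<in>I. T (f i))"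
    by (simp_all add: add diff zero sum)
  show "T (a *\<^sub>C x) = a *\<^sub>C T x" using assms by (simp add: bounded_clinear_def)
qed

lemma bounded_clinear_bound:
  assumes "bounded_clinear T"
  obtains K where "0 < K" "\<And>x. norm (T x) \<le> K * norm x"
  using bounded_linear.pos_bounded[OF bounded_clinear_linear[OF assms]]
  by (auto simp: mult.commute)

lemma bounded_clinearI:
  assumes "\<And>x y. T (x + y) = T x + T y" "\<And>a x. T (a *\<^sub>C x) = a *\<^sub>C T x"
    "\<And>x. norm (T x) \<le> K * norm x"
  shows "bounded_clinear T"
  unfolding bounded_clinear_def
  by (intro conjI allI bounded_linear_intro[of _ K])
    (use assms in \<open>auto simp: scaleR_scaleC mult.commute\<close>)

lemma bounded_clinear_compose:
  "bounded_clinear T \<Longrightarrow> bounded_clinear S \<Longrightarrow> bounded_clinear (\<lambda>x. T (S x))"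
  by (auto simp: bounded_clinear_def intro: bounded_linear_compose)

lemma bounded_clinear_plus:
  "bounded_clinear T \<Longrightarrow> bounded_clinear S \<Longrightarrow> bounded_clinear (\<lambda>x. T x + S x)"
  by (auto simp: bounded_clinear_def scaleC_add_right intro: bounded_linear_add)

lemma bounded_clinear_minus:
  "bounded_clinear T \<Longrightarrow> bounded_clinear S \<Longrightarrow> bounded_clinear (\<lambda>x. T x - S x)"
  by (auto simp: bounded_clinear_def scaleC_diff_right intro: bounded_linear_sub)

lemma bounded_clinear_id: "bounded_clinear (\<lambda>x. x)"
  by (auto simp: bounded_clinear_def)

lemma bounded_clinear_const_zero: "bounded_clinear (\<lambda>x. 0)"
  by (auto simp: bounded_clinear_def)

lemma bounded_linear_scaleC: "bounded_linear (\<lambda>x :: 'a::complex_inner. a *\<^sub>C x)"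
  by (rule bounded_linear_intro[of _ "cmod a"])
    (auto simp: scaleC_add_right scaleR_scaleC scaleC_scaleC norm_scaleC mult.commute)

lemma bounded_clinear_scaleC_const:
  "bounded_clinear T \<Longrightarrow> bounded_clinear (\<lambda>x. a *\<^sub>C T x)"
  using bounded_linear_compose[OF bounded_linear_scaleC bounded_clinear_linear, of T a]
  by (auto simp: bounded_clinear_def scaleC_scaleC mult.commute)

lemma bounded_clinear_scaleR_const:
  "bounded_clinear T \<Longrightarrow> bounded_clinear (\<lambda>x. r *\<^sub>R T x)"
  unfolding scaleR_scaleC by (rule bounded_clinear_scaleC_const)

lemma bounded_clinear_fst: "bounded_clinear T \<Longrightarrow> bounded_clinear (\<lambda>x. fst (T x))"
  by (auto simp: bounded_clinear_def intro: bounded_linear_fst_comp)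

lemma bounded_clinear_snd: "bounded_clinear T \<Longrightarrow> bounded_clinear (\<lambda>x. snd (T x))"
  by (auto simp: bounded_clinear_def intro: bounded_linear_snd_comp)

lemma bounded_clinear_Pair:
  "bounded_clinear T \<Longrightarrow> bounded_clinear S \<Longrightarrow> bounded_clinear (\<lambda>x. (T x, S x))"
  by (auto simp: bounded_clinear_def scaleC_Pair intro: bounded_linear_Pair)

lemmas bounded_clinear_intros = bounded_clinear_plus bounded_clinear_minus bounded_clinear_id
  bounded_clinear_const_zero bounded_clinear_scaleC_const bounded_clinear_scaleR_const
  bounded_clinear_fst bounded_clinear_snd bounded_clinear_Pair

lemma bounded_clinear_power: "bounded_clinear (A :: 'a::complex_inner \<Rightarrow> 'a) \<Longrightarrow> bounded_clinear (A ^^ n)"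
  by (induction n) (auto simp: o_def id_def intro: bounded_clinear_id bounded_clinear_compose)

lemma bounded_clinear_inv:
  assumes T: "bounded_clinear T" "bij T" and K: "\<And>x. norm x \<le> K * norm (T x)"
  shows "bounded_clinear (inv T)"
proof (rule bounded_clinearI)
  have TI: "T (inv T y) = y" for y using T(2) by (simp add: bij_is_surj surj_f_inv_f)
  have eq: "inv T y = x" if "T x = y" for x y
    using T(2) that by (metis bij_inv_eq_iff)
  show "inv T (x + y) = inv T x + inv T y" for x y
    by (rule eq) (simp add: bounded_clinear_add[OF T(1)] TI)
  show "inv T (a *\<^sub>C x) = a *\<^sub>C inv T x" for a x
    by (rule eq) (simp add: bounded_clinear_scaleC[OF T(1)] TI)
  show "norm (inv T x) \<le> K * norm x" for x using K[of "inv T x"] by (simp add: TI)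
qed

subsection \<open>The Riesz representation and adjoints\<close>

text \<open>The functional \<open>\<phi>\<close> is bounded below, its minimising sequences are
  Cauchy by the parallelogram law, and its first variation at the minimiser a is 2 (<a, x> - f x),
  which must vanish. Real scalars suffice because the complex inner product is determined by its
  real part.\<close>

lemma Riesz_representation:
  fixes f :: "'a::{real_inner, complete_space} \<Rightarrow> real"
  assumes "bounded_linear f"
  shows "\<exists>a. \<forall>x. f x = inner a x"
proof -
  interpret f: bounded_linear f by (rule assms)
  obtain K where K: "\<And>x. \<bar>f x\<bar> \<le> norm x * K" using f.bounded by auto
  define \<phi> where "\<phi> = (\<lambda>x. (norm x)\<^sup>2 - 2 * f x)"
  have lower: "- K\<^sup>2 \<le> \<phi> x" for x
  proof -
    have "0 \<le> (norm x - K)\<^sup>2" by simp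
    also have "\<dots> = (norm x)\<^sup>2 - 2 * (norm x * K) + K\<^sup>2" by (simp add: power2_diff algebra_simps)
    finally show ?thesis using K[of x] by (simp add: \<phi>_def)
  qed
  define m where "m = (INF x. \<phi> x)"
  have bdd: "bdd_below (range \<phi>)" by (rule bdd_belowI2) (rule lower)
  have m_le: "m \<le> \<phi> x" for x unfolding m_def by (rule cINF_lower[OF bdd]) simp
  have "\<exists>x. \<phi> x < m + inverse (real (Suc n))" for n
    using cINF_less_iff[OF UNIV_not_empty bdd, of "m + inverse (real (Suc n))"]
    by (auto simp flip: m_def)
  then obtain X where X: "\<And>n. \<phi> (X n) < m + inverse (real (Suc n))" by metis
  have close: "(norm (x - y))\<^sup>2 \<le> 2 * (\<phi> x - m) + 2 * (\<phi> y - m)" for x y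
  proof -
    have "(norm (x - y))\<^sup>2 = 2 * \<phi> x + 2 * \<phi> y - 4 * \<phi> ((1/2) *\<^sub>R (x + y))"
      unfolding \<phi>_def f.scaleR f.add power2_norm_eq_inner
      by (simp add: inner_simps inner_commute field_simps)
    with m_le[of "(1/2) *\<^sub>R (x + y)"] show ?thesis by simp
  qed
  have "Cauchy X"
  proof (rule metric_CauchyI)
    fix e :: real assume "0 < e"
    obtain M where M: "inverse (real (Suc M)) < e\<^sup>2 / 4"
      using reals_Archimedean[of "e\<^sup>2 / 4"] \<open>0 < e\<close> by auto
    have "dist (X k) (X n) < e" if "k \<ge> M" "n \<ge> M" for k n
    proof -
      have small: "\<phi> (X i) - m < e\<^sup>2 / 4" if "i \<ge> M" for i
      proof -
        have "inverse (real (Suc i)) \<le> inverse (real (Suc M))" using that by auto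
        then show ?thesis using X[of i] M by linarith
      qed
      have "(dist (X k) (X n))\<^sup>2 < e\<^sup>2"
        using close[of "X k" "X n"] small[of k] small[of n] that unfolding dist_norm by argo
      then show ?thesis using \<open>0 < e\<close> by (simp add: power_less_imp_less_base)
    qed
    then show "\<exists>M. \<forall>m\<ge>M. \<forall>n\<ge>M. dist (X m) (X n) < e" by blast
  qed
  then obtain a where a: "X \<longlonglongrightarrow> a" using Cauchy_convergent convergent_def by blast
  have "(\<lambda>n. \<phi> (X n)) \<longlonglongrightarrow> \<phi> a"
    unfolding \<phi>_def by (intro tendsto_intros a f.tendsto)
  moreover have "(\<lambda>n. m + inverse (real (Suc n))) \<longlonglongrightarrow> m"
    using tendsto_add[OF tendsto_const LIMSEQ_inverse_real_of_nat, of m] by simp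
  ultimately have "\<phi> a \<le> m"
    by (rule LIMSEQ_le) (use X in \<open>auto intro: less_imp_le\<close>)
  have "f x = inner a x" for x
  proof (rule ccontr)
    define d where "d = inner a x - f x"
    assume "f x \<noteq> inner a x"
    then have d: "d \<noteq> 0" "x \<noteq> 0" by (auto simp: d_def f.zero)
    \<comment> \<open>The minimiser of 2 t d + t^2 <x, x>: moving from \<open>a\<close> along
      \<open>x\<close> would strictly lower \<open>\<phi>\<close>.\<close>
    define t where "t = - d / inner x x"
    have "\<phi> (a + t *\<^sub>R x) = \<phi> a + (2 * t * d + t\<^sup>2 * inner x x)"
      unfolding \<phi>_def f.scaleR f.add power2_norm_eq_inner d_def
      by (simp add: inner_simps inner_commute algebra_simps power2_eq_square)
    also have "2 * t * d + t\<^sup>2 * inner x x = - d\<^sup>2 / inner x x"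
      using d by (simp add: t_def power2_eq_square field_simps)
    finally have "\<phi> (a + t *\<^sub>R x) = \<phi> a - d\<^sup>2 / inner x x" using d by (simp add: field_simps)
    moreover have "d\<^sup>2 / inner x x > 0" using d by simp
    ultimately show False using m_le[of "a + t *\<^sub>R x"] \<open>\<phi> a \<le> m\<close> by simp
  qed
  then show ?thesis by blast
qed

text \<open>The imaginary part of the inner product is the real inner product with -i x, and
  \<open>T\<close> commutes with the factor -i. Adjoints can therefore be computed with
  \<open>inner\<close> alone.\<close>

lemma cinner_adjointI:
  fixes T :: "'a::complex_inner \<Rightarrow> 'b::complex_inner"
  assumes "\<And>x y. inner (T x) y = inner x (S y)" "\<And>a x. T (a *\<^sub>C x) = a *\<^sub>C T x"
  shows "cinner (T x) y = cinner x (S y)"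
proof (rule complex_eqI)
  show "Re (cinner (T x) y) = Re (cinner x (S y))" using assms(1) by (simp flip: inner_eq_Re_cinner)
  show "Im (cinner (T x) y) = Im (cinner x (S y))"
    unfolding Im_cinner by (simp flip: assms)
qed

lemma cadjoint_unique:
  fixes T :: "'a::complex_inner \<Rightarrow> 'b::complex_inner"
  assumes "\<And>x y. cinner (T x) y = cinner x (S y)"
  shows "cadjoint T = S"
proof
  fix y
  have "\<forall>x y. cinner (T x) y = cinner x (cadjoint T y)"
    unfolding cadjoint_def by (rule someI[of _ S]) (simp add: assms)
  then have "inner x (cadjoint T y) = inner x (S y)" for x
    using assms by (simp add: inner_eq_Re_cinner)
  then show "cadjoint T y = S y" using vector_eq_ldot by blast
qed

lemma inner_cadjoint:
  fixes T :: "'a::chilbert_space \<Rightarrow> 'b::complex_inner"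
  assumes "bounded_clinear T"
  shows "inner (T x) y = inner x (cadjoint T y)"
proof -
  have "\<exists>a. \<forall>x. inner (T x) y = inner a x" for y
    by (rule Riesz_representation)
      (rule bounded_linear_compose[OF bounded_linear_inner_left bounded_clinear_linear[OF assms]])
  then obtain S where "\<And>x y. inner (T x) y = inner (S y) x" by metis
  then have S: "inner (T x) y = inner x (S y)" for x y by (simp add: inner_commute)
  then have "cadjoint T = S"
    by (intro cadjoint_unique cinner_adjointI) (auto simp: bounded_clinear_scaleC[OF assms])
  with S show ?thesis by simp
qed

lemma bounded_clinear_cadjoint:
  fixes T :: "'a::chilbert_space \<Rightarrow> 'b::complex_inner"
  assumes "bounded_clinear T"
  shows "bounded_clinear (cadjoint T)"
proof -
  note adj = inner_cadjoint[OF assms, symmetric]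
  obtain K where K: "0 < K" "\<And>x. norm (T x) \<le> K * norm x" using bounded_clinear_bound[OF assms] by blast
  show ?thesis
  proof (rule bounded_clinearI)
    show "cadjoint T (x + y) = cadjoint T x + cadjoint T y" for x y
      by (rule vector_eq_ldot[THEN iffD1]) (simp add: inner_add_right adj)
    show "cadjoint T (a *\<^sub>C x) = a *\<^sub>C cadjoint T x" for a x
    proof (rule vector_eq_ldot[THEN iffD1], rule allI)
      fix z
      have "inner z (a *\<^sub>C cadjoint T x) = inner (cnj a *\<^sub>C z) (cadjoint T x)"
        by (simp add: inner_scaleC_left)
      then show "inner z (cadjoint T (a *\<^sub>C x)) = inner z (a *\<^sub>C cadjoint T x)"
        by (simp add: adj bounded_clinear_scaleC[OF assms] inner_scaleC_left)
    qed
    show "norm (cadjoint T x) \<le> K * norm x" for x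
    proof -
      let ?y = "cadjoint T x"
      have "(norm ?y)\<^sup>2 = inner (T ?y) x" by (simp add: power2_norm_eq_inner adj)
      also have "\<dots> \<le> norm (T ?y) * norm x" by (rule norm_cauchy_schwarz)
      also have "\<dots> \<le> K * norm ?y * norm x" using K by (intro mult_right_mono) auto
      finally have "norm ?y * norm ?y \<le> norm ?y * (K * norm x)"
        by (simp add: power2_eq_square algebra_simps)
      then show ?thesis using K(1) by (cases "norm ?y = 0") (auto simp: mult_le_cancel_left)
    qed
  qed
qed

lemma cadjoint_eq_self:
  assumes "bounded_clinear T" "\<And>x y. inner (T x) y = inner x (T y)"
  shows "cadjoint T = T"
  by (intro cadjoint_unique cinner_adjointI) (auto simp: assms bounded_clinear_scaleC[OF assms(1)])

lemma selfadjointI: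
  assumes "bounded_clinear T" "\<And>x y. inner (T x) y = inner x (T y)"
  shows "selfadjoint T"
  using assms by (simp add: selfadjoint_def cadjoint_eq_self)

text \<open>A symmetric operator has real values <T x, x>, so the operator order turns into a
  comparison of real quadratic forms.\<close>

lemma pos_semidef_iff:
  fixes T :: "'a::chilbert_space \<Rightarrow> 'a"
  assumes T: "bounded_clinear T" and sym: "\<And>x y. inner (T x) y = inner x (T y)"
  shows "pos_semidef T \<longleftrightarrow> (\<forall>x. 0 \<le> inner (T x) x)"
proof -
  have "Im (cinner (T x) x) = 0" for x
  proof -
    have "cinner (T x) x = cinner x (T x)"
      by (rule cinner_adjointI) (auto simp: sym bounded_clinear_scaleC[OF T])
    also have "\<dots> = cnj (cinner (T x) x)" by (rule cinner_commute)
    finally have "Im (cinner (T x) x) = - Im (cinner (T x) x)" by (metis cnj.sel(2))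
    then show ?thesis by simp
  qed
  then show ?thesis using selfadjointI[OF assms]
    by (auto simp: pos_semidef_def complex_nonneg_Reals_iff inner_eq_Re_cinner)
qed

lemma congruence_props:
  fixes L :: "'a::chilbert_space \<Rightarrow> 'b::chilbert_space"
  assumes L: "bounded_clinear L" and K: "bounded_clinear K" "\<And>x y. inner (K x) y = inner x (K y)"
  shows "bounded_clinear (cadjoint L \<circ> K \<circ> L)"
    and "inner ((cadjoint L \<circ> K \<circ> L) x) y = inner (K (L x)) (L y)"
    and "inner ((cadjoint L \<circ> K \<circ> L) x) y = inner x ((cadjoint L \<circ> K \<circ> L) y)"
proof -
  let ?T = "cadjoint L \<circ> K \<circ> L"
  show "bounded_clinear ?T" unfolding o_def
    by (intro bounded_clinear_compose[OF bounded_clinear_cadjoint[OF L]]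
        bounded_clinear_compose[OF K(1)] L)
  show eq: "inner (?T x) y = inner (K (L x)) (L y)" for x y
    by (simp add: inner_cadjoint[OF L, of y] inner_commute)
  show "inner (?T x) y = inner x (?T y)"
    by (simp only: eq inner_commute[of x] K(2)[of "L x"]) (rule inner_commute)
qed

subsection \<open>Quadratic forms\<close>

text \<open>Cauchy's functional equation. Additivity gives homogeneity over the integers; splitting
  n r into integer and fractional part bounds n |f(r x) - r f(x)| independently of n, which forces
  equality.\<close>

lemma additive_locally_bounded_scaleR:
  fixes f :: "'a::real_normed_vector \<Rightarrow> real"
  assumes add: "\<And>x y. f (x + y) = f x + f y"
    and bd: "\<And>x. \<bar>f x\<bar> \<le> D * (1 + (norm x)\<^sup>2)"
  shows "f (r *\<^sub>R x) = r * f x"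
proof -
  have zero: "f 0 = 0" using add[of 0 0] by simp
  have neg: "f (- x) = - f x" for x using add[of x "- x"] zero by simp
  have nat: "f (real n *\<^sub>R x) = real n * f x" for n x
    by (induction n) (auto simp: zero add scaleR_add_left algebra_simps)
  have int: "f (real_of_int k *\<^sub>R x) = real_of_int k * f x" for k x
    by (cases k rule: int_cases2) (auto simp: nat neg)
  have "D \<ge> 0" using bd[of 0] zero by simp
  define M where "M = D * (1 + (norm x)\<^sup>2) + \<bar>f x\<bar>"
  have "real n * \<bar>f (r *\<^sub>R x) - r * f x\<bar> \<le> M" for n
  proof -
    let ?k = "\<lfloor>real n * r\<rfloor>" and ?t = "frac (real n * r)"
    have split: "real n * r = real_of_int ?k + ?t" by (simp add: frac_def)
    have t: "0 \<le> ?t" "?t \<le> 1" using frac_lt_1[of "real n * r"] by auto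
    have "real n * f (r *\<^sub>R x) = f ((real n * r) *\<^sub>R x)" using nat[of n "r *\<^sub>R x"] by simp
    also have "\<dots> = ?k * f x + f (?t *\<^sub>R x)" by (subst split) (simp add: scaleR_add_left add int)
    finally have "real n * (f (r *\<^sub>R x) - r * f x) = f (?t *\<^sub>R x) - ?t * f x"
      using split by (simp add: algebra_simps) (metis distrib_left mult.commute mult.left_commute)
    then have "real n * \<bar>f (r *\<^sub>R x) - r * f x\<bar> = \<bar>f (?t *\<^sub>R x) - ?t * f x\<bar>"
      by (metis abs_mult abs_of_nat)
    also have "\<dots> \<le> \<bar>f (?t *\<^sub>R x)\<bar> + ?t * \<bar>f x\<bar>"
      using abs_triangle_ineq4[of "f (?t *\<^sub>R x)" "?t * f x"] t by (simp add: abs_mult)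
    also have "?t * \<bar>f x\<bar> \<le> \<bar>f x\<bar>" using t by (simp add: mult_left_le_one_le)
    also have "\<bar>f (?t *\<^sub>R x)\<bar> \<le> D * (1 + (norm x)\<^sup>2)"
    proof (rule order_trans[OF bd])
      have "norm (?t *\<^sub>R x) \<le> norm x" using t by (simp add: mult_left_le_one_le)
      then show "D * (1 + (norm (?t *\<^sub>R x))\<^sup>2) \<le> D * (1 + (norm x)\<^sup>2)"
        using \<open>D \<ge> 0\<close> by (intro mult_left_mono add_left_mono power_mono) auto
    qed
    finally show ?thesis by (simp add: M_def)
  qed
  moreover have "\<exists>n. M < real n * d" if "d > 0" for d
    using reals_Archimedean3[OF that] by blast
  ultimately have "\<not> 0 < \<bar>f (r *\<^sub>R x) - r * f x\<bar>" by (metis not_le)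
  then show ?thesis by simp
qed

text \<open>
  The reverse of the one-sided parallelogram inequality follows by applying it to
  \<open>x + y\<close> and \<open>x - y\<close>; polarization and Riesz then produce the operator.
\<close>

lemma quadratic_form_operator:
  fixes q :: "'a::chilbert_space \<Rightarrow> real"
  assumes par: "\<And>x y. 2 * q x + 2 * q y \<le> q (x + y) + q (x - y)"
    and hom: "\<And>a x. q (a *\<^sub>C x) = (cmod a)\<^sup>2 * q x"
    and bd: "\<And>x. \<bar>q x\<bar> \<le> C * (norm x)\<^sup>2"
  shows "\<exists>H. bounded_clinear H \<and> (\<forall>x y. inner (H x) y = inner x (H y)) \<and> (\<forall>x. inner (H x) x = q x)"
proof -
  have homR: "q (r *\<^sub>R x) = r\<^sup>2 * q x" for r x using hom[of "complex_of_real r" x]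
    by (simp add: scaleR_scaleC)
  have pareq: "q (x + y) + q (x - y) = 2 * q x + 2 * q y" for x y
  proof -
    have "2 * q (x + y) + 2 * q (x - y) \<le> q (2 *\<^sub>R x) + q (2 *\<^sub>R y)"
      using par[of "x + y" "x - y"] by (simp add: scaleR_2)
    then show ?thesis using par[of x y] by (simp add: homR)
  qed
  have q0: "q 0 = 0" using homR[of 0 0] by simp
  have qm: "q (- x) = q x" for x using homR[of "-1" x] by simp
  define b where "b x y = (q (x + y) - q (x - y)) / 4" for x y
  have sym: "b x y = b y x" for x y
    using qm[of "x - y"] by (simp add: b_def add.commute)
  have bxx: "b x x = q x" for x using homR[of 2 x] by (simp add: b_def q0 scaleR_2)
  have b0: "b 0 y = 0" for y by (simp add: b_def qm)
  have mid: "b (u + v) y + b (u - v) y = 2 * b u y" for u v y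
  proof -
    have "u + v + y = (u + y) + v" "u + v - y = (u - y) + v" "u - v + y = (u + y) - v"
      "u - v - y = (u - y) - v" by simp_all
    note eq = this
    show ?thesis
      using pareq[of "u + y" v] pareq[of "u - y" v] unfolding b_def eq by argo
  qed
  have dbl: "b (2 *\<^sub>R u) y = 2 * b u y" for u y using mid[of u u y] by (simp add: b0 scaleR_2)
  have add1: "b (x + x') y = b x y + b x' y" for x x' y
  proof -
    define u v where "u = (1/2) *\<^sub>R (x + x')" and "v = (1/2) *\<^sub>R (x - x')"
    have "x = u + v" "x' = u - v" "x + x' = 2 *\<^sub>R u"
      by (simp_all add: u_def v_def scaleR_add_right[symmetric] scaleR_diff_right[symmetric] scaleR_2[symmetric])
    then show ?thesis using mid[of u v y] dbl[of u y] by simp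
  qed
  have add2: "b x (y + y') = b x y + b x y'" for x y y' using add1[of y y' x] by (simp add: sym)
  have C0: "0 \<le> C * (norm x)\<^sup>2" for x :: 'a using bd[of x] by simp
  have bbd: "\<bar>b x y\<bar> \<le> C / 2 * ((norm x)\<^sup>2 + (norm y)\<^sup>2)" for x y
  proof -
    have "\<bar>b x y\<bar> \<le> (\<bar>q (x + y)\<bar> + \<bar>q (x - y)\<bar>) / 4" by (simp add: b_def)
    also have "\<dots> \<le> (C * (norm (x + y))\<^sup>2 + C * (norm (x - y))\<^sup>2) / 4"
      using bd[of "x + y"] bd[of "x - y"] by simp
    also have "\<dots> = C / 2 * ((norm x)\<^sup>2 + (norm y)\<^sup>2)"
      by (simp add: power2_norm_eq_inner inner_simps inner_commute algebra_simps)
    finally show ?thesis .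
  qed
  have scale2: "b x (r *\<^sub>R y) = r * b x y" for r x y
  proof (rule additive_locally_bounded_scaleR[OF add2])
    fix y
    have "\<bar>b x y\<bar> \<le> C * (norm x)\<^sup>2 / 2 + C * (norm y)\<^sup>2 / 2" using bbd[of x y] by (simp add: algebra_simps)
    also have "\<dots> \<le> (\<bar>C\<bar> * (norm x)\<^sup>2 + \<bar>C\<bar>) * (1 + (norm y)\<^sup>2)"
    proof -
      have "C * (norm x)\<^sup>2 \<le> \<bar>C\<bar> * (norm x)\<^sup>2" "C * (norm y)\<^sup>2 \<le> \<bar>C\<bar> * (norm y)\<^sup>2"
        by (auto intro: mult_right_mono)
      moreover have "0 \<le> \<bar>C\<bar> * (norm x)\<^sup>2 * (norm y)\<^sup>2" "0 \<le> \<bar>C\<bar> * (norm x)\<^sup>2" "0 \<le> \<bar>C\<bar> * (norm y)\<^sup>2" by simp_all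
      moreover have "(\<bar>C\<bar> * (norm x)\<^sup>2 + \<bar>C\<bar>) * (1 + (norm y)\<^sup>2) =
          \<bar>C\<bar> * (norm x)\<^sup>2 + \<bar>C\<bar> + \<bar>C\<bar> * (norm x)\<^sup>2 * (norm y)\<^sup>2 + \<bar>C\<bar> * (norm y)\<^sup>2"
        by (simp add: algebra_simps)
      moreover have "0 \<le> \<bar>C\<bar>" by simp
      ultimately show ?thesis by argo
    qed
    finally show "\<bar>b x y\<bar> \<le> (\<bar>C\<bar> * (norm x)\<^sup>2 + \<bar>C\<bar>) * (1 + (norm y)\<^sup>2)" .
  qed
  have scale1: "b (r *\<^sub>R x) y = r * b x y" for r x y using scale2[of y r x] by (simp add: sym)
  \<comment> \<open>The estimate \<open>bbd\<close> is quadratic in both arguments; on unit vectors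
    it reads \<open>C\<close>, and rescaling makes it a bound by the product of the norms.\<close>
  have bCS: "\<bar>b x y\<bar> \<le> C * norm x * norm y" for x y
  proof (cases "x = 0 \<or> y = 0")
    case True then show ?thesis by (auto simp: b0 sym[of _ 0])
  next
    case False
    then have "b x y = norm x * norm y * b (x /\<^sub>R norm x) (y /\<^sub>R norm y)" by (simp add: scale1 scale2 field_simps)
    moreover have "\<bar>b (x /\<^sub>R norm x) (y /\<^sub>R norm y)\<bar> \<le> C"
      using bbd[of "x /\<^sub>R norm x" "y /\<^sub>R norm y"] False by simp
    then have "norm x * norm y * \<bar>b (x /\<^sub>R norm x) (y /\<^sub>R norm y)\<bar> \<le> norm x * norm y * C"
      by (rule mult_left_mono) simp
    ultimately show ?thesis by (simp add: abs_mult mult_ac)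
  qed
  have "\<exists>a. \<forall>y. b x y = inner a y" for x
    by (intro Riesz_representation bounded_linear_intro[of _ "C * norm x"])
      (use bCS[of x] in \<open>auto simp: add2 scale2 mult.commute\<close>)
  then obtain H where H: "\<And>x y. inner (H x) y = b x y" by metis
  have bi: "b (a *\<^sub>C x) (a *\<^sub>C y) = (cmod a)\<^sup>2 * b x y" for a x y
    by (simp add: b_def hom flip: scaleC_add_right scaleC_diff_right right_diff_distrib)
  \<comment> \<open>By \<open>bi\<close>, the form \<open>b\<close> is invariant under multiplying
    both arguments by i, so i can be moved to the second argument as -i.\<close>
  have ci: "H (\<i> *\<^sub>C x) = \<i> *\<^sub>C H x" for x
  proof (rule vector_eq_rdot[THEN iffD1], rule allI)
    fix z :: 'a
    have "\<i> *\<^sub>C (- \<i>) *\<^sub>C z = z" by (simp add: scaleC_scaleC scaleC_one)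
    then have "b (\<i> *\<^sub>C x) z = b x ((- \<i>) *\<^sub>C z)" using bi[of \<i> x "(- \<i>) *\<^sub>C z"] by simp
    then show "inner (H (\<i> *\<^sub>C x)) z = inner (\<i> *\<^sub>C H x) z" by (simp add: inner_scaleC_left H)
  qed
  have addH: "H (x + y) = H x + H y" for x y
    by (rule vector_eq_rdot[THEN iffD1]) (simp add: inner_simps H add1)
  have scaleH: "H (r *\<^sub>R x) = r *\<^sub>R H x" for r x
    by (rule vector_eq_rdot[THEN iffD1]) (simp add: inner_simps H scale1)
  have "bounded_clinear H"
  proof (rule bounded_clinearI)
    show "H (x + y) = H x + H y" for x y by (rule addH)
    show "H (a *\<^sub>C x) = a *\<^sub>C H x" for a x
    proof -
      have dec: "a *\<^sub>C y = Re a *\<^sub>R y + Im a *\<^sub>R \<i> *\<^sub>C y" for y :: 'a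
        by (simp add: scaleR_scaleC scaleC_scaleC flip: scaleC_add_left)
          (metis complex_eq mult.commute)
      show ?thesis by (simp add: dec[of x] dec[of "H x"] addH scaleH ci)
    qed
    show "norm (H x) \<le> C * norm x" for x
    proof (cases "H x = 0")
      case True then show ?thesis
        using C0[of x] by (cases "x = 0") (auto simp: zero_le_mult_iff)
    next
      case False
      have "(norm (H x))\<^sup>2 \<le> C * norm x * norm (H x)"
        using bCS[of x "H x"] H[of x "H x"] by (simp add: power2_norm_eq_inner)
      then show ?thesis using False by (simp add: power2_eq_square)
    qed
  qed
  moreover have "inner (H x) y = inner x (H y)" for x y
    by (metis H sym inner_commute)
  ultimately show ?thesis by (intro exI[of _ H]) (auto simp: H bxx)
qed

text \<open>Lax-Milgram by contraction: T x = y is a fixed point equation for x - t (T x - y), whose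
  squared Lipschitz factor is at most 1 - 2 t c + t^2 M^2. The choice t = c / M^2 minimises
  this.\<close>

lemma coercive_bij:
  fixes T :: "'a::{real_inner, complete_space} \<Rightarrow> 'a"
  assumes T: "bounded_linear T" and c: "0 < c" "\<And>x. c * (norm x)\<^sup>2 \<le> inner (T x) x"
  shows "bij T" and "norm x \<le> (1 / c) * norm (T x)"
proof -
  interpret bounded_linear T by (rule T)
  have lower: "c * norm x \<le> norm (T x)" for x
  proof (cases "x = 0")
    case False
    have "c * (norm x)\<^sup>2 \<le> norm (T x) * norm x"
      using c(2)[of x] norm_cauchy_schwarz[of "T x" x] by linarith
    then show ?thesis using False by (simp add: power2_eq_square mult.assoc[symmetric])
  qed simp
  then show "norm x \<le> (1 / c) * norm (T x)" using c(1) by (simp add: field_simps)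
  obtain M where M: "0 < M" "\<And>x. norm (T x) \<le> norm x * M" using pos_bounded by blast
  define t where "t = c / M\<^sup>2"
  \<comment> \<open>\<open>max 0\<close> covers M < c, which can happen only on the zero
    space.\<close>
  define k where "k = sqrt (max 0 (1 - c\<^sup>2 / M\<^sup>2))"
  have k: "0 \<le> k" "k < 1" using c M by (auto simp: k_def)
  have t: "0 < t" using c M by (simp add: t_def)
  have contr: "norm (x - t *\<^sub>R T x) \<le> k * norm x" for x
  proof -
    have "(norm (x - t *\<^sub>R T x))\<^sup>2 = (norm x)\<^sup>2 - 2 * t * inner (T x) x + t\<^sup>2 * (norm (T x))\<^sup>2"
      unfolding power2_norm_eq_inner by (simp add: inner_simps inner_commute algebra_simps power2_eq_square)
    also have "\<dots> \<le> (norm x)\<^sup>2 - 2 * t * (c * (norm x)\<^sup>2) + t\<^sup>2 * (M\<^sup>2 * (norm x)\<^sup>2)"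
    proof -
      have "t * (c * (norm x)\<^sup>2) \<le> t * inner (T x) x" using t c by simp
      moreover have "(norm (T x))\<^sup>2 \<le> M\<^sup>2 * (norm x)\<^sup>2"
        using power_mono[OF M(2)[of x], of 2] by (simp add: power_mult_distrib mult.commute)
      then have "t\<^sup>2 * (norm (T x))\<^sup>2 \<le> t\<^sup>2 * (M\<^sup>2 * (norm x)\<^sup>2)" by (rule mult_left_mono) simp
      ultimately show ?thesis by linarith
    qed
    also have "\<dots> = (1 - c\<^sup>2 / M\<^sup>2) * (norm x)\<^sup>2"
      using M by (simp add: t_def power2_eq_square field_simps)
    also have "\<dots> \<le> max 0 (1 - c\<^sup>2 / M\<^sup>2) * (norm x)\<^sup>2"
      by (rule mult_right_mono) auto
    also have "\<dots> = (k * norm x)\<^sup>2" by (simp add: k_def power_mult_distrib)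
    finally show ?thesis by (rule power2_le_imp_le) (use k in simp)
  qed
  have "\<exists>x. T x = y" for y
  proof -
    have "\<exists>!x. x - t *\<^sub>R (T x - y) = x"
    proof (rule banach_fix_type[OF k], intro allI)
      fix x x'
      have "(x - t *\<^sub>R (T x - y)) - (x' - t *\<^sub>R (T x' - y)) = (x - x') - t *\<^sub>R T (x - x')"
        by (simp add: diff algebra_simps)
      then show "dist (x - t *\<^sub>R (T x - y)) (x' - t *\<^sub>R (T x' - y)) \<le> k * dist x x'"
        using contr[of "x - x'"] unfolding dist_norm by (simp only:)
    qed
    then show ?thesis using t by auto
  qed
  moreover have "inj T"
    unfolding inj_iff_eq_0 using lower c(1) by (metis mult_le_0_iff norm_le_zero_iff norm_zero not_less)
  ultimately show "bij T" by (metis bijI surjI)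
qed

text \<open>\<open>H\<close> itself may be indefinite; the involution \<open>J\<close> corrects its
  sign, and (J H)^{-1} J inverts \<open>H\<close>.\<close>

lemma boundedly_invertible_if_coercive:
  fixes H J :: "'a::chilbert_space \<Rightarrow> 'a"
  assumes H: "bounded_clinear H" and J: "bounded_clinear J" "\<And>x. J (J x) = x"
    and c: "0 < c" "\<And>x. c * (norm x)\<^sup>2 \<le> inner (J (H x)) x"
  shows "boundedly_invertible H"
proof -
  let ?T = "\<lambda>x. J (H x)"
  have T: "bounded_clinear ?T" by (rule bounded_clinear_compose[OF J(1) H])
  note co = coercive_bij[OF bounded_clinear_linear[OF T] c]
  have S: "bounded_clinear (\<lambda>x. inv ?T (J x))"
    by (intro bounded_clinear_compose[OF bounded_clinear_inv[OF T co] J(1)])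
  have l: "inv ?T (J (H x)) = x" for x using inv_f_f[OF bij_is_inj[OF co(1)], of x] by simp
  have "J (H (inv ?T (J x))) = J x" for x using co(1) by (metis bij_is_surj surj_f_inv_f)
  then have "H (inv ?T (J x)) = x" for x using J(2) by metis
  then show ?thesis unfolding boundedly_invertible_def using H S l
    by (intro conjI exI[of _ "\<lambda>x. inv ?T (J x)"]) (auto simp: fun_eq_iff)
qed

subsection \<open>Surjective operators\<close>

text \<open>The open mapping theorem in quantitative form. Baire's theorem puts a ball into the
  closure of the image of a bounded set; differences of two points of that ball approximate any y up
  to half its norm, and iterating on the remainder gives a geometric series of corrections.\<close>

lemma bounded_preimages_if_surj:
  fixes W :: "'a::banach \<Rightarrow> 'b::banach"
  assumes W: "bounded_linear W" and surj: "surj W"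
  shows "\<exists>K>0. \<forall>y. \<exists>x. W x = y \<and> norm x \<le> K * norm y"
proof -
  interpret W: bounded_linear W by (rule W)
  define F where "F n = closure (W ` cball 0 (real n))" for n
  have "(\<Union>n. F n) = UNIV"
  proof -
    have "y \<in> (\<Union>n. F n)" for y
    proof -
      obtain x where "W x = y" using surj by (metis surjD)
      moreover obtain n where "norm x \<le> real n" using real_arch_simple by blast
      ultimately have "y \<in> W ` cball 0 (real n)" by auto
      then have "y \<in> F n" unfolding F_def by (rule subsetD[OF closure_subset])
      then show ?thesis by blast
    qed
    then show ?thesis by blast
  qed
  moreover have "interior (\<Union>n. F n) = {}" if "\<And>n. interior (F n) = {}"
  proof -
    have "Met_TC.mtopology interior_of \<Union>(range F) = {}"
    proof (rule Met_TC.metric_Baire_category_alt)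
      show "Met_TC.mcomplete TYPE('b)" using complete_UNIV by (simp add: mcomplete_iff_complete)
      fix T assume "T \<in> range F"
      then obtain n where "T = F n" by blast
      then show "closedin Met_TC.mtopology T \<and> Met_TC.mtopology interior_of T = {}"
        using that[of n] by (simp add: F_def)
    qed simp
    then show ?thesis by simp
  qed
  ultimately have "\<exists>n. interior (F n) \<noteq> {}" by (metis interior_UNIV empty_not_UNIV)
  then obtain n where "interior (F n) \<noteq> {}" by blast
  then obtain y0 where "y0 \<in> interior (F n)" by blast
  then obtain e where e: "0 < e" "ball y0 e \<subseteq> F n" unfolding mem_interior by blast
  \<comment> \<open>A difference of two preimages has norm at most 2 n and is divided by t = e / (2
    |y|), which gives 4 n / e times |y|. The added 1 keeps \<open>M\<close> positive for n =
    0.\<close>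
  define M where "M = 4 * real n / e + 1"
  have M: "M > 0" unfolding M_def using e by (intro add_nonneg_pos) auto
  have approx: "\<exists>x. norm x \<le> M * norm y \<and> norm (y - W x) \<le> norm y / 2" for y
  proof (cases "y = 0")
    case True then show ?thesis by (intro exI[of _ 0]) (simp add: W.zero)
  next
    case False
    define t where "t = e / (2 * norm y)"
    have t: "t > 0" using e False by (simp add: t_def)
    define d where "d = t * norm y / 4"
    have d: "d > 0" using t False by (simp add: d_def)
    have near: "\<exists>x. norm x \<le> real n \<and> norm (z - W x) < d" if "z \<in> ball y0 e" for z
    proof -
      have "z \<in> closure (W ` cball 0 (real n))" using e that by (auto simp: F_def)
      then obtain v where "v \<in> W ` cball 0 (real n)" "dist v z < d"
        using d closure_approachable by blast
      then show ?thesis by (auto simp: dist_norm norm_minus_commute)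
    qed
    have "y0 + t *\<^sub>R y \<in> ball y0 e" using e False by (simp add: dist_norm t_def)
    then obtain x1 where x1: "norm x1 \<le> real n" "norm (y0 + t *\<^sub>R y - W x1) < d" using near by blast
    obtain x2 where x2: "norm x2 \<le> real n" "norm (y0 - W x2) < d" using near[of y0] e by auto
    define x where "x = (1/t) *\<^sub>R (x1 - x2)"
    have "norm (x1 - x2) \<le> 2 * real n" using norm_triangle_ineq4[of x1 x2] x1 x2 by simp
    then have "norm x \<le> (2 * real n) / t" using t by (simp add: x_def divide_right_mono)
    also have "\<dots> = 4 * real n / e * norm y" using e False by (simp add: t_def field_simps)
    also have "\<dots> \<le> M * norm y" by (simp add: M_def distrib_right)
    finally have nx: "norm x \<le> M * norm y" .
    have "t *\<^sub>R (y - W x) = (y0 + t *\<^sub>R y - W x1) - (y0 - W x2)"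
      using t by (simp add: x_def W.scaleR W.diff algebra_simps)
    then have "norm (t *\<^sub>R (y - W x)) \<le> norm (y0 + t *\<^sub>R y - W x1) + norm (y0 - W x2)"
      using norm_triangle_ineq4 by metis
    moreover have "norm (t *\<^sub>R (y - W x)) = t * norm (y - W x)" using t by simp
    moreover have "d + d = t * (norm y / 2)" by (simp add: d_def)
    ultimately have "t * norm (y - W x) \<le> t * (norm y / 2)" using x1(2) x2(2) by linarith
    then have "norm (y - W x) \<le> norm y / 2" using t by simp
    with nx show ?thesis by blast
  qed
  then obtain g where g: "\<And>y. norm (g y) \<le> M * norm y" "\<And>y. norm (y - W (g y)) \<le> norm y / 2"
    by metis
  define r where "r y = y - W (g y)" for y
  have rn: "norm ((r ^^ k) y) \<le> norm y * (1/2) ^ k" for k y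
  proof (induction k)
    case (Suc k)
    have "norm ((r ^^ Suc k) y) \<le> norm ((r ^^ k) y) / 2" using g(2) by (simp add: r_def)
    with Suc show ?case by simp
  qed simp
  show ?thesis
  proof (intro exI[of _ "2 * M"] conjI allI)
    show "0 < 2 * M" using M by simp
    fix y
    define x where "x k = g ((r ^^ k) y)" for k
    have xn: "norm (x k) \<le> M * norm y * (1/2) ^ k" for k
    proof -
      have "norm (x k) \<le> M * norm ((r ^^ k) y)" by (simp add: x_def g)
      also have "\<dots> \<le> M * (norm y * (1/2) ^ k)" using M rn by (intro mult_left_mono) auto
      finally show ?thesis by (simp add: mult.assoc)
    qed
    have sg: "summable (\<lambda>k. M * norm y * (1/2::real) ^ k)" by (intro summable_mult) simp
    have sx: "summable x" by (rule summable_comparison_test'[OF sg]) (rule xn)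
    have Wsum: "(\<Sum>k<m. W (x k)) = y - (r ^^ m) y" for m
    proof (induction m)
      case (Suc m)
      then show ?case using r_def[of "(r ^^ m) y"] by (simp add: x_def)
    qed simp
    have "(\<lambda>m. (r ^^ m) y) \<longlonglongrightarrow> 0"
    proof (rule Lim_null_comparison)
      show "\<forall>\<^sub>F m in sequentially. norm ((r ^^ m) y) \<le> norm y * (1/2) ^ m" using rn by simp
      show "(\<lambda>m. norm y * (1/2) ^ m) \<longlonglongrightarrow> 0"
        by (rule tendsto_mult_right_zero) (simp add: LIMSEQ_power_zero)
    qed
    then have "(\<lambda>m. \<Sum>k<m. W (x k)) \<longlonglongrightarrow> y - 0" unfolding Wsum by (intro tendsto_diff tendsto_const)
    moreover have "(\<lambda>k. W (x k)) sums W (suminf x)" by (intro W.sums summable_sums sx)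
    ultimately have "W (suminf x) = y" unfolding sums_def using LIMSEQ_unique by fastforce
    moreover have "norm (suminf x) \<le> (\<Sum>k. M * norm y * (1/2) ^ k)"
      by (rule norm_suminf_le[OF xn sg])
    then have "norm (suminf x) \<le> 2 * M * norm y"
      by (simp add: suminf_mult suminf_geometric)
    ultimately show "\<exists>x. W x = y \<and> norm x \<le> 2 * M * norm y" by blast
  qed
qed

section \<open>Finite Fourier analysis on a time window\<close>

section \<open>Roots of unity and the discrete Fourier transform\<close>

definition unity_root :: "nat \<Rightarrow> nat \<Rightarrow> complex"
  where "unity_root N j = cis (2 * pi * real j / real N)"

lemma norm_unity_root [simp]: "cmod (unity_root N j) = 1"
  by (simp add: unity_root_def)

lemma unity_root_nonzero [simp]: "unity_root N j \<noteq> 0"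
  by (metis norm_unity_root norm_zero zero_neq_one)

lemma cnj_unity_root: "cnj (unity_root N j) = inverse (unity_root N j)"
  by (simp add: unity_root_def cis_cnj)

text \<open>The kernel exp(2 pi i j k / N) is symmetric, so one orthogonality computation serves
  both sums over time and sums over frequency.\<close>

lemma unity_root_power_swap: "unity_root N j ^ k = unity_root N k ^ j"
proof -
  have "real k * (2 * pi * real j / real N) = real j * (2 * pi * real k / real N)" by simp
  then show ?thesis unfolding unity_root_def Complex.DeMoivre by (simp only:)
qed

lemma unity_root_power_N: "0 < N \<Longrightarrow> unity_root N j ^ N = 1"
  by (subst unity_root_power_swap) (simp add: unity_root_def)

lemma sum_unity_root_power:
  assumes "0 < k" "k < N"
  shows "(\<Sum>j<N. unity_root N j ^ k) = 0"
proof -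
  define w where "w = unity_root N k"
  have N: "0 < N" using assms by simp
  have eq: "unity_root N j ^ k = w ^ j" for j
    unfolding w_def by (rule unity_root_power_swap)
  have "w ^ N = 1" unfolding w_def by (rule unity_root_power_N[OF N])
  moreover have "w \<noteq> 1"
  proof
    assume "w = 1"
    then have "cis (2 * pi * real k / real N) = cis (2 * pi * real 0 / real N)"
      by (simp add: w_def unity_root_def)
    from inj_onD[OF bij_betw_imp_inj_on[OF Complex.bij_betw_roots_unity[OF N]] this] assms
    show False by simp
  qed
  ultimately show ?thesis by (simp add: eq geometric_sum)
qed

lemma sum_unity_root_quotient:
  assumes "n < N" "m < N"
  shows "(\<Sum>j<N. unity_root N j ^ m * inverse (unity_root N j) ^ n) = (if n = m then of_nat N else 0)"
proof (cases n m rule: linorder_cases)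
  case less
  have "unity_root N j ^ m * inverse (unity_root N j) ^ n = unity_root N j ^ (m - n)" for j
    using less by (simp add: power_diff field_simps)
  then show ?thesis using sum_unity_root_power[of "m - n" N] less assms by simp
next
  case greater
  have "unity_root N j ^ m * inverse (unity_root N j) ^ n = cnj (unity_root N j ^ (n - m))" for j
    using greater by (simp add: power_diff cnj_unity_root field_simps)
  then have "(\<Sum>j<N. unity_root N j ^ m * inverse (unity_root N j) ^ n) = cnj (\<Sum>j<N. unity_root N j ^ (n - m))"
    by simp
  then show ?thesis using sum_unity_root_power[of "n - m" N] greater assms by simp
qed (simp flip: power_mult_distrib)

text \<open>Synthesis from amplitudes: \<open>c j\<close> multiplies the sequence z^{-n} with z the
  j-th root of unity, the same exponentials that drive the system. There is no normalising factor,
  hence the N in Parseval's identity.\<close>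

definition dft :: "nat \<Rightarrow> (nat \<Rightarrow> 'a::complex_vector) \<Rightarrow> nat \<Rightarrow> 'a"
  where "dft N c n = (\<Sum>j<N. inverse (unity_root N j) ^ n *\<^sub>C c j)"

lemma dft_surj:
  fixes u :: "nat \<Rightarrow> 'a::complex_vector"
  shows "\<exists>c. \<forall>n<N. dft N c n = u n"
proof (intro exI allI impI)
  fix n assume n: "n < N"
  define c where "c j = (1 / of_nat N) *\<^sub>C (\<Sum>m<N. unity_root N j ^ m *\<^sub>C u m)" for j
  have "dft N c n = (\<Sum>j<N. \<Sum>m<N. ((1 / of_nat N) * (unity_root N j ^ m * inverse (unity_root N j) ^ n)) *\<^sub>C u m)"
    by (simp add: dft_def c_def scaleC_sum_right scaleC_scaleC mult_ac)
  also have "\<dots> = (\<Sum>m<N. \<Sum>j<N. ((1 / of_nat N) * (unity_root N j ^ m * inverse (unity_root N j) ^ n)) *\<^sub>C u m)"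
    by (rule sum.swap)
  also have "\<dots> = (\<Sum>m<N. ((1 / of_nat N) * (\<Sum>j<N. unity_root N j ^ m * inverse (unity_root N j) ^ n)) *\<^sub>C u m)"
    by (simp add: scaleC_sum_left sum_distrib_left)
  also have "\<dots> = (\<Sum>m<N. if m = n then u m else 0)"
    using n by (intro sum.cong refl) (auto simp: sum_unity_root_quotient scaleC_one)
  also have "\<dots> = u n" using n by simp
  finally show "dft N c n = u n" .
qed

lemma dft_Parseval:
  fixes c :: "nat \<Rightarrow> 'a::complex_inner"
  assumes "0 < N"
  shows "(\<Sum>n<N. (norm (dft N c n))\<^sup>2) = real N * (\<Sum>j<N. (norm (c j))\<^sup>2)"
proof -
  have orth: "(\<Sum>n<N. inverse (unity_root N j) ^ n * unity_root N i ^ n) = (if i = j then of_nat N else 0)"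
    if "i < N" "j < N" for i j
  proof -
    have "(\<Sum>n<N. inverse (unity_root N j) ^ n * unity_root N i ^ n)
        = (\<Sum>n<N. unity_root N n ^ i * inverse (unity_root N n) ^ j)"
      by (intro sum.cong refl)
        (simp only: power_inverse unity_root_power_swap[of N j] unity_root_power_swap[of N i] mult.commute)
    then show ?thesis using sum_unity_root_quotient[of j N i] that by auto
  qed
  have "(\<Sum>n<N. cinner (dft N c n) (dft N c n))
      = (\<Sum>n<N. \<Sum>i<N. \<Sum>j<N. (inverse (unity_root N j) ^ n * unity_root N i ^ n) * cinner (c j) (c i))"
    by (simp add: dft_def cinner_sum_left cinner_sum_right cinner_scaleC_left cinner_scaleC_right
        cnj_unity_root sum_distrib_left sum_distrib_right mult_ac)
  also have "\<dots> = (\<Sum>i<N. \<Sum>n<N. \<Sum>j<N. (inverse (unity_root N j) ^ n * unity_root N i ^ n) * cinner (c j) (c i))"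
    by (rule sum.swap)
  also have "\<dots> = (\<Sum>i<N. \<Sum>j<N. \<Sum>n<N. (inverse (unity_root N j) ^ n * unity_root N i ^ n) * cinner (c j) (c i))"
    by (intro sum.cong refl sum.swap)
  also have "\<dots> = (\<Sum>i<N. \<Sum>j<N. if i = j then of_nat N * cinner (c j) (c i) else 0)"
    by (intro sum.cong refl) (auto simp: orth simp flip: sum_distrib_right)
  also have "\<dots> = of_nat N * (\<Sum>i<N. cinner (c i) (c i))" by (simp add: sum_distrib_left)
  finally have "complex_of_real (\<Sum>n<N. (norm (dft N c n))\<^sup>2)
      = complex_of_real (real N * (\<Sum>j<N. (norm (c j))\<^sup>2))"
    unfolding cinner_self by simp
  then show ?thesis using of_real_eq_iff by blast
qed

lemma dft_shift_N: "0 < N \<Longrightarrow> dft N c N = dft N c 0"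
  by (simp only: dft_def power_inverse unity_root_power_N power_0 inverse_1)

lemma dft_apply: "bounded_clinear T \<Longrightarrow> T (dft N c n) = dft N (\<lambda>j. T (c j)) n"
  by (simp add: dft_def bounded_clinearD)

lemma dft_Suc: "dft N c (Suc n) = dft N (\<lambda>j. inverse (unity_root N j) *\<^sub>C c j) n"
  by (simp add: dft_def scaleC_scaleC mult.commute)

lemma dft_add: "dft N (\<lambda>j. c j + d j) n = dft N c n + dft N d n"
  by (simp add: dft_def scaleC_add_right sum.distrib)

section \<open>From the spectrum to geometric decay of powers\<close>

section \<open>Exponentially stable operators\<close>

text \<open>For w \<noteq> 0, I - w A = w (w^{-1} - A) with |w^{-1}| \<ge> 1, hence outside the
  spectrum. A lower bound with constant k at w persists with constant 2 k on a disc around w, and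
  compactness of the closed unit disc leaves finitely many constants.\<close>

lemma exp_stable_resolvent:
  fixes A :: "'a::chilbert_space \<Rightarrow> 'a"
  assumes A: "bounded_clinear A" and st: "exp_stable A"
  shows "\<exists>K>0. \<forall>w. cmod w \<le> 1 \<longrightarrow>
    bij (\<lambda>x. x - w *\<^sub>C A x) \<and> (\<forall>x. norm x \<le> K * norm (x - w *\<^sub>C A x))"
proof -
  obtain a where a: "0 < a" "\<And>x. norm (A x) \<le> a * norm x" using bounded_clinear_bound[OF A] by blast
  have pt: "bij (\<lambda>x. x - w *\<^sub>C A x) \<and> (\<exists>K>0. \<forall>x. norm x \<le> K * norm (x - w *\<^sub>C A x))"
    if w: "cmod w \<le> 1" for w
  proof (cases "w = 0")
    case True then show ?thesis by (auto intro!: exI[of _ 1] simp: bij_id[unfolded id_def])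
  next
    case False
    define l where "l = inverse w"
    have lw: "w * l = 1" "l * w = 1" using False by (simp_all add: l_def)
    have "1 \<le> cmod l" using w False by (simp add: l_def norm_inverse one_le_inverse_iff)
    then have "l \<notin> op_spectrum A" using st by (auto simp: exp_stable_def)
    then obtain S where S: "bounded_clinear S" "\<And>x. S (l *\<^sub>C x - A x) = x" "\<And>x. l *\<^sub>C S x - A (S x) = x"
      by (auto simp: op_spectrum_def boundedly_invertible_def fun_eq_iff)
    have eq: "x - w *\<^sub>C A x = w *\<^sub>C (l *\<^sub>C x - A x)" for x
      by (simp add: scaleC_diff_right scaleC_scaleC lw scaleC_one)
    have l: "l *\<^sub>C w *\<^sub>C x = x" for x :: 'a by (simp add: scaleC_scaleC lw scaleC_one)
    have r: "w *\<^sub>C l *\<^sub>C x = x" for x :: 'a by (simp add: scaleC_scaleC lw scaleC_one)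
    have left: "S (l *\<^sub>C (x - w *\<^sub>C A x)) = x" for x by (simp only: eq l S)
    have right: "(let v = S (l *\<^sub>C y) in v - w *\<^sub>C A v) = y" for y by (simp only: eq S r Let_def)
    obtain K where K: "0 < K" "\<And>x. norm (S x) \<le> K * norm x" using bounded_clinear_bound[OF S(1)] by blast
    have "norm x \<le> (K * cmod l) * norm (x - w *\<^sub>C A x)" for x
      using K(2)[of "l *\<^sub>C (x - w *\<^sub>C A x)"] by (simp only: left norm_scaleC mult.assoc)
    moreover have "K * cmod l > 0" using K(1) lw(1) by (cases "l = 0") auto
    moreover have "bij (\<lambda>x. x - w *\<^sub>C A x)"
      by (rule o_bij[of "\<lambda>y. S (l *\<^sub>C y)"]) (use left right in \<open>auto simp: fun_eq_iff Let_def\<close>)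
    ultimately show ?thesis by blast
  qed
  then obtain k where k: "\<And>w. cmod w \<le> 1 \<Longrightarrow> k w > 0"
    "\<And>w x. cmod w \<le> 1 \<Longrightarrow> norm x \<le> k w * norm (x - w *\<^sub>C A x)" by metis
  \<comment> \<open>Moving w to v changes w A x by at most |v - w| a |x|; this radius makes k times
    the change at most |x| / 2, which is absorbed.\<close>
  define U where "U w = ball w (1 / (2 * k w * a))" for w
  have U: "norm x \<le> (2 * k w) * norm (x - v *\<^sub>C A x)" if "cmod w \<le> 1" "v \<in> U w" for v w x
  proof -
    have "cmod (v - w) \<le> 1 / (2 * k w * a)" using that by (auto simp: U_def dist_norm norm_minus_commute)
    then have "cmod (v - w) * (a * norm x) \<le> 1 / (2 * k w * a) * (a * norm x)"
      using a by (intro mult_right_mono) auto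
    moreover have "norm ((v - w) *\<^sub>C A x) \<le> cmod (v - w) * (a * norm x)"
      using a by (auto simp: norm_scaleC intro: mult_left_mono)
    ultimately have "norm ((v - w) *\<^sub>C A x) \<le> 1 / (2 * k w * a) * (a * norm x)" by linarith
    then have "k w * norm ((v - w) *\<^sub>C A x) \<le> k w * (1 / (2 * k w * a) * (a * norm x))"
      using k(1)[OF that(1)] by (intro mult_left_mono) auto
    then have d: "k w * norm ((v - w) *\<^sub>C A x) \<le> norm x / 2"
      using a(1) k(1)[OF that(1)] by simp
    have "x - w *\<^sub>C A x = (x - v *\<^sub>C A x) + (v - w) *\<^sub>C A x"
      using scaleC_add_left[of "v - w" w "A x"] by (simp add: algebra_simps)
    then have "norm (x - w *\<^sub>C A x) \<le> norm (x - v *\<^sub>C A x) + norm ((v - w) *\<^sub>C A x)"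
      using norm_triangle_ineq by metis
    then have "k w * norm (x - w *\<^sub>C A x) \<le> k w * norm (x - v *\<^sub>C A x) + k w * norm ((v - w) *\<^sub>C A x)"
      using k(1)[OF that(1)] by (simp flip: distrib_left)
    with k(2)[OF that(1), of x] d show ?thesis by linarith
  qed
  have "compact (cball 0 1 :: complex set)" by simp
  moreover have "\<And>w. w \<in> cball 0 1 \<Longrightarrow> open (U w)" by (simp add: U_def)
  moreover have "cball 0 1 \<subseteq> (\<Union>w\<in>cball 0 1. U w)" using k(1) a by (auto simp: U_def)
  ultimately obtain W where W: "W \<subseteq> cball 0 1" "finite W" "cball 0 1 \<subseteq> (\<Union>w\<in>W. U w)"
    by (rule compactE_image)
  define K where "K = 1 + (\<Sum>w\<in>W. 2 * k w)"
  have kW: "0 \<le> 2 * k w" if "w \<in> W" for w using k(1)[of w] W that by (auto intro: less_imp_le)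
  have "norm x \<le> K * norm (x - v *\<^sub>C A x)" if "cmod v \<le> 1" for v x
  proof -
    have "v \<in> (\<Union>w\<in>W. U w)" using W(3) that by (rule_tac subsetD) auto
    then obtain w where w: "w \<in> W" "v \<in> U w" by blast
    have "2 * k w \<le> (\<Sum>w\<in>W. 2 * k w)"
      using W(2) w(1) kW by (intro member_le_sum) auto
    then have "2 * k w \<le> K" by (simp add: K_def)
    then have "(2 * k w) * norm (x - v *\<^sub>C A x) \<le> K * norm (x - v *\<^sub>C A x)" by (rule mult_right_mono) simp
    moreover have "cmod w \<le> 1" using W w by auto
    ultimately show ?thesis using U[of w v x] w by linarith
  qed
  moreover have "K > 0" unfolding K_def using kW by (intro add_pos_nonneg sum_nonneg) auto
  ultimately show ?thesis using pt by blast
qed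

text \<open>The remainder contains w only as w^N, so it is the same for all w on a circle that
  differ by N-th roots of unity. Averaging over them relies on this.\<close>

lemma funpow_telescope:
  assumes "bounded_clinear A"
  shows "(\<Sum>k<N. w ^ k *\<^sub>C (A ^^ k) (v - w *\<^sub>C A v)) = v - w ^ N *\<^sub>C (A ^^ N) v"
proof (induction N)
  case (Suc N)
  note P = bounded_clinear_power[OF assms, of N]
  have "(A ^^ N) (A v) = (A ^^ Suc N) v" by (simp add: funpow_swap1)
  then show ?case using Suc
    by (simp only: sum.lessThan_Suc bounded_clinear_diff[OF P] bounded_clinear_scaleC[OF P]
        scaleC_diff_right scaleC_scaleC) (simp add: mult.commute)
qed (simp add: scaleC_one)

lemma funpow_average:
  fixes y :: "'a::complex_inner"
  assumes "0 < N"
  shows "(\<Sum>j<N. \<Sum>k<N. (w * unity_root N j) ^ k *\<^sub>C (A ^^ k) y) = of_nat N *\<^sub>C y"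
proof -
  have "(\<Sum>j<N. \<Sum>k<N. (w * unity_root N j) ^ k *\<^sub>C (A ^^ k) y)
      = (\<Sum>k<N. \<Sum>j<N. (w * unity_root N j) ^ k *\<^sub>C (A ^^ k) y)" by (rule sum.swap)
  also have "\<dots> = (\<Sum>k<N. (w ^ k * (\<Sum>j<N. unity_root N j ^ k)) *\<^sub>C (A ^^ k) y)"
    by (simp add: scaleC_sum_left sum_distrib_left power_mult_distrib)
  also have "\<dots> = (\<Sum>k<N. if k = 0 then of_nat N *\<^sub>C y else 0)"
    by (intro sum.cong refl) (auto simp: sum_unity_root_power)
  finally show ?thesis using assms by simp
qed

text \<open>
  Rickart's proof of the spectral radius formula: averaging the resolvent over the points
  \<open>w \<omega>\<close>, \<open>\<omega> ^ N = 1\<close>, gives the inverse of \<open>I - w ^ N A ^ N\<close>, and the resolvent is Lipschitz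
  on the closed disc, so smallness of \<open>r ^ N A ^ N\<close> propagates from \<open>r\<close> to a slightly larger \<open>w\<close>.
\<close>

lemma power_small_propagates:
  fixes A :: "'a::chilbert_space \<Rightarrow> 'a"
  assumes A: "bounded_clinear A" and N: "0 < N"
    and a: "0 \<le> a" "\<And>x. norm (A x) \<le> a * norm x"
    and K: "0 < K" "\<And>w. cmod w \<le> 1 \<Longrightarrow> bij (\<lambda>x. x - w *\<^sub>C A x)"
       "\<And>w x. cmod w \<le> 1 \<Longrightarrow> norm x \<le> K * norm (x - w *\<^sub>C A x)"
    and r: "0 \<le> r" "r \<le> w" "w \<le> 1" "8 * K\<^sup>2 * a * (w - r) \<le> 1"
    and small: "\<And>x. r ^ N * norm ((A ^^ N) x) \<le> norm x / 9"
  shows "w ^ N * norm ((A ^^ N) x) \<le> norm x / 3"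
proof -
  \<comment> \<open>x is recovered from this y by averaging \<open>R\<close> over the circle of
    radius w; the same average over radius r gives the comparison vector \<open>z\<close>.\<close>
  define y where "y = x - complex_of_real (w ^ N) *\<^sub>C (A ^^ N) x"
  define R where "R v = inv (\<lambda>x. x - v *\<^sub>C A x) y" for v
  have R: "R v - v *\<^sub>C A (R v) = y" if "cmod v \<le> 1" for v
    using surj_f_inv_f[OF bij_is_surj[OF K(2)[OF that]], of y] by (simp add: R_def)
  have Ru: "R v = z" if "cmod v \<le> 1" "z - v *\<^sub>C A z = y" for v z
    using K(2)[OF that(1)] that(2) unfolding R_def by (metis (no_types, lifting) bij_inv_eq_iff)
  have Rn: "norm (R v) \<le> K * norm y" if "cmod v \<le> 1" for v using K(3)[OF that, of "R v"] R[OF that] by simp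
  have norm_om: "cmod (complex_of_real s * unity_root N j) = s" if "0 \<le> s" for s j
    using that by (simp add: norm_mult)
  have pow_om: "(complex_of_real s * unity_root N j) ^ N = complex_of_real (s ^ N)" for s j
    by (simp add: power_mult_distrib unity_root_power_N[OF N])
  have lip: "norm (R v - R v') \<le> K\<^sup>2 * a * cmod (v - v') * norm y" if "cmod v \<le> 1" "cmod v' \<le> 1" for v v'
  proof -
    have "(R v - R v') - v *\<^sub>C A (R v - R v') = (v - v') *\<^sub>C A (R v')"
    proof -
      have "(R v - R v') - v *\<^sub>C A (R v - R v')
          = (R v - v *\<^sub>C A (R v)) - (R v' - v' *\<^sub>C A (R v')) + (v *\<^sub>C A (R v') - v' *\<^sub>C A (R v'))"
        by (simp add: bounded_clinear_diff[OF A] scaleC_diff_right)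
      then show ?thesis using scaleC_add_left[of "v - v'" v' "A (R v')"]
        unfolding R[OF that(1)] R[OF that(2)] by simp
    qed
    then have "norm (R v - R v') \<le> K * norm ((v - v') *\<^sub>C A (R v'))"
      using K(3)[OF that(1), of "R v - R v'"] by simp
    also have "\<dots> \<le> K * (cmod (v - v') * (a * (K * norm y)))"
      unfolding norm_scaleC using K(1) a Rn[OF that(2)]
      by (intro mult_left_mono order_trans[OF a(2)]) auto
    finally show ?thesis by (simp add: power2_eq_square mult_ac)
  qed
  define z where "z = (1 / of_nat N) *\<^sub>C (\<Sum>j<N. R (complex_of_real r * unity_root N j))"
  have avg: "(1 / of_nat N) *\<^sub>C of_nat N *\<^sub>C v = v" for v :: 'a
    using N by (simp add: scaleC_scaleC scaleC_one)
  have sumA: "(A ^^ k) (\<Sum>j\<in>I. f j) = (\<Sum>j\<in>I. (A ^^ k) (f j))" for k I and f :: "nat \<Rightarrow> 'a"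
    by (rule bounded_clinear_sum[OF bounded_clinear_power[OF A]])
  note AN = bounded_clinear_power[OF A, of N]
  have zy: "z - complex_of_real (r ^ N) *\<^sub>C (A ^^ N) z = y"
  proof -
    have "R (complex_of_real r * unity_root N j) - complex_of_real (r ^ N) *\<^sub>C (A ^^ N) (R (complex_of_real r * unity_root N j))
        = (\<Sum>k<N. (complex_of_real r * unity_root N j) ^ k *\<^sub>C (A ^^ k) y)" for j
    proof -
      have c: "cmod (complex_of_real r * unity_root N j) \<le> 1" using r norm_om by simp
      show ?thesis
        using funpow_telescope[OF A, where N = N and w = "complex_of_real r * unity_root N j"
            and v = "R (complex_of_real r * unity_root N j)"]
        unfolding R[OF c] pow_om by simp
    qed
    then have "(\<Sum>j<N. R (complex_of_real r * unity_root N j)) - complex_of_real (r ^ N) *\<^sub>C (A ^^ N) (\<Sum>j<N. R (complex_of_real r * unity_root N j))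
       = of_nat N *\<^sub>C y"
      unfolding sumA scaleC_sum_right funpow_average[OF N, where A = A and w = "complex_of_real r", symmetric]
      by (simp flip: sum_subtractf)
    then have "(1 / of_nat N) *\<^sub>C ((\<Sum>j<N. R (complex_of_real r * unity_root N j)) - complex_of_real (r ^ N) *\<^sub>C (A ^^ N) (\<Sum>j<N. R (complex_of_real r * unity_root N j)))
       = y" using avg by simp
    then show ?thesis unfolding z_def
      by (simp add: bounded_clinear_scaleC[OF AN] scaleC_diff_right scaleC_scaleC mult.commute)
  qed
  have x_eq: "x = (1 / of_nat N) *\<^sub>C (\<Sum>j<N. R (complex_of_real w * unity_root N j))"
  proof -
    have "R (complex_of_real w * unity_root N j) = (\<Sum>k<N. (complex_of_real w * unity_root N j) ^ k *\<^sub>C (A ^^ k) x)" for j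
    proof (rule Ru)
      define v where "v = complex_of_real w * unity_root N j"
      show "cmod (complex_of_real w * unity_root N j) \<le> 1" using r norm_om by simp
      have "(\<Sum>k<N. v ^ k *\<^sub>C (A ^^ k) x) - v *\<^sub>C A (\<Sum>k<N. v ^ k *\<^sub>C (A ^^ k) x) = (\<Sum>k<N. v ^ k *\<^sub>C (A ^^ k) (x - v *\<^sub>C A x))"
        by (simp add: bounded_clinearD[OF A] bounded_clinearD[OF bounded_clinear_power[OF A]]
            scaleC_sum_right scaleC_diff_right scaleC_scaleC mult.commute funpow_swap1 flip: sum_subtractf)
      then show "(\<Sum>k<N. v ^ k *\<^sub>C (A ^^ k) x) - v *\<^sub>C A (\<Sum>k<N. v ^ k *\<^sub>C (A ^^ k) x) = y"
        unfolding funpow_telescope[OF A] y_def unfolding v_def pow_om .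
    qed
    then show ?thesis using funpow_average[OF N, where A = A and w = "complex_of_real w" and y = x] avg by simp
  qed
  \<comment> \<open>The constants interlock: the Lipschitz bound costs 1/8, and \<open>small\<close>
    with its 1/9 costs another 1/8. So |x - y| \<le> |y| / 4, and |y| \<le> |x| + |x - y| turns this
    into |x| / 3.\<close>
  have "norm (x - z) \<le> (1 / 8) * norm y"
  proof -
    have "x - z = (1 / of_nat N) *\<^sub>C (\<Sum>j<N. R (complex_of_real w * unity_root N j) - R (complex_of_real r * unity_root N j))"
      by (subst x_eq) (simp add: z_def sum_subtractf scaleC_diff_right)
    then have "norm (x - z) = (1 / real N) * norm (\<Sum>j<N. R (complex_of_real w * unity_root N j) - R (complex_of_real r * unity_root N j))"
      by (simp add: norm_scaleC norm_divide)
    also have "\<dots> \<le> (1 / real N) * (\<Sum>j<N. (1 / 8) * norm y)"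
    proof (intro mult_left_mono sum_norm_le)
      fix j
      have "cmod (complex_of_real w * unity_root N j - complex_of_real r * unity_root N j)
          = cmod (complex_of_real (w - r) * unity_root N j)" by (simp add: left_diff_distrib)
      also have "\<dots> = w - r" by (rule norm_om) (use r in simp)
      finally have "norm (R (complex_of_real w * unity_root N j) - R (complex_of_real r * unity_root N j))
         \<le> K\<^sup>2 * a * (w - r) * norm y"
        using lip[of "complex_of_real w * unity_root N j" "complex_of_real r * unity_root N j"] r norm_om
        by simp
      also have "\<dots> \<le> (1 / 8) * norm y" using r(4) by (intro mult_right_mono) auto
      finally show "norm (R (complex_of_real w * unity_root N j) - R (complex_of_real r * unity_root N j)) \<le> (1 / 8) * norm y" .
    qed simp
    finally show ?thesis using N by simp
  qed
  moreover have "norm (z - y) \<le> (1 / 8) * norm y"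
  proof -
    have "norm (z - y) = r ^ N * norm ((A ^^ N) z)"
      using zy r by (metis norm_scaleC diff_diff_eq2 add_diff_cancel_left' norm_of_real abs_of_nonneg zero_le_power)
    then have "norm (z - y) \<le> norm z / 9" using small[of z] by simp
    moreover have "norm z \<le> norm (z - y) + norm y" using norm_triangle_ineq[of "z - y" y] by simp
    ultimately show ?thesis by linarith
  qed
  ultimately have "norm (x - y) \<le> (1 / 4) * norm y"
    using norm_triangle_ineq[of "x - z" "z - y"] by simp
  moreover have "norm (x - y) = w ^ N * norm ((A ^^ N) x)"
    using r by (simp add: y_def norm_scaleC norm_power)
  moreover have "norm y \<le> norm x + norm (x - y)" using norm_triangle_ineq4[of x "x - y"] by simp
  ultimately show ?thesis by linarith
qed

text \<open>The radius moves from 0 to 1 in steps of length \<open>\<delta>\<close>. Each step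
  worsens 1/9 to 1/3, and doubling N squares 1/3 back to 1/9 for the next step. At radius 1 some
  power of \<open>A\<close> has norm at most 1/3.\<close>

lemma exp_stable_power_decay:
  fixes A :: "'a::chilbert_space \<Rightarrow> 'a"
  assumes A: "bounded_clinear A" and st: "exp_stable A"
  shows "\<exists>C\<ge>0. \<exists>r. 0 < r \<and> r < 1 \<and> (\<forall>n x. norm ((A ^^ n) x) \<le> C * r ^ n * norm x)"
proof -
  obtain a where a: "0 < a" "\<And>x. norm (A x) \<le> a * norm x" using bounded_clinear_bound[OF A] by blast
  obtain K where K: "0 < K" "\<And>w. cmod w \<le> 1 \<Longrightarrow> bij (\<lambda>x. x - w *\<^sub>C A x)"
       "\<And>w x. cmod w \<le> 1 \<Longrightarrow> norm x \<le> K * norm (x - w *\<^sub>C A x)"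
    using exp_stable_resolvent[OF A st] by blast
  have an: "norm ((A ^^ n) x) \<le> a ^ n * norm x" for n x
  proof (induction n)
    case (Suc n)
    have "norm ((A ^^ Suc n) x) \<le> a * norm ((A ^^ n) x)" using a(2) by simp
    also have "\<dots> \<le> a * (a ^ n * norm x)" using a Suc by (intro mult_left_mono) auto
    finally show ?case by (simp add: mult.assoc)
  qed simp
  have iter: "s ^ (N * m) * norm ((A ^^ (N * m)) x) \<le> (1/3) ^ m * norm x"
    if "0 \<le> s" "\<And>x. s ^ N * norm ((A ^^ N) x) \<le> norm x / 3" for s :: real and N m x
  proof (induction m arbitrary: x)
    case (Suc m)
    have "s ^ (N * Suc m) * norm ((A ^^ (N * Suc m)) x) = s ^ N * (s ^ (N * m) * norm ((A ^^ (N * m)) ((A ^^ N) x)))"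
      by (simp add: power_add funpow_add add.commute[of N])
    also have "\<dots> \<le> s ^ N * ((1/3) ^ m * norm ((A ^^ N) x))" using Suc that by (intro mult_left_mono) auto
    also have "\<dots> \<le> (1/3) ^ m * (norm x / 3)" using that(2)[of x] by (simp add: mult.left_commute)
    finally show ?case by simp
  qed simp
  \<comment> \<open>The longest step for which the Lipschitz hypothesis of
    \<open>power_small_propagates\<close> holds.\<close>
  define \<delta> where "\<delta> = 1 / (8 * K\<^sup>2 * a)"
  have \<delta>: "\<delta> > 0" using a K by (simp add: \<delta>_def)
  have good: "\<exists>N>0. \<forall>x. min 1 (real i * \<delta>) ^ N * norm ((A ^^ N) x) \<le> norm x / 3" for i
  proof (induction i)
    case 0 show ?case by (intro exI[of _ 1]) simp
  next
    case (Suc i)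
    define s where "s = min 1 (real i * \<delta>)"
    have s0: "s \<ge> 0" using \<delta> by (simp add: s_def)
    obtain N where N: "N > 0" "\<And>x. s ^ N * norm ((A ^^ N) x) \<le> norm x / 3" using Suc s_def by blast
    have "s ^ (N * 2) * norm ((A ^^ (N * 2)) x) \<le> norm x / 9" for x
      using iter[OF s0 N(2), of 2 x] by (simp add: power2_eq_square)
    moreover have "8 * K\<^sup>2 * a * (min 1 (real (Suc i) * \<delta>) - s) \<le> 1"
    proof -
      have "min 1 (real (Suc i) * \<delta>) - s \<le> \<delta>" using \<delta> by (auto simp: s_def min_def algebra_simps)
      then have "8 * K\<^sup>2 * a * (min 1 (real (Suc i) * \<delta>) - s) \<le> 8 * K\<^sup>2 * a * \<delta>" using a K by (intro mult_left_mono) auto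
      then show ?thesis using a K by (simp add: \<delta>_def)
    qed
    moreover have "s \<le> min 1 (real (Suc i) * \<delta>)" using \<delta> by (auto simp: s_def min_def algebra_simps)
    ultimately have "min 1 (real (Suc i) * \<delta>) ^ (N * 2) * norm ((A ^^ (N * 2)) x) \<le> norm x / 3" for x
      using N(1) a by (intro power_small_propagates[OF A _ _ a(2) K s0]) auto
    then show ?case using N(1) by (intro exI[of _ "N * 2"]) auto
  qed
  obtain i where "1 \<le> real i * \<delta>" using reals_Archimedean3[OF \<delta>] less_imp_le by blast
  then obtain N where N: "N > 0" "\<And>x. norm ((A ^^ N) x) \<le> norm x / 3"
    using good[of i] by (auto simp: min_absorb1)
  define r where "r = root N (1/3)"
  have r: "0 < r" "r < 1" "r ^ N = 1/3" using N by (auto simp: r_def)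
  \<comment> \<open>(1 + a)^N dominates the fewer than N leftover factors of \<open>A\<close>; the 3
    compensates r^(n mod N) \<ge> r^N = 1/3.\<close>
  define C where "C = 3 * (1 + a) ^ N"
  have "norm ((A ^^ n) x) \<le> C * r ^ n * norm x" for n x
  proof -
    let ?m = "n div N" and ?k = "n mod N"
    have nk: "n = N * ?m + ?k" by simp
    have "?k < N" using N by simp
    have "norm ((A ^^ n) x) = norm ((A ^^ (N * ?m)) ((A ^^ ?k) x))"
      by (subst nk) (simp only: funpow_add o_apply)
    also have "\<dots> \<le> (1/3) ^ ?m * norm ((A ^^ ?k) x)" using iter[of 1 N ?m] N by simp
    also have "\<dots> \<le> (1/3) ^ ?m * ((1 + a) ^ N * norm x)"
    proof -
      have "a ^ ?k \<le> (1 + a) ^ ?k" using a by (intro power_mono) auto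
      also have "\<dots> \<le> (1 + a) ^ N" using a \<open>?k < N\<close> by (intro power_increasing) auto
      finally have "a ^ ?k * norm x \<le> (1 + a) ^ N * norm x" by (rule mult_right_mono) simp
      then show ?thesis using an[of ?k x] by (intro mult_left_mono) auto
    qed
    also have "(1/3) ^ ?m \<le> 3 * r ^ n"
    proof -
      have "r ^ n = (1/3) ^ ?m * r ^ ?k" by (subst nk) (simp only: power_add power_mult r)
      moreover have "r ^ N \<le> r ^ ?k" using r(1,2) \<open>?k < N\<close> by (intro power_decreasing) auto
      then have "(1/3) ^ ?m * (1/3) \<le> (1/3) ^ ?m * r ^ ?k" unfolding r(3) by (intro mult_left_mono) auto
      ultimately show ?thesis by simp
    qed
    finally show ?thesis using a by (simp add: C_def mult_ac mult_right_mono)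
  qed
  then show ?thesis using r a by (intro exI[of _ C] exI[of _ r] conjI) (auto simp: C_def)
qed

section \<open>One-sided recursions in both directions of time\<close>

section \<open>State trajectories\<close>

text \<open>Plain functions on the naturals make shifting and prepending immediate and allow either
  direction of time.\<close>

definition l2seq :: "(nat \<Rightarrow> 'a::real_normed_vector) \<Rightarrow> bool"
  where "l2seq u \<longleftrightarrow> summable (\<lambda>n. (norm (u n))\<^sup>2)"

definition energy :: "(nat \<Rightarrow> 'a::real_normed_vector) \<Rightarrow> real"
  where "energy u = (\<Sum>n. (norm (u n))\<^sup>2)"

lemma l2seq_scaleC: "l2seq u \<Longrightarrow> l2seq (\<lambda>n. a *\<^sub>C (u n :: 'a::complex_inner))"
  by (auto simp: l2seq_def norm_scaleC power_mult_distrib intro: summable_mult)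

lemma energy_scaleC: "l2seq u \<Longrightarrow> energy (\<lambda>n. a *\<^sub>C (u n :: 'a::complex_inner)) = (cmod a)\<^sup>2 * energy u"
  by (simp add: l2seq_def energy_def norm_scaleC power_mult_distrib suminf_mult)

lemma l2seq_add_diff:
  fixes u v :: "nat \<Rightarrow> 'a::real_inner"
  assumes "l2seq u" "l2seq v"
  shows "l2seq (\<lambda>n. u n + v n)" "l2seq (\<lambda>n. u n - v n)"
    "energy (\<lambda>n. u n + v n) + energy (\<lambda>n. u n - v n) = 2 * energy u + 2 * energy v"
proof -
  have par: "(norm (x + y))\<^sup>2 + (norm (x - y))\<^sup>2 = 2 * (norm x)\<^sup>2 + 2 * (norm y)\<^sup>2" for x y :: 'a
    unfolding power2_norm_eq_inner by (simp add: inner_simps inner_commute)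
  have sm: "summable (\<lambda>n. 2 * (norm (u n))\<^sup>2 + 2 * (norm (v n))\<^sup>2)"
    using assms unfolding l2seq_def by (intro summable_add summable_mult)
  show l1: "l2seq (\<lambda>n. u n + v n)"
    unfolding l2seq_def
    by (rule summable_comparison_test'[OF sm]) (simp flip: par)
  show l2: "l2seq (\<lambda>n. u n - v n)"
    unfolding l2seq_def
    by (rule summable_comparison_test'[OF sm]) (simp flip: par)
  have "energy (\<lambda>n. u n + v n) + energy (\<lambda>n. u n - v n)
      = (\<Sum>n. (norm (u n + v n))\<^sup>2 + (norm (u n - v n))\<^sup>2)"
    unfolding energy_def using l1 l2 by (intro suminf_add) (auto simp: l2seq_def)
  also have "\<dots> = (\<Sum>n. 2 * (norm (u n))\<^sup>2) + (\<Sum>n. 2 * (norm (v n))\<^sup>2)"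
    unfolding par using assms by (intro suminf_add[symmetric] summable_mult) (auto simp: l2seq_def)
  also have "\<dots> = 2 * energy u + 2 * energy v"
    using assms by (simp add: energy_def l2seq_def suminf_mult)
  finally show "energy (\<lambda>n. u n + v n) + energy (\<lambda>n. u n - v n) = 2 * energy u + 2 * energy v" .
qed

lemma l2seq_zero: "l2seq (\<lambda>_. 0)" and energy_zero: "energy (\<lambda>_. 0) = 0"
  by (simp_all add: l2seq_def energy_def)

lemma sum_le_energy: "l2seq u \<Longrightarrow> finite I \<Longrightarrow> (\<Sum>n\<in>I. (norm (u n))\<^sup>2) \<le> energy u"
  unfolding energy_def l2seq_def by (rule sum_le_suminf) auto

lemma energy_nonneg: "l2seq u \<Longrightarrow> 0 \<le> energy u"
  using sum_le_energy[of u "{}"] by simp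

lemma norm_le_sqrt_energy: "l2seq u \<Longrightarrow> norm (u n) \<le> sqrt (energy u)"
  using sum_le_energy[of u "{n}"] real_le_rsqrt by simp

lemma l2seq_Suc_iff: "l2seq (\<lambda>n. u (Suc n)) \<longleftrightarrow> l2seq u"
  unfolding l2seq_def by (rule summable_Suc_iff)

lemma energy_Suc: "l2seq u \<Longrightarrow> energy u = (norm (u 0))\<^sup>2 + energy (\<lambda>n. u (Suc n))"
  unfolding energy_def l2seq_def by (subst suminf_split_head) auto

text \<open>For bounded u, the bounded solution of x(n) = A x(n+1) + B u(n). With u the future input
  it is the anticausal state; with u(k) the input at time -1-k it is the causal state at time
  -n.\<close>

definition tail_state :: "('x \<Rightarrow> 'x::real_normed_vector) \<Rightarrow> ('u \<Rightarrow> 'x) \<Rightarrow> (nat \<Rightarrow> 'u) \<Rightarrow> nat \<Rightarrow> 'x"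
  where "tail_state A B u n = (\<Sum>j. (A ^^ j) (B (u (n + j))))"

primrec fwd_state :: "('x \<Rightarrow> 'x::real_normed_vector) \<Rightarrow> ('u \<Rightarrow> 'x) \<Rightarrow> 'x \<Rightarrow> (nat \<Rightarrow> 'u) \<Rightarrow> nat \<Rightarrow> 'x"
  where "fwd_state A B x u 0 = x"
  | "fwd_state A B x u (Suc n) = A (fwd_state A B x u n) + B (u n)"

locale decaying =
  fixes A :: "'x::chilbert_space \<Rightarrow> 'x" and B :: "'u::chilbert_space \<Rightarrow> 'x" and D r :: real
  assumes A: "bounded_clinear A" and B: "bounded_clinear B"
    and D: "0 \<le> D" and r: "0 < r" "r < 1"
    and decay: "\<And>n x. norm ((A ^^ n) x) \<le> D * r ^ n * norm x"
begin

lemma gain: "\<exists>b>0. \<forall>j v. norm ((A ^^ j) (B v)) \<le> D * b * norm v * r ^ j"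
proof -
  obtain b where b: "0 < b" "\<And>x. norm (B x) \<le> b * norm x" using bounded_clinear_bound[OF B] by blast
  have "norm ((A ^^ j) (B v)) \<le> D * b * norm v * r ^ j" for j v
  proof -
    have "norm ((A ^^ j) (B v)) \<le> D * r ^ j * norm (B v)" by (rule decay)
    also have "\<dots> \<le> D * r ^ j * (b * norm v)" using b D r by (intro mult_left_mono) auto
    finally show ?thesis by (simp add: mult_ac)
  qed
  with b show ?thesis by blast
qed

lemma tail_bound:
  assumes "\<And>n. norm (u n) \<le> M"
  shows "summable (\<lambda>j. (A ^^ j) (B (u (n + j))))" "\<exists>M'. \<forall>n. norm (tail_state A B u n) \<le> M'"
proof -
  obtain b where b: "0 < b" "\<And>j v. norm ((A ^^ j) (B v)) \<le> D * b * norm v * r ^ j" using gain by blast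
  have le: "norm ((A ^^ j) (B (u (n + j)))) \<le> D * b * M * r ^ j" for n j
    by (rule order_trans[OF b(2)]) (use b D r assms in \<open>auto intro!: mult_right_mono mult_left_mono\<close>)
  have sm: "summable (\<lambda>j. D * b * M * r ^ j)" using r by (intro summable_mult summable_geometric) auto
  show "summable (\<lambda>j. (A ^^ j) (B (u (n + j))))" for n
    by (rule summable_comparison_test'[OF sm le])
  show "\<exists>M'. \<forall>n. norm (tail_state A B u n) \<le> M'"
    unfolding tail_state_def
    by (intro exI[of _ "\<Sum>j. D * b * M * r ^ j"] allI norm_suminf_le[OF le sm])
qed

lemma tail_rec:
  assumes "\<And>n. norm (u n) \<le> M"
  shows "tail_state A B u n = A (tail_state A B u (Suc n)) + B (u n)"
proof -
  note sm = tail_bound(1)[of u, OF assms]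
  have "tail_state A B u n = B (u n) + (\<Sum>j. (A ^^ Suc j) (B (u (n + Suc j))))"
    unfolding tail_state_def using suminf_split_head[OF sm[of n]] by simp
  also have "(\<Sum>j. (A ^^ Suc j) (B (u (n + Suc j)))) = A (tail_state A B u (Suc n))"
    unfolding tail_state_def using bounded_linear.suminf[OF bounded_clinear_linear[OF A] sm[of "Suc n"]]
    by simp
  finally show ?thesis by simp
qed

lemma tail_add_diff:
  assumes "\<And>n. norm (u n) \<le> M" "\<And>n. norm (v n) \<le> M'"
  shows "tail_state A B (\<lambda>n. u n + v n) n = tail_state A B u n + tail_state A B v n"
    "tail_state A B (\<lambda>n. u n - v n) n = tail_state A B u n - tail_state A B v n"
  using tail_bound(1)[of u, OF assms(1)] tail_bound(1)[of v, OF assms(2)]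
  unfolding tail_state_def
  by (simp_all add: bounded_clinearD[OF B] bounded_clinearD[OF bounded_clinear_power[OF A]]
      suminf_add suminf_diff)

lemma tail_scaleC:
  assumes "\<And>n. norm (u n) \<le> M"
  shows "tail_state A B (\<lambda>n. a *\<^sub>C u n) n = a *\<^sub>C tail_state A B u n"
  using bounded_linear.suminf[OF bounded_linear_scaleC tail_bound(1)[of u, OF assms]]
  unfolding tail_state_def
  by (simp add: bounded_clinearD[OF B] bounded_clinearD[OF bounded_clinear_power[OF A]])

lemma tail_zero: "tail_state A B (\<lambda>_. 0) n = 0"
  by (simp add: tail_state_def bounded_clinearD[OF B] bounded_clinearD[OF bounded_clinear_power[OF A]])

text \<open>The induction treats \<open>A ^^ m\<close> of the state for all m at once. Estimating
  step by step would multiply by \<open>D\<close> or by the norm of \<open>A\<close> each time, and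
  neither has to be below 1.\<close>

lemma fwd_bound:
  assumes M: "\<And>n. norm (u n) \<le> M"
  shows "\<exists>M'. \<forall>n. norm (fwd_state A B x u n) \<le> M'"
proof -
  obtain b where b: "0 < b" "\<And>j v. norm ((A ^^ j) (B v)) \<le> D * b * norm v * r ^ j" using gain by blast
  have le: "norm ((A ^^ j) (B (u n))) \<le> D * b * M * r ^ j" for n j
    by (rule order_trans[OF b(2)]) (use b D r assms in \<open>auto intro!: mult_right_mono mult_left_mono\<close>)
  have M0: "0 \<le> M" using M[of 0] norm_ge_zero order_trans by blast
  have main: "norm ((A ^^ m) (fwd_state A B x u n)) \<le> D * r ^ (m + n) * norm x + D * b * M * (\<Sum>k<n. r ^ (m + k))" for m n
  proof (induction n arbitrary: m)
    case 0 show ?case using decay by simp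
  next
    case (Suc n)
    have "(A ^^ m) (fwd_state A B x u (Suc n)) = (A ^^ Suc m) (fwd_state A B x u n) + (A ^^ m) (B (u n))"
      by (simp add: bounded_clinear_add[OF bounded_clinear_power[OF A]] funpow_swap1)
    then have "norm ((A ^^ m) (fwd_state A B x u (Suc n)))
       \<le> norm ((A ^^ Suc m) (fwd_state A B x u n)) + norm ((A ^^ m) (B (u n)))"
      using norm_triangle_ineq by metis
    also have "\<dots> \<le> (D * r ^ (Suc m + n) * norm x + D * b * M * (\<Sum>k<n. r ^ (Suc m + k))) + D * b * M * r ^ m"
      by (intro add_mono Suc le)
    also have "\<dots> = D * r ^ (m + Suc n) * norm x + D * b * M * (\<Sum>k<Suc n. r ^ (m + k))"
      by (subst sum.lessThan_Suc_shift) (simp add: distrib_left)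
    finally show ?case .
  qed
  have "norm (fwd_state A B x u n) \<le> D * norm x + D * b * M * (1 / (1 - r))" for n
  proof -
    have "(\<Sum>k<n. r ^ k) \<le> (\<Sum>k. r ^ k)" using r by (intro sum_le_suminf summable_geometric) auto
    then have "(\<Sum>k<n. r ^ k) \<le> 1 / (1 - r)" using r by (simp add: suminf_geometric)
    then have "D * b * M * (\<Sum>k<n. r ^ k) \<le> D * b * M * (1 / (1 - r))"
      using D b M0 by (intro mult_left_mono) auto
    moreover have "D * r ^ n * norm x \<le> D * 1 * norm x"
      using D r by (intro mult_right_mono mult_left_mono) (auto intro: power_le_one)
    ultimately show ?thesis using main[of 0 n] by simp
  qed
  then show ?thesis by blast
qed

lemma fwd_add_diff:
  "fwd_state A B (x + x') (\<lambda>n. u n + v n) n = fwd_state A B x u n + fwd_state A B x' v n"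
  "fwd_state A B (x - x') (\<lambda>n. u n - v n) n = fwd_state A B x u n - fwd_state A B x' v n"
  by (induction n) (auto simp: bounded_clinearD[OF A] bounded_clinearD[OF B])

lemma fwd_scaleC: "fwd_state A B (a *\<^sub>C x) (\<lambda>n. a *\<^sub>C u n) n = a *\<^sub>C fwd_state A B x u n"
  by (induction n) (auto simp: bounded_clinearD[OF A] bounded_clinearD[OF B] scaleC_add_right)

lemma fwd_zero_input: "fwd_state A B x (\<lambda>_. 0) n = (A ^^ n) x"
  by (induction n) (auto simp: bounded_clinearD[OF B])

end

lemma fwd_state_shift:
  "fwd_state A B x u (Suc n) = fwd_state A B (A x + B (u 0)) (\<lambda>n. u (Suc n)) n"
  by (induction n) auto

section \<open>From contractivity in frequency to an energy inequality in time\<close>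

section \<open>Contractive systems\<close>

text \<open>
  The output is written as \<open>E x\<^sub>-(n+1) + C x\<^sub>+(n) + G u(n)\<close>; the bicausal system of the
  theorem has \<open>E = C\<^sub>- A\<^sub>-\<close> and \<open>G = C\<^sub>- B\<^sub>- + D\<close>. The additional generality is needed in
  the strict case, where \<open>x\<^sub>-(n+1)\<close> itself is added to the output.
\<close>

locale contractive_system =
  minus: decaying Am Bm D r + plus: decaying Ap Bp D r
  for Am :: "'xm::chilbert_space \<Rightarrow> 'xm" and Bm :: "'u::chilbert_space \<Rightarrow> 'xm"
    and Ap :: "'xp::chilbert_space \<Rightarrow> 'xp" and Bp :: "'u \<Rightarrow> 'xp" and D r :: real +
  fixes E :: "'xm \<Rightarrow> 'y::chilbert_space" and C :: "'xp \<Rightarrow> 'y" and G :: "'u \<Rightarrow> 'y" and K :: real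
  assumes E: "bounded_clinear E" and C: "bounded_clinear C" and G: "bounded_clinear G" and K: "0 < K"
    and freq: "\<And>z u. cmod z = 1 \<Longrightarrow> \<exists>\<eta> \<xi>. \<eta> = inverse z *\<^sub>C Am \<eta> + Bm u \<and>
      inverse z *\<^sub>C \<xi> = Ap \<xi> + Bp u \<and> norm \<eta> \<le> K * norm u \<and> norm \<xi> \<le> K * norm u \<and>
      norm (inverse z *\<^sub>C E \<eta> + C \<xi> + G u) \<le> norm u"
begin

definition out :: "'xm \<Rightarrow> 'xp \<Rightarrow> 'u \<Rightarrow> 'y" where "out xm xp u = E xm + C xp + G u"

lemma out_add_diff:
  "out (xm + xm') (xp + xp') (u + u') = out xm xp u + out xm' xp' u'"
  "out (xm - xm') (xp - xp') (u - u') = out xm xp u - out xm' xp' u'"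
  by (simp_all add: out_def bounded_clinearD[OF E] bounded_clinearD[OF C] bounded_clinearD[OF G])

lemma out_scaleC: "out (a *\<^sub>C xm) (a *\<^sub>C xp) (a *\<^sub>C u) = a *\<^sub>C out xm xp u"
  by (simp add: out_def bounded_clinearD[OF E] bounded_clinearD[OF C] bounded_clinearD[OF G] scaleC_add_right)

text \<open>The input on the window is resolved into roots of unity, each amplitude is answered by
  \<open>freq\<close>, and the answers are resummed. Parseval turns the bounds per frequency into
  energy bounds; a single state sample is at most the energy of a whole period.\<close>

lemma periodic_response:
  assumes N: "0 < N"
  shows "\<exists>xm xp. (\<forall>n<N. xm n = Am (xm (Suc n)) + Bm (u n) \<and> xp (Suc n) = Ap (xp n) + Bp (u n)) \<and>
    xm N = xm 0 \<and> (\<Sum>n<N. (norm (out (xm (Suc n)) (xp n) (u n)))\<^sup>2) \<le> (\<Sum>n<N. (norm (u n))\<^sup>2) \<and>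
    norm (xm 0) \<le> K * sqrt (\<Sum>n<N. (norm (u n))\<^sup>2) \<and> norm (xp 0) \<le> K * sqrt (\<Sum>n<N. (norm (u n))\<^sup>2)"
proof -
  obtain c where c: "\<And>n. n < N \<Longrightarrow> dft N c n = u n" using dft_surj[of N u] by blast
  have "\<forall>j. \<exists>\<eta> \<xi>. \<eta> = inverse (unity_root N j) *\<^sub>C Am \<eta> + Bm (c j) \<and>
      inverse (unity_root N j) *\<^sub>C \<xi> = Ap \<xi> + Bp (c j) \<and> norm \<eta> \<le> K * norm (c j) \<and> norm \<xi> \<le> K * norm (c j) \<and>
      norm (inverse (unity_root N j) *\<^sub>C E \<eta> + C \<xi> + G (c j)) \<le> norm (c j)"
    by (intro allI freq) simp
  then obtain \<eta> \<xi> where \<eta>: "\<And>j. inverse (unity_root N j) *\<^sub>C Am (\<eta> j) + Bm (c j) = \<eta> j"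
    and \<xi>: "\<And>j. inverse (unity_root N j) *\<^sub>C \<xi> j = Ap (\<xi> j) + Bp (c j)"
    and bd: "\<And>j. norm (\<eta> j) \<le> K * norm (c j)" "\<And>j. norm (\<xi> j) \<le> K * norm (c j)"
    and y: "\<And>j. norm (inverse (unity_root N j) *\<^sub>C E (\<eta> j) + C (\<xi> j) + G (c j)) \<le> norm (c j)"
    by metis
  have Pc: "(\<Sum>n<N. (norm (u n))\<^sup>2) = real N * (\<Sum>j<N. (norm (c j))\<^sup>2)"
    using dft_Parseval[OF N, of c] c by simp
  have le: "norm (dft N x 0) \<le> K * sqrt (\<Sum>n<N. (norm (u n))\<^sup>2)"
    if "\<And>j. norm (x j) \<le> K * norm (c j)" for x :: "nat \<Rightarrow> 'z::complex_inner"
  proof -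
    have "(norm (dft N x 0))\<^sup>2 \<le> (\<Sum>n<N. (norm (dft N x n))\<^sup>2)"
      using N by (intro member_le_sum) auto
    also have "\<dots> = real N * (\<Sum>j<N. (norm (x j))\<^sup>2)" by (rule dft_Parseval[OF N])
    also have "\<dots> \<le> real N * (\<Sum>j<N. (K * norm (c j))\<^sup>2)"
      using that by (intro mult_left_mono sum_mono power_mono) auto
    also have "\<dots> = K\<^sup>2 * (\<Sum>n<N. (norm (u n))\<^sup>2)"
      by (simp add: Pc power_mult_distrib sum_distrib_left mult_ac)
    also have "\<dots> = (K * sqrt (\<Sum>n<N. (norm (u n))\<^sup>2))\<^sup>2" by (simp add: power_mult_distrib sum_nonneg)
    finally show ?thesis by (rule power2_le_imp_le) (use K in \<open>simp add: sum_nonneg\<close>)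
  qed
  show ?thesis
  proof (intro exI[of _ "dft N \<eta>"] exI[of _ "dft N \<xi>"] conjI allI impI)
    fix n assume n: "n < N"
    show "dft N \<eta> n = Am (dft N \<eta> (Suc n)) + Bm (u n)"
    proof -
      have "dft N \<eta> n = dft N (\<lambda>j. inverse (unity_root N j) *\<^sub>C Am (\<eta> j) + Bm (c j)) n" by (simp add: \<eta>)
      then show ?thesis
        by (simp add: c[OF n, symmetric] dft_Suc dft_apply minus.A minus.B
            bounded_clinear_scaleC[OF minus.A] dft_add)
    qed
    show "dft N \<xi> (Suc n) = Ap (dft N \<xi> n) + Bp (u n)"
      by (simp add: c[OF n, symmetric] dft_Suc dft_apply plus.A plus.B \<xi> dft_add)
  next
    show "dft N \<eta> N = dft N \<eta> 0" by (rule dft_shift_N[OF N])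
    have "out (dft N \<eta> (Suc n)) (dft N \<xi> n) (u n)
        = dft N (\<lambda>j. inverse (unity_root N j) *\<^sub>C E (\<eta> j) + C (\<xi> j) + G (c j)) n" if "n < N" for n
      using that by (simp add: out_def c[OF that, symmetric] dft_Suc dft_apply E C G bounded_clinear_scaleC[OF E] dft_add)
    then have "(\<Sum>n<N. (norm (out (dft N \<eta> (Suc n)) (dft N \<xi> n) (u n)))\<^sup>2)
        = real N * (\<Sum>j<N. (norm (inverse (unity_root N j) *\<^sub>C E (\<eta> j) + C (\<xi> j) + G (c j)))\<^sup>2)"
      using dft_Parseval[OF N] by simp
    also have "\<dots> \<le> (\<Sum>n<N. (norm (u n))\<^sup>2)" unfolding Pc
      using y by (intro mult_left_mono sum_mono power_mono) auto
    finally show "(\<Sum>n<N. (norm (out (dft N \<eta> (Suc n)) (dft N \<xi> n) (u n)))\<^sup>2) \<le> (\<Sum>n<N. (norm (u n))\<^sup>2)" .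
  qed (use le bd in auto)
qed

lemma out_bound: "\<exists>g>0. \<forall>xm xp. norm (out xm xp 0) \<le> g * (norm xm + norm xp)"
proof -
  obtain e where e: "0 < e" "\<And>x. norm (E x) \<le> e * norm x" using bounded_clinear_bound[OF E] by blast
  obtain c where c: "0 < c" "\<And>x. norm (C x) \<le> c * norm x" using bounded_clinear_bound[OF C] by blast
  have "norm (out xm xp 0) \<le> (e + c) * (norm xm + norm xp)" for xm xp
  proof -
    have "norm (out xm xp 0) \<le> norm (E xm) + norm (C xp)"
      by (simp add: out_def bounded_clinearD[OF G] norm_triangle_ineq)
    also have "\<dots> \<le> e * norm xm + c * norm xp" by (intro add_mono e c)
    also have "\<dots> \<le> (e + c) * (norm xm + norm xp)" using e(1) c(1) by (simp add: algebra_simps)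
    finally show ?thesis .
  qed
  then show ?thesis using e c by (intro exI[of _ "e + c"]) auto
qed

text \<open>
  The deviation of a trajectory from the periodic steady state for the same input solves the
  homogeneous equations, hence is small away from the ends of the window.
\<close>

lemma window_response:
  assumes g: "0 < g" "\<And>xm xp. norm (out xm xp 0) \<le> g * (norm xm + norm xp)"
    and N: "0 < N" and rec: "\<And>n. n < N \<Longrightarrow> xm n = Am (xm (Suc n)) + Bm (u n)"
      "\<And>n. n < N \<Longrightarrow> xp (Suc n) = Ap (xp n) + Bp (u n)"
    and M: "norm (xm N) \<le> M" "norm (xp 0) \<le> M" and S: "(\<Sum>n<N. (norm (u n))\<^sup>2) \<le> S"
  shows "\<exists>y. (\<Sum>n<N. (norm (y n))\<^sup>2) \<le> S \<and> (\<forall>n<N. norm (y n - out (xm (Suc n)) (xp n) (u n))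
     \<le> g * D * (M + K * sqrt S) * (r ^ (N - Suc n) + r ^ n))"
proof -
  obtain xm' xp' where rec': "\<And>n. n < N \<Longrightarrow> xm' n = Am (xm' (Suc n)) + Bm (u n)"
      "\<And>n. n < N \<Longrightarrow> xp' (Suc n) = Ap (xp' n) + Bp (u n)"
    and per: "xm' N = xm' 0"
    and y: "(\<Sum>n<N. (norm (out (xm' (Suc n)) (xp' n) (u n)))\<^sup>2) \<le> (\<Sum>n<N. (norm (u n))\<^sup>2)"
    and bd: "norm (xm' 0) \<le> K * sqrt (\<Sum>n<N. (norm (u n))\<^sup>2)" "norm (xp' 0) \<le> K * sqrt (\<Sum>n<N. (norm (u n))\<^sup>2)"
    using periodic_response[OF N, of u] by blast
  have sq: "K * sqrt (\<Sum>n<N. (norm (u n))\<^sup>2) \<le> K * sqrt S" using S K by simp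
  \<comment> \<open>The anticausal deviation spreads leftwards from the right end, the causal one
    (\<open>dp\<close>) rightwards from 0. Hence the two powers of r in the bound.\<close>
  have dm: "xm' (N - k) - xm (N - k) = (Am ^^ k) (xm' N - xm N)" if "k \<le> N" for k
    using that
  proof (induction k)
    case (Suc k)
    then have "Suc (N - Suc k) = N - k" "N - Suc k < N" by auto
    then show ?case using Suc rec(1)[of "N - Suc k"] rec'(1)[of "N - Suc k"]
      by (simp add: bounded_clinear_diff[OF minus.A, symmetric])
  qed simp
  have dp: "xp' k - xp k = (Ap ^^ k) (xp' 0 - xp 0)" if "k \<le> N" for k
    using that by (induction k) (auto simp: rec rec' bounded_clinear_diff[OF plus.A, symmetric])
  have n1: "norm (xm' N - xm N) \<le> M + K * sqrt S"
    using norm_triangle_ineq4[of "xm' N" "xm N"] per bd M sq by simp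
  have n2: "norm (xp' 0 - xp 0) \<le> M + K * sqrt S"
    using norm_triangle_ineq4[of "xp' 0" "xp 0"] bd M sq by simp
  have "norm (out (xm' (Suc n)) (xp' n) (u n) - out (xm (Suc n)) (xp n) (u n))
     \<le> g * D * (M + K * sqrt S) * (r ^ (N - Suc n) + r ^ n)" if n: "n < N" for n
  proof -
    have "norm (xm' (Suc n) - xm (Suc n)) \<le> D * r ^ (N - Suc n) * norm (xm' N - xm N)"
      using dm[of "N - Suc n"] n minus.decay[of "N - Suc n"] by (simp add: Suc_leI)
    also have "\<dots> \<le> D * r ^ (N - Suc n) * (M + K * sqrt S)"
      using minus.D minus.r n1 by (intro mult_left_mono) auto
    finally have 1: "norm (xm' (Suc n) - xm (Suc n)) \<le> D * r ^ (N - Suc n) * (M + K * sqrt S)" .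
    have "norm (xp' n - xp n) \<le> D * r ^ n * norm (xp' 0 - xp 0)"
      using dp[of n] n plus.decay[of n] by simp
    also have "\<dots> \<le> D * r ^ n * (M + K * sqrt S)"
      using minus.D minus.r n2 by (intro mult_left_mono) auto
    finally have 2: "norm (xp' n - xp n) \<le> D * r ^ n * (M + K * sqrt S)" .
    have "norm (out (xm' (Suc n)) (xp' n) (u n) - out (xm (Suc n)) (xp n) (u n))
        \<le> g * (norm (xm' (Suc n) - xm (Suc n)) + norm (xp' n - xp n))"
      using g(2)[of "xm' (Suc n) - xm (Suc n)" "xp' n - xp n"]
        out_add_diff(2)[of "xm' (Suc n)" "xm (Suc n)" "xp' n" "xp n" "u n" "u n"] by simp
    also have "\<dots> \<le> g * (D * r ^ (N - Suc n) * (M + K * sqrt S) + D * r ^ n * (M + K * sqrt S))"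
      using g(1) 1 2 by (intro mult_left_mono add_mono) auto
    finally show ?thesis by (simp add: algebra_simps)
  qed
  then show ?thesis using y S
    by (intro exI[of _ "\<lambda>n. out (xm' (Suc n)) (xp' n) (u n)"]) auto
qed

text \<open>The finite set \<open>I\<close> lies in windows [-P, P) whose ends recede. The periodic
  outputs obey the energy bound and approach the true ones on \<open>I\<close> like r^p, so the
  bound passes to the limit. Boundedness of the states is what controls the mismatch at the
  ends.\<close>

lemma bilateral_contraction:
  fixes u :: "int \<Rightarrow> 'u"
  assumes rec: "\<And>n. xm n = Am (xm (n + 1)) + Bm (u n)" "\<And>n. xp (n + 1) = Ap (xp n) + Bp (u n)"
    and M: "\<And>n. norm (xm n) \<le> M" "\<And>n. norm (xp n) \<le> M"
    and S: "\<And>I. finite I \<Longrightarrow> (\<Sum>n\<in>I. (norm (u n))\<^sup>2) \<le> S" and I: "finite I"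
  shows "(\<Sum>n\<in>I. (norm (out (xm (n + 1)) (xp n) (u n)))\<^sup>2) \<le> S"
proof -
  obtain g where g: "0 < g" "\<And>xm xp. norm (out xm xp 0) \<le> g * (norm xm + norm xp)" using out_bound by blast
  obtain q where q: "\<And>k. k \<in> I \<Longrightarrow> \<bar>k\<bar> < int q"
  proof -
    have "\<bar>k\<bar> < int (Suc (\<Sum>k\<in>I. nat \<bar>k\<bar>))" if "k \<in> I" for k
    proof -
      have "nat \<bar>k\<bar> \<le> (\<Sum>k\<in>I. nat \<bar>k\<bar>)" using that I by (intro member_le_sum) auto
      then show ?thesis by linarith
    qed
    then show ?thesis using that by blast
  qed
  \<comment> \<open>The factor 2 stands for the two ends of the window.\<close>
  define cst where "cst = 2 * (g * D * (M + K * sqrt S))"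
  have "0 \<le> M" using M(1)[of 0] norm_ge_zero order_trans by blast
  have "0 \<le> S" using S[of "{}"] by simp
  have base: "0 \<le> g * D * (M + K * sqrt S)" using \<open>0 \<le> M\<close> \<open>0 \<le> S\<close> g K minus.D by simp
  have "\<exists>y. (\<Sum>k\<in>I. (norm (y k))\<^sup>2) \<le> S \<and> (\<forall>k\<in>I. norm (y k - out (xm (k + 1)) (xp k) (u k)) \<le> cst * r ^ p)" for p
  proof (cases "p + q = 0")
    \<comment> \<open>The window would be empty, but q = 0 leaves no element in \<open>I\<close>
      either.\<close>
    case True then show ?thesis using q \<open>0 \<le> S\<close> by (intro exI[of _ "\<lambda>_. 0"]) force
  next
    case False
    define P where "P = p + q"
    define sh where "sh n = int n - int P" for n
    have inj: "inj_on sh J" for J by (auto simp: sh_def inj_on_def)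
    have sh1: "sh (Suc n) = sh n + 1" for n by (simp add: sh_def)
    have "(\<Sum>n<2 * P. (norm (u (sh n)))\<^sup>2) = (\<Sum>n\<in>sh ` {..<2 * P}. (norm (u n))\<^sup>2)"
      by (simp add: sum.reindex[OF inj])
    also have "\<dots> \<le> S" by (rule S) simp
    finally have Su: "(\<Sum>n<2 * P. (norm (u (sh n)))\<^sup>2) \<le> S" .
    have "\<exists>y. (\<Sum>n<2 * P. (norm (y n))\<^sup>2) \<le> S \<and>
      (\<forall>n<2 * P. norm (y n - out (xm (sh (Suc n))) (xp (sh n)) (u (sh n)))
        \<le> g * D * (M + K * sqrt S) * (r ^ (2 * P - Suc n) + r ^ n))"
    proof (rule window_response[OF g])
      show "0 < 2 * P" using False by (simp add: P_def)
      show "xm (sh n) = Am (xm (sh (Suc n))) + Bm (u (sh n))" for n unfolding sh1 by (rule rec)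
      show "xp (sh (Suc n)) = Ap (xp (sh n)) + Bp (u (sh n))" for n unfolding sh1 by (rule rec)
    qed (rule M Su)+
    then obtain y where y: "(\<Sum>n<2 * P. (norm (y n))\<^sup>2) \<le> S"
      "\<And>n. n < 2 * P \<Longrightarrow> norm (y n - out (xm (sh n + 1)) (xp (sh n)) (u (sh n)))
        \<le> g * D * (M + K * sqrt S) * (r ^ (2 * P - Suc n) + r ^ n)"
      unfolding sh1 by blast
    define ix where "ix k = nat (k + int P)" for k
    have ix: "ix k < 2 * P" "sh (ix k) = k" "p \<le> ix k" "p \<le> 2 * P - Suc (ix k)" if "k \<in> I" for k
      using q[OF that] by (auto simp: ix_def sh_def P_def)
    show ?thesis
    proof (intro exI[of _ "\<lambda>k. y (ix k)"] conjI ballI)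
      have "inj_on ix I" using ix(2) by (metis inj_onI)
      then have "(\<Sum>k\<in>I. (norm (y (ix k)))\<^sup>2) = (\<Sum>n\<in>ix ` I. (norm (y n))\<^sup>2)" by (simp add: sum.reindex)
      also have "\<dots> \<le> (\<Sum>n<2 * P. (norm (y n))\<^sup>2)" using ix(1) by (intro sum_mono2) auto
      finally show "(\<Sum>k\<in>I. (norm (y (ix k)))\<^sup>2) \<le> S" using y by simp
      fix k assume k: "k \<in> I"
      have "r ^ ix k \<le> r ^ p" "r ^ (2 * P - Suc (ix k)) \<le> r ^ p"
        using ix[OF k] minus.r by (auto intro!: power_decreasing)
      then have "g * D * (M + K * sqrt S) * (r ^ (2 * P - Suc (ix k)) + r ^ ix k)
          \<le> g * D * (M + K * sqrt S) * (r ^ p + r ^ p)"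
        using base by (intro mult_left_mono add_mono) auto
      then show "norm (y (ix k) - out (xm (k + 1)) (xp k) (u k)) \<le> cst * r ^ p"
        using y(2)[OF ix(1)[OF k]] by (simp add: ix(2)[OF k] cst_def)
    qed
  qed
  then obtain y where y: "\<And>p. (\<Sum>k\<in>I. (norm (y p k))\<^sup>2) \<le> S"
    "\<And>p k. k \<in> I \<Longrightarrow> norm (y p k - out (xm (k + 1)) (xp k) (u k)) \<le> cst * r ^ p" by metis
  have lim: "(\<lambda>p. y p k) \<longlonglongrightarrow> out (xm (k + 1)) (xp k) (u k)" if "k \<in> I" for k
  proof (rule LIM_zero_cancel, rule Lim_null_comparison)
    show "\<forall>\<^sub>F p in sequentially. norm (y p k - out (xm (k + 1)) (xp k) (u k)) \<le> cst * r ^ p"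
      using y(2)[OF that] by simp
    show "(\<lambda>p. cst * r ^ p) \<longlonglongrightarrow> 0"
      using minus.r by (intro tendsto_mult_right_zero LIMSEQ_power_zero) auto
  qed
  have "(\<lambda>p. \<Sum>k\<in>I. (norm (y p k))\<^sup>2) \<longlonglongrightarrow> (\<Sum>k\<in>I. (norm (out (xm (k + 1)) (xp k) (u k)))\<^sup>2)"
    by (intro tendsto_sum tendsto_power tendsto_norm lim)
  then show ?thesis by (rule LIMSEQ_le_const2) (use y(1) in auto)
qed

text \<open>The anticausal initial state is not an argument: it is
  \<open>tail_state Am Bm u 0\<close>, already fixed by u.\<close>

definition future :: "'xp \<Rightarrow> (nat \<Rightarrow> 'u) \<Rightarrow> nat \<Rightarrow> 'y"
  where "future xp u n = out (tail_state Am Bm u (Suc n)) (fwd_state Ap Bp xp u n) (u n)"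

text \<open>The argument \<open>k\<close> stands for the time \<open>-1-k\<close>.\<close>

definition past :: "'xm \<Rightarrow> (nat \<Rightarrow> 'u) \<Rightarrow> nat \<Rightarrow> 'y"
  where "past xm u k = out (fwd_state Am Bm xm u k) (tail_state Ap Bp u (Suc k)) (u k)"

text \<open>\<open>u\<close> and the time-reversed \<open>v\<close> are glued into one input on the
  integers. At time 0 the past supplies the causal state and the future the anticausal one, so the
  four one-sided state sequences form a single bounded trajectory.\<close>

lemma dissipation:
  assumes u: "l2seq u" and v: "l2seq v"
  defines "yf \<equiv> future (tail_state Ap Bp v 0) u" and "yp \<equiv> past (tail_state Am Bm u 0) v"
  shows "l2seq yf" "l2seq yp" "energy yf + energy yp \<le> energy u + energy v"
proof -
  define U where "U n = (if 0 \<le> n then u (nat n) else v (nat (- n - 1)))" for n :: int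
  define XM where "XM n = (if 0 \<le> n then tail_state Am Bm u (nat n)
     else fwd_state Am Bm (tail_state Am Bm u 0) v (nat (- n)))" for n :: int
  define XP where "XP n = (if 0 \<le> n then fwd_state Ap Bp (tail_state Ap Bp v 0) u (nat n)
     else tail_state Ap Bp v (nat (- n)))" for n :: int
  note ub = norm_le_sqrt_energy[OF u] and vb = norm_le_sqrt_energy[OF v]
  have recm: "XM n = Am (XM (n + 1)) + Bm (U n)" for n
  proof -
    consider "n \<ge> 0" | "n = -1" | "n < -1" by linarith
    then show ?thesis
    proof cases
      case 1
      then show ?thesis using minus.tail_rec[of u, OF ub, of "nat n"]
        by (simp add: XM_def U_def nat_add_distrib)
    next
      case 3
      then have "nat (- n) = Suc (nat (- n - 1))" "nat (- (n + 1)) = nat (- n - 1)" by auto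
      then show ?thesis using 3 by (simp add: XM_def U_def)
    qed (simp add: XM_def U_def)
  qed
  have recp: "XP (n + 1) = Ap (XP n) + Bp (U n)" for n
  proof -
    consider "n \<ge> 0" | "n = -1" | "n < -1" by linarith
    then show ?thesis
    proof cases
      case 1
      then show ?thesis by (simp add: XP_def U_def nat_add_distrib)
    next
      case 2
      then show ?thesis using plus.tail_rec[of v, OF vb, of 0] by (simp add: XP_def U_def)
    next
      case 3
      then have "nat (- n) = Suc (nat (- n - 1))" "nat (- (n + 1)) = nat (- n - 1)" by auto
      then show ?thesis using 3 plus.tail_rec[of v, OF vb, of "nat (- n - 1)"] by (simp add: XP_def U_def)
    qed
  qed
  obtain M1 M2 M3 M4 where MM: "\<And>n. norm (tail_state Am Bm u n) \<le> M1"
    "\<And>n. norm (fwd_state Am Bm (tail_state Am Bm u 0) v n) \<le> M2"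
    "\<And>n. norm (tail_state Ap Bp v n) \<le> M3"
    "\<And>n. norm (fwd_state Ap Bp (tail_state Ap Bp v 0) u n) \<le> M4"
    using minus.tail_bound(2)[of u, OF ub] minus.fwd_bound[of v, OF vb]
      plus.tail_bound(2)[of v, OF vb] plus.fwd_bound[of u, OF ub] by metis
  define M where "M = max (max M1 M2) (max M3 M4)"
  have Mb: "norm (XM n) \<le> M" "norm (XP n) \<le> M" for n
    using MM(1)[of "nat n"] MM(2)[of "nat (- n)"] MM(3)[of "nat (- n)"] MM(4)[of "nat n"]
    by (auto simp: XM_def XP_def M_def)
  have S: "(\<Sum>n\<in>I. (norm (U n))\<^sup>2) \<le> energy u + energy v" if I: "finite I" for I
  proof -
    let ?P = "{n\<in>I. 0 \<le> n}" and ?N = "{n\<in>I. \<not> 0 \<le> n}"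
    have "(\<Sum>n\<in>I. (norm (U n))\<^sup>2) = (\<Sum>n\<in>?P. (norm (U n))\<^sup>2) + (\<Sum>n\<in>?N. (norm (U n))\<^sup>2)"
      using I by (subst sum.union_disjoint[symmetric]) (auto intro!: sum.cong)
    also have "(\<Sum>n\<in>?P. (norm (U n))\<^sup>2) = (\<Sum>n\<in>nat ` ?P. (norm (u n))\<^sup>2)"
      by (subst sum.reindex) (auto simp: U_def inj_on_def intro!: sum.cong)
    also have "\<dots> \<le> energy u" using I by (intro sum_le_energy u) auto
    also have "(\<Sum>n\<in>?N. (norm (U n))\<^sup>2) = (\<Sum>n\<in>(\<lambda>n. nat (- n - 1)) ` ?N. (norm (v n))\<^sup>2)"
      by (subst sum.reindex) (auto simp: U_def inj_on_def intro!: sum.cong)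
    also have "\<dots> \<le> energy v" using I by (intro sum_le_energy v) auto
    finally show ?thesis by simp
  qed
  have part: "(\<Sum>n<m. (norm (yf n))\<^sup>2) + (\<Sum>k<m. (norm (yp k))\<^sup>2) \<le> energy u + energy v" for m
  proof -
    let ?Y = "\<lambda>n. out (XM (n + 1)) (XP n) (U n)"
    let ?I = "int ` {..<m}" and ?J = "(\<lambda>k. - 1 - int k) ` {..<m}"
    have f: "?Y (int n) = yf n" for n
      by (simp add: XM_def XP_def U_def yf_def future_def nat_add_distrib)
    \<comment> \<open>For k = 0 the output at time -1 uses the anticausal state at time 0, which
      comes from the other branch of \<open>XM\<close>.\<close>
    have p: "?Y (- 1 - int k) = yp k" for k
      by (cases "k = 0") (auto simp: XM_def XP_def U_def yp_def past_def nat_add_distrib)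
    have "(\<Sum>n\<in>?I \<union> ?J. (norm (?Y n))\<^sup>2) = (\<Sum>n\<in>?I. (norm (?Y n))\<^sup>2) + (\<Sum>n\<in>?J. (norm (?Y n))\<^sup>2)"
      by (rule sum.union_disjoint) auto
    also have "(\<Sum>n\<in>?I. (norm (?Y n))\<^sup>2) = (\<Sum>n<m. (norm (yf n))\<^sup>2)"
      by (subst sum.reindex) (auto simp: inj_on_def f)
    also have "(\<Sum>n\<in>?J. (norm (?Y n))\<^sup>2) = (\<Sum>k<m. (norm (yp k))\<^sup>2)"
      by (subst sum.reindex) (simp_all only: o_def p, auto simp: inj_on_def)
    finally show ?thesis
      using bilateral_contraction[OF recm recp Mb S, of "?I \<union> ?J"] by simp
  qed
  show f: "l2seq yf" unfolding l2seq_def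
  proof (rule summableI_nonneg_bounded)
    fix m show "(\<Sum>n<m. (norm (yf n))\<^sup>2) \<le> energy u + energy v"
      using part[of m] sum_nonneg[of "{..<m}" "\<lambda>k. (norm (yp k))\<^sup>2"] by simp
  qed simp
  show p: "l2seq yp" unfolding l2seq_def
  proof (rule summableI_nonneg_bounded)
    fix m show "(\<Sum>n<m. (norm (yp n))\<^sup>2) \<le> energy u + energy v"
      using part[of m] sum_nonneg[of "{..<m}" "\<lambda>k. (norm (yf k))\<^sup>2"] by simp
  qed simp
  have "(\<lambda>m. (\<Sum>n<m. (norm (yf n))\<^sup>2) + (\<Sum>k<m. (norm (yp k))\<^sup>2)) \<longlonglongrightarrow> energy yf + energy yp"
    unfolding energy_def using f p by (intro tendsto_add summable_LIMSEQ) (auto simp: l2seq_def)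
  then show "energy yf + energy yp \<le> energy u + energy v"
    by (rule LIMSEQ_le_const2) (use part in auto)
qed

end

section \<open>The available storage\<close>

text \<open>Exact minimality as energy estimates: states are reached at cost at most k |x|^2 and
  seen with energy at least c |x|^2. The anticausal state is observed through \<open>E\<close>,
  since under zero past input the output at time -1-n is \<open>E ((Am ^^ n) x)\<close>.\<close>

locale minimal_system = contractive_system Am Bm Ap Bp D r E C G K
  for Am :: "'xm::chilbert_space \<Rightarrow> 'xm" and Bm :: "'u::chilbert_space \<Rightarrow> 'xm"
    and Ap :: "'xp::chilbert_space \<Rightarrow> 'xp" and Bp :: "'u \<Rightarrow> 'xp" and D r :: real
    and E :: "'xm \<Rightarrow> 'y::chilbert_space" and C :: "'xp \<Rightarrow> 'y" and G :: "'u \<Rightarrow> 'y" and K :: real +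
  fixes k c :: real
  assumes k: "0 \<le> k" and c: "0 < c"
    and control_minus: "\<And>x. \<exists>u. l2seq u \<and> tail_state Am Bm u 0 = x \<and> energy u \<le> k * (norm x)\<^sup>2"
    and control_plus: "\<And>x. \<exists>u. l2seq u \<and> tail_state Ap Bp u 0 = x \<and> energy u \<le> k * (norm x)\<^sup>2"
    and observe_minus: "\<And>x. c * (norm x)\<^sup>2 \<le> energy (\<lambda>n. E ((Am ^^ n) x))"
    and observe_plus: "\<And>x. c * (norm x)\<^sup>2 \<le> energy (\<lambda>n. C ((Ap ^^ n) x))"
begin

definition inputs :: "'xm \<Rightarrow> (nat \<Rightarrow> 'u) set"
  where "inputs x = {u. l2seq u \<and> tail_state Am Bm u 0 = x}"

definition net_supply :: "'xp \<Rightarrow> (nat \<Rightarrow> 'u) \<Rightarrow> real"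
  where "net_supply x u = energy (future x u) - energy u"

definition storage :: "'xm \<times> 'xp \<Rightarrow> real"
  where "storage x = (SUP u\<in>inputs (fst x). net_supply (snd x) u)"

lemma l2seq_future: "l2seq u \<Longrightarrow> l2seq (future x u)"
  using control_plus[of x] dissipation(1) by blast

text \<open>A past input that reaches x cheaply is put in front and the past output is discarded:
  the future cannot return more than the past has spent.\<close>

lemma net_supply_le:
  assumes "l2seq u" shows "net_supply x u \<le> k * (norm x)\<^sup>2"
proof -
  obtain v where v: "l2seq v" "tail_state Ap Bp v 0 = x" "energy v \<le> k * (norm x)\<^sup>2"
    using control_plus by blast
  have "energy (future x u) \<le> energy u + energy v"
    using dissipation(2,3)[OF assms v(1)] energy_nonneg unfolding v(2) by fastforce
  with v(3) show ?thesis by (simp add: net_supply_def)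
qed

lemma inputs_nonempty: "inputs x \<noteq> {}"
  using control_minus[of x] by (auto simp: inputs_def)

lemma bdd_net_supply: "bdd_above (net_supply y ` inputs x)"
  by (rule bdd_aboveI2[of _ _ "k * (norm y)\<^sup>2"]) (auto simp: inputs_def intro: net_supply_le)

lemma net_supply_le_storage: "u \<in> inputs (fst x) \<Longrightarrow> net_supply (snd x) u \<le> storage x"
  unfolding storage_def by (intro cSUP_upper bdd_net_supply)

lemma storage_least: "(\<And>u. u \<in> inputs (fst x) \<Longrightarrow> net_supply (snd x) u \<le> b) \<Longrightarrow> storage x \<le> b"
  unfolding storage_def by (intro cSUP_least inputs_nonempty)

lemma storage_le: "storage x \<le> k * (norm (snd x))\<^sup>2"
  by (rule storage_least) (auto simp: inputs_def intro: net_supply_le)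

lemma storage_ge: "- (k * (norm (fst x))\<^sup>2) \<le> storage x"
proof -
  obtain u where u: "l2seq u" "tail_state Am Bm u 0 = fst x" "energy u \<le> k * (norm (fst x))\<^sup>2"
    using control_minus by blast
  have "- (k * (norm (fst x))\<^sup>2) \<le> net_supply (snd x) u"
    using u energy_nonneg[OF l2seq_future[OF u(1)], of "snd x"] by (simp add: net_supply_def)
  also have "\<dots> \<le> storage x" using u by (intro net_supply_le_storage) (simp add: inputs_def)
  finally show ?thesis .
qed

lemma storage_abs_le: "\<bar>storage x\<bar> \<le> k * (norm x)\<^sup>2"
proof -
  have "(norm x)\<^sup>2 = (norm (fst x))\<^sup>2 + (norm (snd x))\<^sup>2" by (simp add: norm_prod_def)
  then have "k * (norm (fst x))\<^sup>2 \<le> k * (norm x)\<^sup>2" "k * (norm (snd x))\<^sup>2 \<le> k * (norm x)\<^sup>2"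
    using k by (auto intro: mult_left_mono)
  with storage_le[of x] storage_ge[of x] show ?thesis by linarith
qed

lemma inputs_add_diff:
  assumes "u \<in> inputs x" "v \<in> inputs y"
  shows "(\<lambda>n. u n + v n) \<in> inputs (x + y)" "(\<lambda>n. u n - v n) \<in> inputs (x - y)"
  using assms l2seq_add_diff[of u v] minus.tail_add_diff[of u _ v, OF norm_le_sqrt_energy norm_le_sqrt_energy]
  by (auto simp: inputs_def)

lemma future_add_diff:
  assumes "l2seq u" "l2seq v"
  shows "future (x + y) (\<lambda>n. u n + v n) = (\<lambda>n. future x u n + future y v n)"
    "future (x - y) (\<lambda>n. u n - v n) = (\<lambda>n. future x u n - future y v n)"
  using assms
  by (simp_all add: fun_eq_iff future_def out_add_diff plus.fwd_add_diff
      minus.tail_add_diff[of u _ v, OF norm_le_sqrt_energy norm_le_sqrt_energy])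

lemma future_scaleC: "l2seq u \<Longrightarrow> future (a *\<^sub>C x) (\<lambda>n. a *\<^sub>C u n) = (\<lambda>n. a *\<^sub>C future x u n)"
  by (simp add: fun_eq_iff future_def out_scaleC plus.fwd_scaleC minus.tail_scaleC[of u, OF norm_le_sqrt_energy])

text \<open>Inputs u, v compete through u + v and u - v, for which the net supply satisfies the
  parallelogram identity exactly; taking suprema turns the identity into an inequality.\<close>

lemma storage_parallelogram: "2 * storage x + 2 * storage y \<le> storage (x + y) + storage (x - y)"
proof -
  have *: "2 * net_supply (snd x) u + 2 * net_supply (snd y) v \<le> storage (x + y) + storage (x - y)"
    if u: "u \<in> inputs (fst x)" and v: "v \<in> inputs (fst y)" for u v
  proof -
    have l: "l2seq u" "l2seq v" using u v by (auto simp: inputs_def)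
    have "net_supply (snd (x + y)) (\<lambda>n. u n + v n) + net_supply (snd (x - y)) (\<lambda>n. u n - v n)
        = 2 * net_supply (snd x) u + 2 * net_supply (snd y) v"
      using l2seq_add_diff(3)[OF l]
        l2seq_add_diff(3)[OF l2seq_future[OF l(1), of "snd x"] l2seq_future[OF l(2), of "snd y"]]
      by (simp add: net_supply_def future_add_diff[OF l])
    moreover have "net_supply (snd (x + y)) (\<lambda>n. u n + v n) \<le> storage (x + y)"
       "net_supply (snd (x - y)) (\<lambda>n. u n - v n) \<le> storage (x - y)"
      using inputs_add_diff[OF u v] by (intro net_supply_le_storage; simp)+
    ultimately show ?thesis by linarith
  qed
  \<comment> \<open>The two suprema are taken one after the other, with all remaining terms as the
    upper bound.\<close>
  have "storage x \<le> (storage (x + y) + storage (x - y)) / 2 - net_supply (snd y) v" if "v \<in> inputs (fst y)" for v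
  proof (rule storage_least)
    fix u assume "u \<in> inputs (fst x)"
    from *[OF this that]
    show "net_supply (snd x) u \<le> (storage (x + y) + storage (x - y)) / 2 - net_supply (snd y) v" by argo
  qed
  then have "net_supply (snd y) v \<le> (storage (x + y) + storage (x - y)) / 2 - storage x"
    if "v \<in> inputs (fst y)" for v using that by fastforce
  then have "storage y \<le> (storage (x + y) + storage (x - y)) / 2 - storage x"
    by (rule storage_least)
  then show ?thesis by argo
qed

text \<open>Scaling inputs gives one inequality for every a \<noteq> 0, and the same inequality for
  \<open>inverse a\<close> gives the converse.\<close>

lemma storage_scaleC: "storage (a *\<^sub>C x) = (cmod a)\<^sup>2 * storage x"
proof -
  have le: "(cmod a)\<^sup>2 * storage x \<le> storage (a *\<^sub>C x)" if "a \<noteq> 0" for a x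
  proof -
    have "storage x \<le> storage (a *\<^sub>C x) / (cmod a)\<^sup>2"
    proof (rule storage_least)
      fix u assume u: "u \<in> inputs (fst x)"
      then have l: "l2seq u" by (simp add: inputs_def)
      have "(\<lambda>n. a *\<^sub>C u n) \<in> inputs (fst (a *\<^sub>C x))"
        using u l by (simp add: inputs_def l2seq_scaleC minus.tail_scaleC[of u, OF norm_le_sqrt_energy])
      from net_supply_le_storage[OF this]
      have "(cmod a)\<^sup>2 * net_supply (snd x) u \<le> storage (a *\<^sub>C x)"
        by (simp add: net_supply_def future_scaleC[OF l] energy_scaleC l l2seq_future right_diff_distrib)
      then show "net_supply (snd x) u \<le> storage (a *\<^sub>C x) / (cmod a)\<^sup>2"
        using that by (simp add: field_simps)
    qed
    then show ?thesis using that by (simp add: field_simps)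
  qed
  show ?thesis
  proof (cases "a = 0")
    case True
    have "storage (0 *\<^sub>C x) = 0" using storage_abs_le[of "0 *\<^sub>C x"] by simp
    with True show ?thesis by simp
  next
    case False
    have "storage (a *\<^sub>C x) = (cmod a)\<^sup>2 * ((cmod (inverse a))\<^sup>2 * storage (a *\<^sub>C x))"
      using False by (simp add: norm_inverse power_inverse)
    also have "\<dots> \<le> (cmod a)\<^sup>2 * storage x"
      using le[of "inverse a" "a *\<^sub>C x"] False by (intro mult_left_mono) (simp_all add: scaleC_scaleC scaleC_one)
    finally have "storage (a *\<^sub>C x) \<le> (cmod a)\<^sup>2 * storage x" .
    with le[OF False, of x] show ?thesis by simp
  qed
qed

text \<open>The zero input is admissible and leaves the free response, whose energy observability
  bounds below.\<close>

lemma storage_plus_ge: "c * (norm x)\<^sup>2 \<le> storage (0, x)"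
proof -
  have "(\<lambda>_. 0) \<in> inputs (fst (0, x))" by (simp add: inputs_def l2seq_zero minus.tail_zero)
  from net_supply_le_storage[OF this] have "energy (future x (\<lambda>_. 0)) \<le> storage (0, x)"
    by (simp add: net_supply_def energy_zero)
  moreover have "future x (\<lambda>_. 0) = (\<lambda>n. C ((Ap ^^ n) x))"
    by (simp add: fun_eq_iff future_def out_def minus.tail_zero plus.fwd_zero_input
        bounded_clinear_zero[OF E] bounded_clinear_zero[OF G])
  ultimately show ?thesis using observe_plus[of x] by simp
qed

text \<open>Zero past input makes the causal state at 0 vanish and the past output the free response
  of x. Future and past output together cost at most the input energy, so every net supply is at
  most minus the observed energy.\<close>

lemma storage_minus_le: "storage (x, 0) \<le> - (c * (norm x)\<^sup>2)"
proof (rule storage_least)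
  fix u assume "u \<in> inputs (fst (x, 0 :: 'xp))"
  then have u: "l2seq u" "tail_state Am Bm u 0 = x" by (auto simp: inputs_def)
  have "past x (\<lambda>_. 0) = (\<lambda>n. E ((Am ^^ n) x))"
    by (simp add: fun_eq_iff past_def out_def plus.tail_zero minus.fwd_zero_input
        bounded_clinear_zero[OF C] bounded_clinear_zero[OF G])
  then show "net_supply (snd (x, 0 :: 'xp)) u \<le> - (c * (norm x)\<^sup>2)"
    using dissipation(3)[OF u(1) l2seq_zero] observe_minus[of x]
    by (simp add: plus.tail_zero u(2) net_supply_def energy_zero)
qed

text \<open>\<open>xm\<close> is the anticausal state at time 1. A competitor v for the left
  supremum, delayed by one step behind u, becomes a competitor for the right one, and the first term
  of its net supply splits off.\<close>

lemma storage_dissipates: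
  "storage (xm, Ap xp + Bp u) + (norm (out xm xp u))\<^sup>2 \<le> storage (Am xm + Bm u, xp) + (norm u)\<^sup>2"
proof -
  have "storage (xm, Ap xp + Bp u) \<le> storage (Am xm + Bm u, xp) + (norm u)\<^sup>2 - (norm (out xm xp u))\<^sup>2"
  proof (rule storage_least)
    fix v assume "v \<in> inputs (fst (xm, Ap xp + Bp u))"
    then have v: "l2seq v" "tail_state Am Bm v 0 = xm" by (auto simp: inputs_def)
    define w where "w = case_nat u v"
    have w: "w 0 = u" "(\<lambda>n. w (Suc n)) = v" by (simp_all add: w_def)
    have lw: "l2seq w" using v(1) l2seq_Suc_iff[of w] by (simp add: w)
    have shift: "tail_state Am Bm w (Suc n) = tail_state Am Bm v n" for n
      by (simp add: tail_state_def w_def)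
    have t0: "tail_state Am Bm w 0 = Am xm + Bm u"
      using minus.tail_rec[of w, OF norm_le_sqrt_energy[OF lw], of 0] by (simp add: shift v w)
    have f0: "future xp w 0 = out xm xp u" by (simp add: future_def shift v w)
    have fS: "(\<lambda>n. future xp w (Suc n)) = future (Ap xp + Bp u) v"
      unfolding future_def fwd_state_shift[of Ap Bp xp w] shift w by (simp add: w_def)
    have "net_supply xp w = (norm (out xm xp u))\<^sup>2 - (norm u)\<^sup>2 + net_supply (Ap xp + Bp u) v"
      unfolding net_supply_def energy_Suc[OF lw] energy_Suc[OF l2seq_future[OF lw]] f0 fS w by simp
    moreover have "net_supply xp w \<le> storage (Am xm + Bm u, xp)"
      using net_supply_le_storage[of w "(Am xm + Bm u, xp)"] lw t0 by (simp add: inputs_def)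
    ultimately show "net_supply (snd (xm, Ap xp + Bp u)) v
        \<le> storage (Am xm + Bm u, xp) + (norm u)\<^sup>2 - (norm (out xm xp u))\<^sup>2" by simp
  qed
  then show ?thesis by simp
qed

end

text \<open>In the quadratic form of J H the two off-diagonal terms cancel by symmetry of
  \<open>H\<close>, leaving the sum of the two definite diagonal contributions.\<close>

lemma admissible_if_indefinite:
  fixes H :: "'a::chilbert_space \<times> 'b::chilbert_space \<Rightarrow> 'a \<times> 'b"
  assumes H: "bounded_clinear H" and sym: "\<And>x y. inner (H x) y = inner x (H y)"
    and c: "0 < c" and neg: "\<And>x. inner (H (x, 0)) (x, 0) \<le> - (c * (norm x)\<^sup>2)"
    and pos: "\<And>x. c * (norm x)\<^sup>2 \<le> inner (H (0, x)) (0, x)"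
  shows "admissible_H H"
proof -
  define J where "J x = (- fst x, snd x)" for x :: "'a \<times> 'b"
  have J: "bounded_clinear J"
    using bounded_clinear_Pair[OF bounded_clinear_minus[OF bounded_clinear_const_zero
          bounded_clinear_fst[OF bounded_clinear_id]] bounded_clinear_snd[OF bounded_clinear_id]]
    by (simp add: J_def[abs_def])
  have split: "H (a, b) = H (a, 0) + H (0, b)" for a b
    by (simp flip: bounded_clinear_add[OF H])
  have inv: "boundedly_invertible H"
  proof (rule boundedly_invertible_if_coercive[OF H J _ c])
    show "J (J x) = x" for x by (simp add: J_def)
    fix x :: "'a \<times> 'b"
    obtain a b where x: "x = (a, b)" by force
    have "inner (J (H x)) x = - inner (H (a, 0)) (a, 0) + inner (H (0, b)) (0, b)
        + (inner (H (a, 0)) (0, b) - inner (H (0, b)) (a, 0))"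
      by (simp add: x split[of a b] J_def inner_prod_def inner_simps)
    also have "inner (H (a, 0)) (0, b) = inner (H (0, b)) (a, 0)"
      using sym[of "(a, 0)" "(0, b)"] by (simp add: inner_commute)
    finally show "c * (norm x)\<^sup>2 \<le> inner (J (H x)) x"
      using neg[of a] pos[of b] by (simp add: x norm_prod_def distrib_left)
  qed
  have H': "bounded_clinear (\<lambda>x. H (T x))" if "bounded_clinear T" for T :: "'z::complex_inner \<Rightarrow> 'a \<times> 'b"
    by (rule bounded_clinear_compose[OF H that])
  define Hm H0 Hp where "Hm x = fst (H (x, 0))" and "H0 y = fst (H (0, y))" and "Hp y = snd (H (0, y))" for x y
  have bl: "bounded_clinear Hm" "bounded_clinear H0" "bounded_clinear Hp"
    unfolding Hm_def[abs_def] H0_def[abs_def] Hp_def[abs_def]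
    by (intro bounded_clinear_intros H')+
  have "cadjoint H0 = (\<lambda>x. snd (H (x, 0)))"
  proof (intro cadjoint_unique cinner_adjointI)
    show "inner (H0 x) y = inner x (snd (H (y, 0)))" for x y
      using sym[of "(0, x)" "(y, 0)"] by (simp add: H0_def inner_prod_def)
  qed (simp add: bounded_clinear_scaleC[OF bl(2)])
  then have "H (a, b) = block_op Hm H0 (cadjoint H0) Hp (a, b)" for a b
    by (simp add: split[of a b] block_op_def Hm_def H0_def Hp_def prod_eq_iff)
  then have "H = block_op Hm H0 (cadjoint H0) Hp" by auto
  with bl inv H selfadjointI[OF H sym] show ?thesis unfolding admissible_H_def by blast
qed

lemma (in minimal_system) storage_operator:
  "\<exists>H. admissible_H H \<and> (\<forall>xm xp u. inner (H (xm, Ap xp + Bp u)) (xm, Ap xp + Bp u) + (norm (out xm xp u))\<^sup>2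
    \<le> inner (H (Am xm + Bm u, xp)) (Am xm + Bm u, xp) + (norm u)\<^sup>2)"
proof -
  obtain H where H: "bounded_clinear H" "\<And>x y. inner (H x) y = inner x (H y)"
    and q: "\<And>x. inner (H x) x = storage x"
    using quadratic_form_operator[OF storage_parallelogram storage_scaleC storage_abs_le] by blast
  have "admissible_H H"
    by (rule admissible_if_indefinite[OF H c]) (simp_all only: q storage_minus_le storage_plus_ge)
  then show ?thesis using storage_dissipates by (intro exI[of _ H]) (simp only: q simp_thms)
qed

section \<open>Surjectivity of the four operators as energy estimates\<close>

section \<open>Controllability and observability operators\<close>

lemma infsum_nonneg_reindex_nat:
  fixes f :: "nat \<Rightarrow> real"
  assumes h: "bij h" and f: "\<And>n. 0 \<le> f n"
  shows "(\<lambda>i. f (h i)) summable_on UNIV \<longleftrightarrow> summable f"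
    and "summable f \<Longrightarrow> (\<Sum>\<^sub>\<infinity>i. f (h i)) = suminf f"
proof -
  show "(\<lambda>i. f (h i)) summable_on UNIV \<longleftrightarrow> summable f"
    using summable_on_reindex_bij_betw[OF h, of f] summable_on_UNIV_nonneg_real_iff[of f] f by simp
  assume "summable f"
  then have "(f has_sum suminf f) UNIV" by (intro sums_nonneg_imp_has_sum summable_sums f)
  then show "(\<Sum>\<^sub>\<infinity>i. f (h i)) = suminf f"
    using infsum_reindex_bij_betw[OF h, of f] by (simp add: infsumI)
qed

text \<open>\<open>h\<close> numbers the index type, by \<open>id\<close> or by
  \<open>neg_index\<close>, so that one argument serves both half-lines.\<close>

lemma l2seq_ell2:
  fixes u :: "('i, 'a::complex_inner) ell2"
  assumes h: "bij (h :: 'i \<Rightarrow> nat)"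
  shows "l2seq (\<lambda>n. ell2_nth u (inv h n))" "energy (\<lambda>n. ell2_nth u (inv h n)) = (norm u)\<^sup>2"
proof -
  let ?f = "\<lambda>n. (norm (ell2_nth u (inv h n)))\<^sup>2"
  have inv: "inv h (h i) = i" for i using h by (simp add: bij_is_inj)
  have "(\<lambda>i. ?f (h i)) summable_on UNIV" using ell2_summable[of u] by (simp add: inv)
  then have sm: "summable ?f" using infsum_nonneg_reindex_nat(1)[OF h, of ?f] by simp
  then show "l2seq (\<lambda>n. ell2_nth u (inv h n))" by (simp add: l2seq_def)
  show "energy (\<lambda>n. ell2_nth u (inv h n)) = (norm u)\<^sup>2"
    using infsum_nonneg_reindex_nat(2)[OF h _ sm] by (simp add: energy_def norm_ell2_sq inv)
qed

context decaying
begin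

lemma l2seq_observation:
  assumes T: "bounded_clinear T"
  shows "l2seq (\<lambda>n. T ((A ^^ n) x))"
    and "\<exists>M\<ge>0. \<forall>x. energy (\<lambda>n. T ((A ^^ n) x)) \<le> M * (norm x)\<^sup>2"
proof -
  obtain t where t: "0 < t" "\<And>x. norm (T x) \<le> t * norm x" using bounded_clinear_bound[OF T] by blast
  have le: "(norm (T ((A ^^ n) x)))\<^sup>2 \<le> ((t * D)\<^sup>2 * (norm x)\<^sup>2) * (r\<^sup>2) ^ n" for n x
  proof -
    have "norm (T ((A ^^ n) x)) \<le> t * (D * r ^ n * norm x)"
      using t decay[of n x] by (meson mult_left_mono less_imp_le order_trans)
    then have "(norm (T ((A ^^ n) x)))\<^sup>2 \<le> (t * (D * r ^ n * norm x))\<^sup>2" by (rule power_mono) simp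
    then show ?thesis by (simp add: power_mult_distrib power_mult[symmetric] mult_ac)
  qed
  have r2: "norm (r\<^sup>2) < 1" using r by (simp add: power_less_one_iff abs_square_less_1)
  then have sm: "summable (\<lambda>n. ((t * D)\<^sup>2 * (norm x)\<^sup>2) * (r\<^sup>2) ^ n)" for x :: 'x
    by (intro summable_mult summable_geometric)
  show l: "l2seq (\<lambda>n. T ((A ^^ n) x))" for x
    unfolding l2seq_def by (rule summable_comparison_test'[OF sm[of x]]) (use le in simp)
  have "energy (\<lambda>n. T ((A ^^ n) x)) \<le> ((t * D)\<^sup>2 / (1 - r\<^sup>2)) * (norm x)\<^sup>2" for x
  proof -
    have "energy (\<lambda>n. T ((A ^^ n) x)) \<le> (\<Sum>n. ((t * D)\<^sup>2 * (norm x)\<^sup>2) * (r\<^sup>2) ^ n)"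
      unfolding energy_def using l by (intro suminf_le le sm) (simp add: l2seq_def)
    also have "\<dots> = ((t * D)\<^sup>2 / (1 - r\<^sup>2)) * (norm x)\<^sup>2"
      using suminf_mult[OF summable_geometric[OF r2]] suminf_geometric[OF r2] by simp
    finally show ?thesis .
  qed
  moreover have "0 \<le> (t * D)\<^sup>2 / (1 - r\<^sup>2)" using r2 by simp
  ultimately show "\<exists>M\<ge>0. \<forall>x. energy (\<lambda>n. T ((A ^^ n) x)) \<le> M * (norm x)\<^sup>2" by blast
qed

text \<open>After renumbering, W is \<open>tail_state\<close> at 0 and bounded by decay. The open
  mapping theorem then yields inputs of norm at most K |x|, and K^2 is the energy constant.\<close>

lemma control_if_surj:
  fixes h :: "'i \<Rightarrow> nat" and W :: "('i, 'u) ell2 \<Rightarrow> 'x"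
  assumes h: "bij h" and W: "\<And>u. W u = (\<Sum>\<^sub>\<infinity>i. (A ^^ h i) (B (ell2_nth u i)))" and surj: "surj W"
  shows "\<exists>k\<ge>0. \<forall>x. \<exists>u. l2seq u \<and> tail_state A B u 0 = x \<and> energy u \<le> k * (norm x)\<^sup>2"
proof -
  obtain b where b: "0 < b" "\<And>j v. norm ((A ^^ j) (B v)) \<le> D * b * norm v * r ^ j" using gain by blast
  have inv: "inv h (h i) = i" for i using h by (simp add: bij_is_inj)
  define s where "s u n = ell2_nth u (inv h n)" for u :: "('i, 'u) ell2" and n
  have sb: "norm (s u n) \<le> norm u" for u n by (simp add: s_def norm_ell2_nth_le)
  have le: "norm ((A ^^ n) (B (s u n))) \<le> D * b * norm u * r ^ n" for u n
    by (rule order_trans[OF b(2)]) (use b D r sb in \<open>auto intro!: mult_right_mono mult_left_mono\<close>)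
  have sm: "summable (\<lambda>n. D * b * norm u * r ^ n)" for u :: "('i, 'u) ell2"
    using r by (intro summable_mult summable_geometric) auto
  have Wt: "W u = tail_state A B (s u) 0" for u
  proof -
    let ?f = "\<lambda>n. (A ^^ n) (B (s u n))"
    have n: "summable (\<lambda>n. norm (?f n))" by (rule summable_comparison_test'[OF sm[of u]]) (use le in simp)
    have "(?f has_sum suminf ?f) UNIV"
      by (rule norm_summable_imp_has_sum[OF n summable_sums[OF summable_norm_cancel[OF n]]])
    then have "infsum ?f UNIV = suminf ?f" by (rule infsumI)
    moreover have "W u = (\<Sum>\<^sub>\<infinity>i. ?f (h i))" unfolding W s_def inv ..
    moreover have "(\<Sum>\<^sub>\<infinity>i. ?f (h i)) = infsum ?f UNIV" by (rule infsum_reindex_bij_betw[OF h])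
    moreover have "tail_state A B (s u) 0 = suminf ?f" by (simp add: tail_state_def)
    ultimately show ?thesis by (simp only:)
  qed
  have "bounded_linear W"
  proof (rule bounded_linear_intro)
    show "W (u + v) = W u + W v" for u v
    proof -
      have "s (u + v) = (\<lambda>n. s u n + s v n)" by (simp add: s_def fun_eq_iff plus_ell2.rep_eq)
      then show ?thesis unfolding Wt by (simp only: tail_add_diff(1)[OF sb sb])
    qed
    show "W (a *\<^sub>R u) = a *\<^sub>R W u" for a u
    proof -
      have "s (a *\<^sub>R u) = (\<lambda>n. complex_of_real a *\<^sub>C s u n)"
        by (simp add: s_def fun_eq_iff scaleC_ell2.rep_eq scaleR_scaleC)
      then show ?thesis unfolding Wt by (simp only: tail_scaleC[OF sb] scaleR_scaleC)
    qed
    show "norm (W u) \<le> norm u * (D * b / (1 - r))" for u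
    proof -
      have "norm (W u) \<le> (\<Sum>n. D * b * norm u * r ^ n)"
        unfolding Wt tail_state_def using norm_suminf_le[OF le sm, of u] by simp
      also have "\<dots> = D * b * norm u * (1 / (1 - r))"
        using r by (subst suminf_mult[OF summable_geometric]) (auto simp: suminf_geometric)
      finally show ?thesis by (simp add: field_simps)
    qed
  qed
  from bounded_preimages_if_surj[OF this surj] obtain K where K: "K > 0"
    "\<And>x. \<exists>u. W u = x \<and> norm u \<le> K * norm x" by blast
  show ?thesis
  proof (intro exI[of _ "K\<^sup>2"] conjI allI)
    fix x
    obtain u where u: "W u = x" "norm u \<le> K * norm x" using K by blast
    have "(norm u)\<^sup>2 \<le> K\<^sup>2 * (norm x)\<^sup>2"
      using power_mono[OF u(2), of 2] by (simp add: power_mult_distrib)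
    moreover have "s u = (\<lambda>n. ell2_nth u (inv h n))" by (simp add: s_def fun_eq_iff)
    then have "l2seq (s u)" "energy (s u) = (norm u)\<^sup>2" using l2seq_ell2[OF h, of u] by (simp_all only:)
    moreover have "tail_state A B (s u) 0 = x" using u(1) Wt[of u] by (simp only:)
    ultimately show "\<exists>u. l2seq u \<and> tail_state A B u 0 = x \<and> energy u \<le> K\<^sup>2 * (norm x)\<^sup>2"
      by (intro exI[of _ "s u"]) simp
  qed simp
qed

text \<open>A surjective adjoint bounds W below: if f is a preimage of x with |f| \<le> K |x|, then
  |x|^2 = <W x, f> \<le> K |W x| |x|.\<close>

lemma observe_if_surj:
  fixes h :: "'i \<Rightarrow> nat" and W :: "'x \<Rightarrow> ('i, 'y::chilbert_space) ell2"
  assumes h: "bij h" and T: "bounded_clinear T" and W: "\<And>x. W x = Abs_ell2 (\<lambda>i. T ((A ^^ h i) x))"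
    and surj: "surj (cadjoint W)"
  shows "\<exists>c>0. \<forall>x. c * (norm x)\<^sup>2 \<le> energy (\<lambda>n. T ((A ^^ n) x))"
proof -
  \<comment> \<open>Square summability ensures that \<open>Abs_ell2\<close> returns the intended
    family.\<close>
  have "(\<lambda>i. (norm (T ((A ^^ h i) x)))\<^sup>2) summable_on UNIV" for x
    using infsum_nonneg_reindex_nat(1)[OF h, of "\<lambda>n. (norm (T ((A ^^ n) x)))\<^sup>2"]
      l2seq_observation(1)[OF T, of x] by (simp add: l2seq_def)
  then have nth: "ell2_nth (W x) i = T ((A ^^ h i) x)" for x i
    unfolding W by (subst Abs_ell2_inverse) auto
  have "h (inv h n) = n" for n using h by (simp add: bij_is_surj surj_f_inv_f)
  then have en: "(norm (W x))\<^sup>2 = energy (\<lambda>n. T ((A ^^ n) x))" for x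
    using l2seq_ell2(2)[OF h, of "W x"] by (simp add: nth)
  obtain M where M: "0 \<le> M" "\<And>x. energy (\<lambda>n. T ((A ^^ n) x)) \<le> M * (norm x)\<^sup>2"
    using l2seq_observation(2)[OF T] by blast
  have bW: "bounded_clinear W"
  proof (rule bounded_clinearI)
    note lin = bounded_clinearD[OF T] bounded_clinearD[OF bounded_clinear_power[OF A]]
    show "W (x + y) = W x + W y" for x y
      by (simp add: fun_eq_iff nth plus_ell2.rep_eq lin flip: ell2_nth_inject)
    show "W (a *\<^sub>C x) = a *\<^sub>C W x" for a x
      by (simp add: fun_eq_iff nth scaleC_ell2.rep_eq lin flip: ell2_nth_inject)
    show "norm (W x) \<le> sqrt M * norm x" for x
    proof (rule power2_le_imp_le)
      show "(norm (W x))\<^sup>2 \<le> (sqrt M * norm x)\<^sup>2"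
        unfolding en using M by (simp add: power_mult_distrib)
    qed (use M in simp)
  qed
  from bounded_preimages_if_surj[OF bounded_clinear_linear[OF bounded_clinear_cadjoint[OF bW]] surj]
  obtain K where K: "K > 0" "\<And>x. \<exists>f. cadjoint W f = x \<and> norm f \<le> K * norm x" by blast
  have "(1 / K\<^sup>2) * (norm x)\<^sup>2 \<le> (norm (W x))\<^sup>2" for x
  proof -
    obtain f where f: "cadjoint W f = x" "norm f \<le> K * norm x" using K by blast
    have "(norm x)\<^sup>2 = inner (W x) f" by (simp add: inner_cadjoint[OF bW] f power2_norm_eq_inner)
    also have "\<dots> \<le> norm (W x) * norm f" by (rule norm_cauchy_schwarz)
    also have "\<dots> \<le> norm (W x) * (K * norm x)" using f by (intro mult_left_mono) auto
    finally have "norm x \<le> K * norm (W x)" using K(1)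
      by (cases "x = 0") (auto simp: power2_eq_square mult_ac)
    from power_mono[OF this, of 2] show ?thesis using K(1) by (simp add: power_mult_distrib field_simps)
  qed
  then show ?thesis using K(1) unfolding en by (intro exI[of _ "1 / K\<^sup>2"]) auto
qed

text \<open>An impulse at time 0 reaches every state in the range of \<open>B'\<close> at once; this
  is how the extended system of the strict case is controlled.\<close>

lemma control_of_single:
  fixes B' :: "'v::real_normed_vector \<Rightarrow> 'x" and v0 :: 'v
  assumes "B' 0 = 0"
  shows "l2seq (\<lambda>n. if n = 0 then v0 else 0)" "energy (\<lambda>n. if n = 0 then v0 else 0) = (norm v0)\<^sup>2"
    "tail_state A B' (\<lambda>n. if n = 0 then v0 else 0) 0 = B' v0"
proof -
  have A0: "(A ^^ j) 0 = 0" for j by (rule bounded_clinear_zero[OF bounded_clinear_power[OF A]])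
  have sg: "(\<lambda>n::nat. (norm (if n = 0 then v0 else 0))\<^sup>2) sums (norm v0)\<^sup>2"
    using sums_finite[of "{0::nat}" "\<lambda>n. (norm (if n = 0 then v0 else 0))\<^sup>2"] by simp
  then show "l2seq (\<lambda>n. if n = 0 then v0 else 0)" "energy (\<lambda>n. if n = 0 then v0 else 0) = (norm v0)\<^sup>2"
    by (auto simp: l2seq_def energy_def sums_iff)
  have "(\<lambda>j. (A ^^ j) (B' (if j = 0 then v0 else 0))) sums B' v0"
    using sums_finite[of "{0::nat}" "\<lambda>j. (A ^^ j) (B' (if j = 0 then v0 else 0))"] by (simp add: assms A0)
  then show "tail_state A B' (\<lambda>n. if n = 0 then v0 else 0) 0 = B' v0"
    by (simp add: tail_state_def sums_iff)
qed

end

definition neg_index :: "neg_int \<Rightarrow> nat" where "neg_index j = nat (- int_of_neg j - 1)"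

lemma bij_neg_index: "bij neg_index"
proof (rule o_bij[of "\<lambda>n. neg_of_int (- 1 - int n)"])
  have neg: "int_of_neg j < 0" for j using int_of_neg[of j] by simp
  have "neg_of_int (- 1 - int (neg_index j)) = j" for j
    using neg[of j] by (simp add: neg_index_def int_of_neg_inverse)
  then show "(\<lambda>n. neg_of_int (- 1 - int n)) \<circ> neg_index = id" by auto
  have "neg_index (neg_of_int (- 1 - int n)) = n" for n
    by (simp add: neg_index_def neg_of_int_inverse)
  then show "neg_index \<circ> (\<lambda>n. neg_of_int (- 1 - int n)) = id" by auto
qed

section \<open>The operator inequality as a scalar dissipation inequality\<close>

section \<open>The bicausal KYP-inequality\<close>

lemma diag_id_props:
  fixes H :: "'a::chilbert_space \<Rightarrow> 'a"
  assumes H: "bounded_clinear H" "\<And>x y. inner (H x) y = inner x (H y)"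
  shows "bounded_clinear (diag_id H :: 'a \<times> 'b::chilbert_space \<Rightarrow> 'a \<times> 'b)"
    and "inner (diag_id H p) q = inner p (diag_id H (q :: 'a \<times> 'b))"
    and "inner (diag_id H p) p = inner (H (fst p)) (fst p) + (norm (snd p))\<^sup>2"
proof -
  have "diag_id H = (\<lambda>p :: 'a \<times> 'b. (H (fst p), snd p))" by (auto simp: diag_id_def)
  then show "bounded_clinear (diag_id H :: 'a \<times> 'b \<Rightarrow> 'a \<times> 'b)"
    by (simp only:) (intro bounded_clinear_Pair bounded_clinear_compose[OF H(1)] bounded_clinear_intros)
  show "inner (diag_id H p) q = inner p (diag_id H (q :: 'a \<times> 'b))"
    by (simp add: diag_id_def inner_prod_def H(2) split: prod.splits)
  show "inner (diag_id H p) p = inner (H (fst p)) (fst p) + (norm (snd p))\<^sup>2"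
    by (simp add: diag_id_def inner_prod_def power2_norm_eq_inner split: prod.splits)
qed

lemma admissible_H_sym:
  assumes "admissible_H H"
  shows "bounded_clinear H" "inner (H x) y = inner x (H y)"
  using assms inner_cadjoint[of H x y] by (auto simp: admissible_H_def selfadjoint_def)

text \<open>The adjoints disappear into the quadratic forms at L w and R w. The cases e = 0 and e =
  \<epsilon>^2 give the plain and the strict inequality.\<close>

lemma congruence_le_iff:
  fixes L :: "'w::chilbert_space \<Rightarrow> 'a::chilbert_space \<times> 'y::chilbert_space"
    and R :: "'w \<Rightarrow> 'a \<times> 'u::chilbert_space" and e :: real
  assumes L: "bounded_clinear L" and R: "bounded_clinear R"
    and H: "bounded_clinear H" "\<And>x y. inner (H x) y = inner x (H y)"
  shows "((\<lambda>w. (cadjoint L \<circ> diag_id H \<circ> L) w + e *\<^sub>R (cadjoint R \<circ> R) w) \<preceq> cadjoint R \<circ> diag_id H \<circ> R) \<longleftrightarrow>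
    (\<forall>w. inner (H (fst (L w))) (fst (L w)) + (norm (snd (L w)))\<^sup>2 + e * (norm (R w))\<^sup>2
      \<le> inner (H (fst (R w))) (fst (R w)) + (norm (snd (R w)))\<^sup>2)"
proof -
  note diag = diag_id_props(1,2)[OF H]
  have id: "bounded_clinear (\<lambda>x. x)" "inner ((\<lambda>x. x) x) y = inner x ((\<lambda>x. x) y)" for x y :: "'a \<times> 'u"
    by (simp_all add: bounded_clinear_id)
  define TL TR TI where "TL = cadjoint L \<circ> diag_id H \<circ> L" and "TR = cadjoint R \<circ> diag_id H \<circ> R"
    and "TI = cadjoint R \<circ> R"
  have TI: "TI = cadjoint R \<circ> (\<lambda>x. x) \<circ> R" by (auto simp: TI_def)
  note l = congruence_props[OF L diag, folded TL_def] and r = congruence_props[OF R diag, folded TR_def]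
    and i = congruence_props[OF R id, folded TI]
  have b: "bounded_clinear (\<lambda>w. TR w - (TL w + e *\<^sub>R TI w))"
    by (intro bounded_clinear_intros l r i)
  have s: "inner (TR x - (TL x + e *\<^sub>R TI x)) y = inner x (TR y - (TL y + e *\<^sub>R TI y))" for x y
    using l(3)[of x y] r(3)[of x y] i(3)[of x y] by (simp add: inner_simps)
  have "inner (TR w - (TL w + e *\<^sub>R TI w)) w = (inner (H (fst (R w))) (fst (R w)) + (norm (snd (R w)))\<^sup>2)
    - ((inner (H (fst (L w))) (fst (L w)) + (norm (snd (L w)))\<^sup>2) + e * (norm (R w))\<^sup>2)" for w
    by (simp only: inner_diff_left inner_add_left inner_scaleR_left l(2) r(2) i(2) diag_id_props(3)[OF H] power2_norm_eq_inner)
  then show ?thesis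
    unfolding op_le_def TL_def[symmetric] TR_def[symmetric] TI_def[symmetric] pos_semidef_iff[OF b s] by simp
qed

locale stable_bicausal =
  minus: decaying "A_minus \<Sigma>" "B_minus \<Sigma>" D r + plus: decaying "A_plus \<Sigma>" "B_plus \<Sigma>" D r
  for \<Sigma> :: "('xm::chilbert_space, 'xp::chilbert_space, 'u::chilbert_space, 'y::chilbert_space) bicausal"
    and D r :: real +
  fixes K :: real
  assumes outputs: "bounded_clinear (C_minus \<Sigma>)" "bounded_clinear (C_plus \<Sigma>)" "bounded_clinear (D_op \<Sigma>)"
    and K_pos: "0 < K"
    and bij_minus: "\<And>w. cmod w \<le> 1 \<Longrightarrow> bij (\<lambda>x. x - w *\<^sub>C A_minus \<Sigma> x)"
    and le_minus: "\<And>w x. cmod w \<le> 1 \<Longrightarrow> norm x \<le> K * norm (x - w *\<^sub>C A_minus \<Sigma> x)"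
    and bij_plus: "\<And>w. cmod w \<le> 1 \<Longrightarrow> bij (\<lambda>x. x - w *\<^sub>C A_plus \<Sigma> x)"
    and le_plus: "\<And>w x. cmod w \<le> 1 \<Longrightarrow> norm x \<le> K * norm (x - w *\<^sub>C A_plus \<Sigma> x)"

lemma stable_bicausal_exists:
  assumes sys: "bicausal_system \<Sigma>" and stp: "exp_stable (A_plus \<Sigma>)" and stm: "exp_stable (A_minus \<Sigma>)"
  shows "\<exists>D r K. stable_bicausal \<Sigma> D r K"
proof -
  note ops = sys[unfolded bicausal_system_def]
  have Am: "bounded_clinear (A_minus \<Sigma>)" and Ap: "bounded_clinear (A_plus \<Sigma>)" using ops by auto
  obtain D1 r1 where 1: "0 \<le> D1" "0 < r1" "r1 < 1" "\<And>n x. norm ((A_minus \<Sigma> ^^ n) x) \<le> D1 * r1 ^ n * norm x"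
    using exp_stable_power_decay[OF Am stm] by blast
  obtain D2 r2 where 2: "0 \<le> D2" "0 < r2" "r2 < 1" "\<And>n x. norm ((A_plus \<Sigma> ^^ n) x) \<le> D2 * r2 ^ n * norm x"
    using exp_stable_power_decay[OF Ap stp] by blast
  have le1: "D1 * r1 ^ n * t \<le> max D1 D2 * max r1 r2 ^ n * t" if "0 \<le> t" for n t
    using 1 2 that by (intro mult_right_mono mult_mono power_mono) auto
  have le2: "D2 * r2 ^ n * t \<le> max D1 D2 * max r1 r2 ^ n * t" if "0 \<le> t" for n t
    using 1 2 that by (intro mult_right_mono mult_mono power_mono) auto
  obtain Km where Km: "0 < Km" "\<And>w. cmod w \<le> 1 \<Longrightarrow> bij (\<lambda>x. x - w *\<^sub>C A_minus \<Sigma> x)"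
    "\<And>w x. cmod w \<le> 1 \<Longrightarrow> norm x \<le> Km * norm (x - w *\<^sub>C A_minus \<Sigma> x)"
    using exp_stable_resolvent[OF Am stm] by blast
  obtain Kp where Kp: "0 < Kp" "\<And>w. cmod w \<le> 1 \<Longrightarrow> bij (\<lambda>x. x - w *\<^sub>C A_plus \<Sigma> x)"
    "\<And>w x. cmod w \<le> 1 \<Longrightarrow> norm x \<le> Kp * norm (x - w *\<^sub>C A_plus \<Sigma> x)"
    using exp_stable_resolvent[OF Ap stp] by blast
  have mx: "Km * t \<le> max Km Kp * t" "Kp * t \<le> max Km Kp * t" if "0 \<le> t" for t
    using that by (auto intro: mult_right_mono)
  have "stable_bicausal \<Sigma> (max D1 D2) (max r1 r2) (max Km Kp)"
  proof unfold_locales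
    show "norm ((A_minus \<Sigma> ^^ n) x) \<le> max D1 D2 * max r1 r2 ^ n * norm x" for n x
      by (rule order_trans[OF 1(4) le1[OF norm_ge_zero]])
    show "norm ((A_plus \<Sigma> ^^ n) x) \<le> max D1 D2 * max r1 r2 ^ n * norm x" for n x
      by (rule order_trans[OF 2(4) le2[OF norm_ge_zero]])
    show "norm x \<le> max Km Kp * norm (x - w *\<^sub>C A_minus \<Sigma> x)" if "cmod w \<le> 1" for w x
      by (rule order_trans[OF Km(3)[OF that] mx(1)[OF norm_ge_zero]])
    show "norm x \<le> max Km Kp * norm (x - w *\<^sub>C A_plus \<Sigma> x)" if "cmod w \<le> 1" for w x
      by (rule order_trans[OF Kp(3)[OF that] mx(2)[OF norm_ge_zero]])
  qed (use ops 1(1-3) 2(1-3) Km(1,2) Kp(1,2) in \<open>auto simp: less_max_iff_disj le_max_iff_disj\<close>)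
  then show ?thesis by blast
qed

context stable_bicausal
begin

lemmas ops = minus.A minus.B outputs(1) plus.A plus.B outputs(2,3)

lemmas op_intros = ops[THEN bounded_clinear_compose] bounded_clinear_intros

lemma bounded_clinear_L_op: "bounded_clinear (L_op \<Sigma>)"
proof -
  have "L_op \<Sigma> = (\<lambda>w. ((fst (fst w), A_plus \<Sigma> (snd (fst w)) + B_plus \<Sigma> (snd w)),
     C_minus \<Sigma> (A_minus \<Sigma> (fst (fst w))) + C_plus \<Sigma> (snd (fst w)) + (C_minus \<Sigma> (B_minus \<Sigma> (snd w)) + D_op \<Sigma> (snd w))))"
    by (auto simp: L_op_def)
  then show ?thesis by (simp only:) (intro op_intros)
qed

lemma bounded_clinear_R_op: "bounded_clinear (R_op \<Sigma>)"
proof -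
  have "R_op \<Sigma> = (\<lambda>w. ((A_minus \<Sigma> (fst (fst w)) + B_minus \<Sigma> (snd w), snd (fst w)), snd w))"
    by (auto simp: R_op_def)
  then show ?thesis by (simp only:) (intro op_intros)
qed

definition dissipative :: "('xm \<times> 'xp \<Rightarrow> 'xm \<times> 'xp) \<Rightarrow> real \<Rightarrow> bool"
  where "dissipative H e \<longleftrightarrow> (\<forall>xm xp u.
    inner (H (xm, A_plus \<Sigma> xp + B_plus \<Sigma> u)) (xm, A_plus \<Sigma> xp + B_plus \<Sigma> u)
      + (norm (C_minus \<Sigma> (A_minus \<Sigma> xm) + C_plus \<Sigma> xp + (C_minus \<Sigma> (B_minus \<Sigma> u) + D_op \<Sigma> u)))\<^sup>2
      + e * ((norm (A_minus \<Sigma> xm + B_minus \<Sigma> u))\<^sup>2 + (norm xp)\<^sup>2 + (norm u)\<^sup>2)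
    \<le> inner (H (A_minus \<Sigma> xm + B_minus \<Sigma> u, xp)) (A_minus \<Sigma> xm + B_minus \<Sigma> u, xp) + (norm u)\<^sup>2)"

lemma KYP_iff:
  assumes "admissible_H H"
  shows "bicausal_KYP \<Sigma> H \<longleftrightarrow> dissipative H 0"
    "strict_bicausal_KYP \<Sigma> H \<longleftrightarrow> (\<exists>\<epsilon>>0. dissipative H (\<epsilon>\<^sup>2))"
proof -
  have nR: "(norm (R_op \<Sigma> ((xm, xp), u)))\<^sup>2 = (norm (A_minus \<Sigma> xm + B_minus \<Sigma> u))\<^sup>2 + (norm xp)\<^sup>2 + (norm u)\<^sup>2"
    for xm xp u by (simp add: R_op_def norm_prod_def)
  have *: "((\<lambda>w. (cadjoint (L_op \<Sigma>) \<circ> diag_id H \<circ> L_op \<Sigma>) w + e *\<^sub>R (cadjoint (R_op \<Sigma>) \<circ> R_op \<Sigma>) w)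
      \<preceq> cadjoint (R_op \<Sigma>) \<circ> diag_id H \<circ> R_op \<Sigma>) \<longleftrightarrow> dissipative H e" for e
    unfolding congruence_le_iff[OF bounded_clinear_L_op bounded_clinear_R_op admissible_H_sym[OF assms]]
      dissipative_def split_paired_All nR by (simp add: L_op_def R_op_def)
  from *[of 0] show "bicausal_KYP \<Sigma> H \<longleftrightarrow> dissipative H 0" by (simp add: bicausal_KYP_def o_def)
  show "strict_bicausal_KYP \<Sigma> H \<longleftrightarrow> (\<exists>\<epsilon>>0. dissipative H (\<epsilon>\<^sup>2))"
    unfolding strict_bicausal_KYP_def * ..
qed

section \<open>Steady states and the transfer function on the circle\<close>

lemma minus_response:
  assumes z: "cmod z = 1"
  shows "bounded_clinear (inv (\<lambda>x. x - inverse z *\<^sub>C A_minus \<Sigma> x))"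
    and "\<exists>\<eta>. inv (\<lambda>x. x - inverse z *\<^sub>C A_minus \<Sigma> x) v = \<eta> \<and>
      \<eta> = inverse z *\<^sub>C A_minus \<Sigma> \<eta> + v \<and> norm \<eta> \<le> K * norm v"
proof -
  have z1: "cmod (inverse z) \<le> 1" using z by (simp add: norm_inverse)
  show "bounded_clinear (inv (\<lambda>x. x - inverse z *\<^sub>C A_minus \<Sigma> x))"
    by (rule bounded_clinear_inv[OF _ bij_minus[OF z1] le_minus[OF z1]]) (intro op_intros)
  define \<eta> where "\<eta> = inv (\<lambda>x. x - inverse z *\<^sub>C A_minus \<Sigma> x) v"
  have eq: "\<eta> - inverse z *\<^sub>C A_minus \<Sigma> \<eta> = v"
    using surj_f_inv_f[OF bij_is_surj[OF bij_minus[OF z1]], of v] by (simp add: \<eta>_def)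
  have "\<eta> = inverse z *\<^sub>C A_minus \<Sigma> \<eta> + v" unfolding eq[symmetric] by simp
  moreover have "norm \<eta> \<le> K * norm v" using le_minus[OF z1, of \<eta>] unfolding eq .
  ultimately show "\<exists>\<eta>. inv (\<lambda>x. x - inverse z *\<^sub>C A_minus \<Sigma> x) v = \<eta> \<and>
      \<eta> = inverse z *\<^sub>C A_minus \<Sigma> \<eta> + v \<and> norm \<eta> \<le> K * norm v"
    unfolding \<eta>_def by blast
qed

text \<open>The factor z in front of the causal term of the transfer function is moved into \<xi>,
  so that z^{-n} \<xi> solves the forward recursion forced by z^{-n} v.\<close>

lemma plus_response:
  assumes z: "cmod z = 1"
  shows "bounded_clinear (inv (\<lambda>x. x - z *\<^sub>C A_plus \<Sigma> x))"
    and "\<exists>\<xi>. z *\<^sub>C inv (\<lambda>x. x - z *\<^sub>C A_plus \<Sigma> x) v = \<xi> \<and>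
      inverse z *\<^sub>C \<xi> = A_plus \<Sigma> \<xi> + v \<and> norm \<xi> \<le> K * norm v"
proof -
  have z1: "cmod z \<le> 1" and z0: "z \<noteq> 0" using z by auto
  show "bounded_clinear (inv (\<lambda>x. x - z *\<^sub>C A_plus \<Sigma> x))"
    by (rule bounded_clinear_inv[OF _ bij_plus[OF z1] le_plus[OF z1]]) (intro op_intros)
  define \<zeta> where "\<zeta> = inv (\<lambda>x. x - z *\<^sub>C A_plus \<Sigma> x) v"
  have eq: "\<zeta> - z *\<^sub>C A_plus \<Sigma> \<zeta> = v"
    using surj_f_inv_f[OF bij_is_surj[OF bij_plus[OF z1]], of v] by (simp add: \<zeta>_def)
  have "norm (z *\<^sub>C \<zeta>) \<le> K * norm v" using le_plus[OF z1, of \<zeta>] unfolding eq using z by (simp add: norm_scaleC)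
  moreover have "inverse z *\<^sub>C z *\<^sub>C \<zeta> = A_plus \<Sigma> (z *\<^sub>C \<zeta>) + v"
    using eq z0 by (simp add: scaleC_scaleC scaleC_one bounded_clinear_scaleC[OF ops(4)] algebra_simps)
  ultimately show "\<exists>\<xi>. z *\<^sub>C inv (\<lambda>x. x - z *\<^sub>C A_plus \<Sigma> x) v = \<xi> \<and>
      inverse z *\<^sub>C \<xi> = A_plus \<Sigma> \<xi> + v \<and> norm \<xi> \<le> K * norm v"
    using \<zeta>_def by (intro exI[of _ "z *\<^sub>C \<zeta>"]) auto
qed

lemma frequency_response:
  assumes z: "cmod z = 1"
  shows "\<exists>\<eta> \<xi>. \<eta> = inverse z *\<^sub>C A_minus \<Sigma> \<eta> + B_minus \<Sigma> u \<and> inverse z *\<^sub>C \<xi> = A_plus \<Sigma> \<xi> + B_plus \<Sigma> u \<and>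
    norm \<eta> \<le> K * norm (B_minus \<Sigma> u) \<and> norm \<xi> \<le> K * norm (B_plus \<Sigma> u) \<and>
    transfer_fun \<Sigma> z u = C_minus \<Sigma> \<eta> + C_plus \<Sigma> \<xi> + D_op \<Sigma> u"
  using minus_response(2)[OF z, of "B_minus \<Sigma> u"] plus_response(2)[OF z, of "B_plus \<Sigma> u"]
  by (auto simp: transfer_fun_def bounded_clinear_scaleC[OF ops(6), symmetric] intro!: exI)

lemma bounded_clinear_transfer_fun:
  assumes z: "cmod z = 1"
  shows "bounded_clinear (transfer_fun \<Sigma> z)"
  unfolding transfer_fun_def[abs_def]
  by (intro op_intros minus_response(1)[OF z, THEN bounded_clinear_compose]
      plus_response(1)[OF z, THEN bounded_clinear_compose])

text \<open>Uniformity in z bounds the set of operator norms above, so that each of them lies below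
  the real supremum.\<close>

lemma transfer_fun_bound: "\<exists>M. \<forall>z u. cmod z = 1 \<longrightarrow> norm (transfer_fun \<Sigma> z u) \<le> M * norm u"
proof -
  obtain bm where bm: "0 < bm" "\<And>x. norm (B_minus \<Sigma> x) \<le> bm * norm x" using bounded_clinear_bound[OF ops(2)] by blast
  obtain cm where cm: "0 < cm" "\<And>x. norm (C_minus \<Sigma> x) \<le> cm * norm x" using bounded_clinear_bound[OF ops(3)] by blast
  obtain bp where bp: "0 < bp" "\<And>x. norm (B_plus \<Sigma> x) \<le> bp * norm x" using bounded_clinear_bound[OF ops(5)] by blast
  obtain cp where cp: "0 < cp" "\<And>x. norm (C_plus \<Sigma> x) \<le> cp * norm x" using bounded_clinear_bound[OF ops(6)] by blast
  obtain d where d: "0 < d" "\<And>x. norm (D_op \<Sigma> x) \<le> d * norm x" using bounded_clinear_bound[OF ops(7)] by blast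
  have "norm (transfer_fun \<Sigma> z u) \<le> (cm * (K * bm) + cp * (K * bp) + d) * norm u" if z: "cmod z = 1" for z u
  proof -
    obtain \<eta> \<xi> where n: "norm \<eta> \<le> K * norm (B_minus \<Sigma> u)" "norm \<xi> \<le> K * norm (B_plus \<Sigma> u)"
      and F: "transfer_fun \<Sigma> z u = C_minus \<Sigma> \<eta> + C_plus \<Sigma> \<xi> + D_op \<Sigma> u" using frequency_response[OF z] by blast
    have "norm (C_minus \<Sigma> \<eta>) \<le> cm * (K * (bm * norm u))"
      by (rule order_trans[OF cm(2)], intro mult_left_mono order_trans[OF n(1)] bm(2)) (use cm K_pos in auto)
    moreover have "norm (C_plus \<Sigma> \<xi>) \<le> cp * (K * (bp * norm u))"
      by (rule order_trans[OF cp(2)], intro mult_left_mono order_trans[OF n(2)] bp(2)) (use cp K_pos in auto)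
    moreover have "norm (transfer_fun \<Sigma> z u) \<le> norm (C_minus \<Sigma> \<eta>) + norm (C_plus \<Sigma> \<xi>) + norm (D_op \<Sigma> u)"
      unfolding F by (meson norm_triangle_ineq norm_triangle_le add_right_mono order_trans)
    ultimately show ?thesis using d(2)[of u] by (simp add: algebra_simps)
  qed
  then show ?thesis by blast
qed

lemma transfer_fun_le_sup:
  assumes z: "cmod z = 1"
  shows "norm (transfer_fun \<Sigma> z u) \<le> sup_norm_circle (transfer_fun \<Sigma>) * norm u"
proof -
  obtain M where M: "\<And>z u. cmod z = 1 \<Longrightarrow> norm (transfer_fun \<Sigma> z u) \<le> M * norm u" using transfer_fun_bound by blast
  have "onorm (transfer_fun \<Sigma> z) \<le> sup_norm_circle (transfer_fun \<Sigma>)"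
    unfolding sup_norm_circle_def
  proof (rule cSUP_upper)
    show "z \<in> sphere 0 1" using z by simp
    show "bdd_above ((\<lambda>z. onorm (transfer_fun \<Sigma> z)) ` sphere 0 1)"
    proof (rule bdd_aboveI2)
      fix w :: complex assume "w \<in> sphere 0 1"
      then have "norm (transfer_fun \<Sigma> w u) \<le> max M 0 * norm u" for u
        using M[of w u] mult_right_mono[of M "max M 0" "norm u"] by (auto intro: order_trans)
      then show "onorm (transfer_fun \<Sigma> w) \<le> max M 0" by (intro onorm_bound) auto
    qed
  qed
  then have "onorm (transfer_fun \<Sigma> z) * norm u \<le> sup_norm_circle (transfer_fun \<Sigma>) * norm u"
    by (rule mult_right_mono) simp
  with onorm[OF bounded_clinear_linear[OF bounded_clinear_transfer_fun[OF z]], of u] show ?thesis by linarith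
qed

text \<open>Of the e-term only e |u|^2 is kept, which gives |F(z) u|^2 \<le> (1 - e) |u|^2.
  \<open>max 0\<close> keeps the bound nonnegative for e > 1.\<close>

lemma sup_norm_le_if_dissipative:
  assumes H: "admissible_H H" and d: "dissipative H e" and e: "0 \<le> e"
  shows "sup_norm_circle (transfer_fun \<Sigma>) \<le> sqrt (max 0 (1 - e))"
  unfolding sup_norm_circle_def
proof (rule cSUP_least)
  fix z :: complex assume "z \<in> sphere 0 1"
  then have z: "cmod z = 1" and zi: "cmod (inverse z) = 1" by (auto simp: norm_inverse)
  show "onorm (transfer_fun \<Sigma> z) \<le> sqrt (max 0 (1 - e))"
  proof (rule onorm_bound)
    fix u
    obtain \<eta> \<xi> where eq: "\<eta> = inverse z *\<^sub>C A_minus \<Sigma> \<eta> + B_minus \<Sigma> u" "inverse z *\<^sub>C \<xi> = A_plus \<Sigma> \<xi> + B_plus \<Sigma> u"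
      and F: "transfer_fun \<Sigma> z u = C_minus \<Sigma> \<eta> + C_plus \<Sigma> \<xi> + D_op \<Sigma> u" using frequency_response[OF z] by blast
    let ?w = "inverse z"
    \<comment> \<open>The first variable of the inequality is the anticausal state one step ahead,
      hence z^{-1} \<eta>.\<close>
    have Am: "A_minus \<Sigma> (?w *\<^sub>C \<eta>) + B_minus \<Sigma> u = \<eta>"
      using eq(1) by (simp add: bounded_clinear_scaleC[OF ops(1)])
    have "C_minus \<Sigma> (A_minus \<Sigma> (?w *\<^sub>C \<eta>)) + C_minus \<Sigma> (B_minus \<Sigma> u) = C_minus \<Sigma> \<eta>"
      using bounded_clinear_add[OF ops(3), of "A_minus \<Sigma> (?w *\<^sub>C \<eta>)" "B_minus \<Sigma> u"] Am by simp
    then have out: "C_minus \<Sigma> (A_minus \<Sigma> (?w *\<^sub>C \<eta>)) + C_plus \<Sigma> \<xi> + (C_minus \<Sigma> (B_minus \<Sigma> u) + D_op \<Sigma> u) = transfer_fun \<Sigma> z u"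
      unfolding F by (simp add: algebra_simps)
    have "(?w *\<^sub>C \<eta>, ?w *\<^sub>C \<xi>) = ?w *\<^sub>C (\<eta>, \<xi>)" by (simp add: scaleC_Pair)
    moreover have "inner (H (?w *\<^sub>C p)) (?w *\<^sub>C p) = inner (H p) p" for p
    proof -
      have "inner (H (?w *\<^sub>C p)) (?w *\<^sub>C p) = inner (H p) ((cnj ?w * ?w) *\<^sub>C p)"
        by (simp add: bounded_clinear_scaleC[OF admissible_H_sym(1)[OF H]] inner_scaleC_left scaleC_scaleC)
      also have "cnj ?w * ?w = 1" using zi by (metis complex_norm_square mult.commute of_real_1 one_power2)
      finally show ?thesis by (simp add: scaleC_one)
    qed
    ultimately have same: "inner (H (?w *\<^sub>C \<eta>, ?w *\<^sub>C \<xi>)) (?w *\<^sub>C \<eta>, ?w *\<^sub>C \<xi>) = inner (H (\<eta>, \<xi>)) (\<eta>, \<xi>)" by simp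
    have "(norm (transfer_fun \<Sigma> z u))\<^sup>2 + e * ((norm \<eta>)\<^sup>2 + (norm \<xi>)\<^sup>2 + (norm u)\<^sup>2) \<le> (norm u)\<^sup>2"
      using d[unfolded dissipative_def, rule_format, of "?w *\<^sub>C \<eta>" \<xi> u]
      unfolding out eq(2)[symmetric] Am same by simp
    moreover have "e * (norm u)\<^sup>2 \<le> e * ((norm \<eta>)\<^sup>2 + (norm \<xi>)\<^sup>2 + (norm u)\<^sup>2)"
      using e by (intro mult_left_mono) auto
    ultimately have "(norm (transfer_fun \<Sigma> z u))\<^sup>2 \<le> (1 - e) * (norm u)\<^sup>2" by (simp add: left_diff_distrib)
    also have "\<dots> \<le> max 0 (1 - e) * (norm u)\<^sup>2" by (intro mult_right_mono) auto
    also have "\<dots> = (sqrt (max 0 (1 - e)) * norm u)\<^sup>2" by (simp add: power_mult_distrib)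
    finally show "norm (transfer_fun \<Sigma> z u) \<le> sqrt (max 0 (1 - e)) * norm u"
      by (rule power2_le_imp_le) simp
  qed simp
qed (simp add: sphere_eq_empty)

end

section \<open>Existence of solutions in the plain and the strict case\<close>

section \<open>Construction of solutions\<close>

context stable_bicausal
begin

lemma solution_if_sup_norm_le_1:
  assumes min: "l2_exactly_minimal \<Sigma>" and F: "sup_norm_circle (transfer_fun \<Sigma>) \<le> 1"
  shows "\<exists>H. admissible_H H \<and> dissipative H 0"
proof -
  have Wcp: "Wc_plus \<Sigma> u = (\<Sum>\<^sub>\<infinity>i. (A_plus \<Sigma> ^^ neg_index i) (B_plus \<Sigma> (ell2_nth u i)))" for u
    by (simp add: Wc_plus_def neg_index_def)
  have Wcm: "Wc_minus \<Sigma> u = (\<Sum>\<^sub>\<infinity>i. (A_minus \<Sigma> ^^ id i) (B_minus \<Sigma> (ell2_nth u i)))" for u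
    by (simp add: Wc_minus_def)
  have Wop: "Wo_plus \<Sigma> x = Abs_ell2 (\<lambda>i. C_plus \<Sigma> ((A_plus \<Sigma> ^^ id i) x))" for x
    by (simp add: Wo_plus_def)
  \<comment> \<open>The family in \<open>Wo_minus\<close> starts with the first power of the state
    operator; renumbered from 0, that extra factor goes into the output map
    \<open>E\<close>.\<close>
  have Wom: "Wo_minus \<Sigma> x = Abs_ell2 (\<lambda>i. C_minus \<Sigma> (A_minus \<Sigma> ((A_minus \<Sigma> ^^ neg_index i) x)))" for x
  proof -
    have "nat (- int_of_neg i) = Suc (neg_index i)" for i using int_of_neg[of i] by (simp add: neg_index_def)
    then show ?thesis by (simp add: Wo_minus_def)
  qed
  define E where "E x = C_minus \<Sigma> (A_minus \<Sigma> x)" for x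
  define G where "G u = C_minus \<Sigma> (B_minus \<Sigma> u) + D_op \<Sigma> u" for u
  have E: "bounded_clinear E" unfolding E_def[abs_def] by (intro op_intros)
  have G: "bounded_clinear G" unfolding G_def[abs_def] by (intro op_intros)
  from min have surj: "surj (Wc_plus \<Sigma>)" "surj (Wc_minus \<Sigma>)" "surj (cadjoint (Wo_plus \<Sigma>))" "surj (cadjoint (Wo_minus \<Sigma>))"
    by (auto simp: l2_exactly_minimal_def)
  obtain kp where kp: "0 \<le> kp" "\<And>x. \<exists>u. l2seq u \<and> tail_state (A_plus \<Sigma>) (B_plus \<Sigma>) u 0 = x \<and> energy u \<le> kp * (norm x)\<^sup>2"
    using plus.control_if_surj[OF bij_neg_index Wcp surj(1)] by blast
  obtain km where km: "0 \<le> km" "\<And>x. \<exists>u. l2seq u \<and> tail_state (A_minus \<Sigma>) (B_minus \<Sigma>) u 0 = x \<and> energy u \<le> km * (norm x)\<^sup>2"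
    using minus.control_if_surj[OF bij_id Wcm surj(2)] by blast
  obtain cp where cp: "0 < cp" "\<And>x. cp * (norm x)\<^sup>2 \<le> energy (\<lambda>n. C_plus \<Sigma> ((A_plus \<Sigma> ^^ n) x))"
    using plus.observe_if_surj[OF bij_id outputs(2) Wop surj(3)] by blast
  obtain cm where cm: "0 < cm" "\<And>x. cm * (norm x)\<^sup>2 \<le> energy (\<lambda>n. E ((A_minus \<Sigma> ^^ n) x))"
    using minus.observe_if_surj[OF bij_neg_index E Wom[folded E_def] surj(4)] by blast
  obtain bm where bm: "0 < bm" "\<And>x. norm (B_minus \<Sigma> x) \<le> bm * norm x" using bounded_clinear_bound[OF ops(2)] by blast
  obtain bp where bp: "0 < bp" "\<And>x. norm (B_plus \<Sigma> x) \<le> bp * norm x" using bounded_clinear_bound[OF ops(5)] by blast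
  have mono: "a * (norm x)\<^sup>2 \<le> b * (norm x)\<^sup>2" if "a \<le> b" for a b and x :: "'z::real_normed_vector"
    using that by (intro mult_right_mono) auto
  interpret min: minimal_system "A_minus \<Sigma>" "B_minus \<Sigma>" "A_plus \<Sigma>" "B_plus \<Sigma>" D r E "C_plus \<Sigma>" G
    "K * (bm + bp)" "max kp km" "min cp cm"
  proof (unfold_locales, goal_cases)
    case 1 show ?case by (rule E)
  next case 2 show ?case by (rule outputs)
  next case 3 show ?case by (rule G)
  next case 4 show ?case using K_pos bm bp by simp
  next
    case (5 z u)
    obtain \<eta> \<xi> where eq: "\<eta> = inverse z *\<^sub>C A_minus \<Sigma> \<eta> + B_minus \<Sigma> u" "inverse z *\<^sub>C \<xi> = A_plus \<Sigma> \<xi> + B_plus \<Sigma> u"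
      and n: "norm \<eta> \<le> K * norm (B_minus \<Sigma> u)" "norm \<xi> \<le> K * norm (B_plus \<Sigma> u)"
      and Fz: "transfer_fun \<Sigma> z u = C_minus \<Sigma> \<eta> + C_plus \<Sigma> \<xi> + D_op \<Sigma> u" using frequency_response[OF 5] by blast
    have "K * norm (B_minus \<Sigma> u) \<le> K * ((bm + bp) * norm u)"
      using K_pos bm bp by (intro mult_left_mono order_trans[OF bm(2)] mult_right_mono) auto
    with n(1) have n1: "norm \<eta> \<le> K * (bm + bp) * norm u" by (simp add: mult.assoc)
    have "K * norm (B_plus \<Sigma> u) \<le> K * ((bm + bp) * norm u)"
      using K_pos bm bp by (intro mult_left_mono order_trans[OF bp(2)] mult_right_mono) auto
    with n(2) have n2: "norm \<xi> \<le> K * (bm + bp) * norm u" by (simp add: mult.assoc)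
    \<comment> \<open>Expanding x_-(n) by its recursion brings F(z) u into the output form with
      \<open>E\<close> and \<open>G\<close>.\<close>
    have "C_minus \<Sigma> \<eta> = C_minus \<Sigma> (inverse z *\<^sub>C A_minus \<Sigma> \<eta> + B_minus \<Sigma> u)" using eq(1) by (rule arg_cong)
    then have "inverse z *\<^sub>C E \<eta> + C_plus \<Sigma> \<xi> + G u = transfer_fun \<Sigma> z u"
      unfolding Fz by (simp add: E_def G_def bounded_clinearD[OF ops(3)])
    moreover have "norm (transfer_fun \<Sigma> z u) \<le> 1 * norm u"
      by (rule order_trans[OF transfer_fun_le_sup[OF 5] mult_right_mono[OF F]]) simp
    ultimately have "norm (inverse z *\<^sub>C E \<eta> + C_plus \<Sigma> \<xi> + G u) \<le> norm u" by simp
    with eq n1 n2 show ?case by blast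
  next case 6 show ?case using kp by simp
  next case 7 show ?case using cp cm by simp
  next
    case (8 x)
    have "km * (norm x)\<^sup>2 \<le> max kp km * (norm x)\<^sup>2" by (rule mono) simp
    then show ?case using km(2)[of x] order_trans by blast
  next
    case (9 x)
    have "kp * (norm x)\<^sup>2 \<le> max kp km * (norm x)\<^sup>2" by (rule mono) simp
    then show ?case using kp(2)[of x] order_trans by blast
  next case (10 x) show ?case by (rule order_trans[OF mono cm(2)]) simp
  next case (11 x) show ?case by (rule order_trans[OF mono cp(2)]) simp
  qed
  show ?thesis
    using min.storage_operator unfolding dissipative_def min.out_def by (simp add: E_def G_def)
qed

text \<open>
  For the strict inequality, inputs \<open>\<epsilon> v\<^sub>\<plusminus>\<close> to the states and outputs \<open>\<epsilon> x\<^sub>-(n)\<close>, \<open>\<epsilon> x\<^sub>+(n)\<close>,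
  \<open>\<epsilon> u(n)\<close> and \<open>\<epsilon> x\<^sub>-(n+1)\<close> are adjoined. This makes the system exactly controllable and observable,
  and for small \<open>\<epsilon>\<close> it remains contractive. The output \<open>\<epsilon> x\<^sub>-(n+1)\<close> is what yields observability of
  the anticausal part when \<open>A\<^sub>-\<close> is not injective.
\<close>

definition B_minus_ext :: "real \<Rightarrow> 'u \<times> 'xm \<times> 'xp \<Rightarrow> 'xm"
  where "B_minus_ext e w = B_minus \<Sigma> (fst w) + e *\<^sub>R fst (snd w)"

definition B_plus_ext :: "real \<Rightarrow> 'u \<times> 'xm \<times> 'xp \<Rightarrow> 'xp"
  where "B_plus_ext e w = B_plus \<Sigma> (fst w) + e *\<^sub>R snd (snd w)"

definition E_ext :: "real \<Rightarrow> 'xm \<Rightarrow> 'y \<times> 'xm \<times> 'xp \<times> 'u \<times> 'xm"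
  where "E_ext e x = (C_minus \<Sigma> (A_minus \<Sigma> x), e *\<^sub>R A_minus \<Sigma> x, 0, 0, e *\<^sub>R x)"

definition C_ext :: "real \<Rightarrow> 'xp \<Rightarrow> 'y \<times> 'xm \<times> 'xp \<times> 'u \<times> 'xm"
  where "C_ext e x = (C_plus \<Sigma> x, 0, e *\<^sub>R x, 0, 0)"

definition G_ext :: "real \<Rightarrow> 'u \<times> 'xm \<times> 'xp \<Rightarrow> 'y \<times> 'xm \<times> 'xp \<times> 'u \<times> 'xm"
  where "G_ext e w = (C_minus \<Sigma> (B_minus_ext e w) + D_op \<Sigma> (fst w), e *\<^sub>R B_minus_ext e w, 0, e *\<^sub>R fst w, 0)"

lemma ext_ops:
  "bounded_clinear (B_minus_ext e)" "bounded_clinear (B_plus_ext e)"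
  "bounded_clinear (E_ext e)" "bounded_clinear (C_ext e)" "bounded_clinear (G_ext e)"
  unfolding B_minus_ext_def[abs_def] B_plus_ext_def[abs_def] E_ext_def[abs_def] C_ext_def[abs_def] G_ext_def[abs_def]
  by (intro op_intros)+

text \<open>The gap 1 - \<rho> pays for everything adjoined. New outputs cost e^2 times squared
  norms of states and input; new inputs change the old output by order e, and convexity of the
  square trades the cross term for e^2 / (1 - \<rho>).\<close>

lemma ext_frequency_response:
  assumes \<rho>: "0 \<le> \<rho>" "\<rho> < 1" and F: "\<And>z u. cmod z = 1 \<Longrightarrow> norm (transfer_fun \<Sigma> z u) \<le> \<rho> * norm u"
  shows "\<exists>e>0. \<exists>K'>0. \<forall>z w. cmod z = 1 \<longrightarrow> (\<exists>\<eta> \<xi>. \<eta> = inverse z *\<^sub>C A_minus \<Sigma> \<eta> + B_minus_ext e w \<and>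
      inverse z *\<^sub>C \<xi> = A_plus \<Sigma> \<xi> + B_plus_ext e w \<and> norm \<eta> \<le> K' * norm w \<and> norm \<xi> \<le> K' * norm w \<and>
      norm (inverse z *\<^sub>C E_ext e \<eta> + C_ext e \<xi> + G_ext e w) \<le> norm w)"
proof -
  obtain bm where bm: "0 < bm" "\<And>x. norm (B_minus \<Sigma> x) \<le> bm * norm x" using bounded_clinear_bound[OF ops(2)] by blast
  obtain bp where bp: "0 < bp" "\<And>x. norm (B_plus \<Sigma> x) \<le> bp * norm x" using bounded_clinear_bound[OF ops(5)] by blast
  obtain cm where cm: "0 < cm" "\<And>x. norm (C_minus \<Sigma> x) \<le> cm * norm x" using bounded_clinear_bound[OF ops(3)] by blast
  obtain cp where cp: "0 < cp" "\<And>x. norm (C_plus \<Sigma> x) \<le> cp * norm x" using bounded_clinear_bound[OF ops(6)] by blast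
  \<comment> \<open>\<open>K1\<close> bounds both steady states and \<open>K2\<close> the effect of
    the new inputs on the old output. In \<open>Q\<close>, the 6 is 3 * 2: three squared states, and
    (P + V)^2 \<le> 2 P^2 + 2 V^2; the 1 is for the output e u. \<open>T\<close> makes e^2 small
    enough for both final coefficients to be at most 1.\<close>
  define K1 where "K1 = K * (bm + bp + 1)"
  define K2 where "K2 = (cm + cp) * K"
  define Q where "Q = 6 * K1\<^sup>2 + 1"
  define T where "T = Q + K2\<^sup>2"
  define e where "e = sqrt ((1 - \<rho>) / T)"
  have K1: "0 < K1" "K * bm \<le> K1" "K * bp \<le> K1" "K \<le> K1"
    using K_pos bm(1) bp(1) by (simp_all add: K1_def distrib_left add_pos_pos)
  have T1: "1 \<le> Q" "Q \<le> T" by (simp_all add: T_def Q_def)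
  then have T: "1 \<le> Q" "Q \<le> T" "0 < T" by linarith+
  have e2: "e\<^sup>2 = (1 - \<rho>) / T" using T \<rho> by (simp add: e_def)
  have e0: "0 < e" using T \<rho> by (simp add: e_def)
  have "(1 - \<rho>) / T \<le> 1" using T \<rho> by simp
  then have e1: "e \<le> 1" using e0 e2 by (metis power2_le_imp_le one_power2 zero_le_one)
  have "\<exists>\<eta> \<xi>. \<eta> = inverse z *\<^sub>C A_minus \<Sigma> \<eta> + B_minus_ext e w \<and>
      inverse z *\<^sub>C \<xi> = A_plus \<Sigma> \<xi> + B_plus_ext e w \<and> norm \<eta> \<le> (2 * K1) * norm w \<and> norm \<xi> \<le> (2 * K1) * norm w \<and>
      norm (inverse z *\<^sub>C E_ext e \<eta> + C_ext e \<xi> + G_ext e w) \<le> norm w" if z: "cmod z = 1" for z w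
  proof -
    obtain u vm vp where w: "w = (u, vm, vp)" by (metis prod.exhaust)
    obtain \<eta>1 \<xi>1 where eq1: "\<eta>1 = inverse z *\<^sub>C A_minus \<Sigma> \<eta>1 + B_minus \<Sigma> u" "inverse z *\<^sub>C \<xi>1 = A_plus \<Sigma> \<xi>1 + B_plus \<Sigma> u"
      and n1: "norm \<eta>1 \<le> K * norm (B_minus \<Sigma> u)" "norm \<xi>1 \<le> K * norm (B_plus \<Sigma> u)"
      and Fz: "transfer_fun \<Sigma> z u = C_minus \<Sigma> \<eta>1 + C_plus \<Sigma> \<xi>1 + D_op \<Sigma> u" using frequency_response[OF z] by blast
    obtain \<eta>2 where eq2: "\<eta>2 = inverse z *\<^sub>C A_minus \<Sigma> \<eta>2 + vm" and n2: "norm \<eta>2 \<le> K * norm vm"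
      using minus_response(2)[OF z, of vm] by blast
    obtain \<xi>2 where eq3: "inverse z *\<^sub>C \<xi>2 = A_plus \<Sigma> \<xi>2 + vp" and n3: "norm \<xi>2 \<le> K * norm vp"
      using plus_response(2)[OF z, of vp] by blast
    define \<eta> \<xi> where "\<eta> = \<eta>1 + e *\<^sub>R \<eta>2" and "\<xi> = \<xi>1 + e *\<^sub>R \<xi>2"
    have sR: "T' (s *\<^sub>R x) = s *\<^sub>R T' x" if "bounded_clinear T'" for T' :: "'a1::complex_inner \<Rightarrow> 'a2::complex_inner" and s x
      using bounded_clinear_scaleC[OF that] by (simp add: scaleR_scaleC)
    have sC: "a *\<^sub>C s *\<^sub>R x = s *\<^sub>R a *\<^sub>C x" for a s and x :: "'a1::complex_inner"
      by (simp add: scaleR_scaleC scaleC_scaleC mult.commute)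
    have eq\<eta>: "\<eta> = inverse z *\<^sub>C A_minus \<Sigma> \<eta> + B_minus_ext e w"
    proof -
      have "inverse z *\<^sub>C A_minus \<Sigma> \<eta> + B_minus_ext e w =
          (inverse z *\<^sub>C A_minus \<Sigma> \<eta>1 + B_minus \<Sigma> u) + e *\<^sub>R (inverse z *\<^sub>C A_minus \<Sigma> \<eta>2 + vm)"
        by (simp add: \<eta>_def w B_minus_ext_def bounded_clinear_add[OF ops(1)] sR[OF ops(1)] scaleC_add_right sC scaleR_add_right)
      then show ?thesis unfolding eq1(1)[symmetric] eq2[symmetric] by (simp add: \<eta>_def)
    qed
    have eq\<xi>: "inverse z *\<^sub>C \<xi> = A_plus \<Sigma> \<xi> + B_plus_ext e w"
      by (simp add: \<xi>_def w B_plus_ext_def bounded_clinear_add[OF ops(4)] sR[OF ops(4)] scaleC_add_right sC scaleR_add_right eq1 eq3)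
    define P V where "P = norm u" and "V = norm (vm, vp)"
    have PV: "0 \<le> P" "0 \<le> V" and nw: "(norm w)\<^sup>2 = P\<^sup>2 + V\<^sup>2"
      by (simp_all add: P_def V_def w norm_prod_def)
    have vV: "norm vm \<le> V" "norm vp \<le> V" using norm_fst_le[of "vm" vp] norm_snd_le[of vp vm] by (simp_all add: V_def)
    have n\<eta>: "norm \<eta> \<le> K1 * (P + V)"
    proof -
      have "norm \<eta> \<le> norm \<eta>1 + e * norm \<eta>2" unfolding \<eta>_def using norm_triangle_ineq[of \<eta>1 "e *\<^sub>R \<eta>2"] e0 by simp
      also have "\<dots> \<le> K * (bm * P) + 1 * (K * V)"
        using n1(1) n2 bm(2)[of u] vV K_pos e0 e1
        by (intro add_mono mult_mono order_trans[OF n1(1)] order_trans[OF n2] mult_left_mono) (auto simp: P_def)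
      also have "\<dots> \<le> K1 * P + K1 * V"
        using K1 PV mult_right_mono[of "K * bm" K1 P] mult_right_mono[of K K1 V] by (simp add: mult.assoc)
      finally show ?thesis by (simp add: distrib_left)
    qed
    have n\<xi>: "norm \<xi> \<le> K1 * (P + V)"
    proof -
      have "norm \<xi> \<le> norm \<xi>1 + e * norm \<xi>2" unfolding \<xi>_def using norm_triangle_ineq[of \<xi>1 "e *\<^sub>R \<xi>2"] e0 by simp
      also have "\<dots> \<le> K * (bp * P) + 1 * (K * V)"
        using n1(2) n3 bp(2)[of u] vV K_pos e0 e1
        by (intro add_mono mult_mono order_trans[OF n1(2)] order_trans[OF n3] mult_left_mono) (auto simp: P_def)
      also have "\<dots> \<le> K1 * P + K1 * V"
        using K1 PV mult_right_mono[of "K * bp" K1 P] mult_right_mono[of K K1 V] by (simp add: mult.assoc)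
      finally show ?thesis by (simp add: distrib_left)
    qed
    define y where "y = C_minus \<Sigma> \<eta> + C_plus \<Sigma> \<xi> + D_op \<Sigma> u"
    have ny: "norm y \<le> \<rho> * P + e * K2 * V"
    proof -
      have "y = transfer_fun \<Sigma> z u + e *\<^sub>R (C_minus \<Sigma> \<eta>2 + C_plus \<Sigma> \<xi>2)"
        unfolding Fz by (simp add: y_def \<eta>_def \<xi>_def bounded_clinear_add[OF ops(3)] bounded_clinear_add[OF ops(6)]
            sR[OF ops(3)] sR[OF ops(6)] scaleR_add_right)
      then have "norm y \<le> norm (transfer_fun \<Sigma> z u) + e * norm (C_minus \<Sigma> \<eta>2 + C_plus \<Sigma> \<xi>2)"
        using norm_triangle_ineq[of "transfer_fun \<Sigma> z u" "e *\<^sub>R (C_minus \<Sigma> \<eta>2 + C_plus \<Sigma> \<xi>2)"] e0 by simp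
      also have "\<dots> \<le> \<rho> * P + e * (cm * (K * V) + cp * (K * V))"
      proof (intro add_mono mult_left_mono)
        show "norm (transfer_fun \<Sigma> z u) \<le> \<rho> * P" unfolding P_def by (rule F[OF z])
        have "norm (C_minus \<Sigma> \<eta>2) \<le> cm * (K * V)"
          by (rule order_trans[OF cm(2)], intro mult_left_mono order_trans[OF n2] vV) (use cm K_pos in auto)
        moreover have "norm (C_plus \<Sigma> \<xi>2) \<le> cp * (K * V)"
          by (rule order_trans[OF cp(2)], intro mult_left_mono order_trans[OF n3] vV) (use cp K_pos in auto)
        ultimately show "norm (C_minus \<Sigma> \<eta>2 + C_plus \<Sigma> \<xi>2) \<le> cm * (K * V) + cp * (K * V)"
          by (intro norm_triangle_le add_mono)
      qed (use e0 in simp)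
      also have "\<dots> = \<rho> * P + e * K2 * V" by (simp add: K2_def algebra_simps)
      finally show ?thesis .
    qed
    \<comment> \<open>Reading the bound on y as a convex combination of P and \<open>t\<close>
      leaves \<rho> as coefficient of P^2.\<close>
    have ysq: "(norm y)\<^sup>2 \<le> \<rho> * P\<^sup>2 + (e\<^sup>2 * K2\<^sup>2 / (1 - \<rho>)) * V\<^sup>2"
    proof -
      define t where "t = e * K2 * V / (1 - \<rho>)"
      have t: "e * K2 * V = (1 - \<rho>) * t" using \<rho> by (simp add: t_def)
      have "(norm y)\<^sup>2 \<le> (\<rho> * P + (1 - \<rho>) * t)\<^sup>2" using ny by (intro power_mono) (simp_all add: t)
      also have "\<dots> \<le> \<rho> * P\<^sup>2 + (1 - \<rho>) * t\<^sup>2"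
      proof -
        have "\<rho> * P\<^sup>2 + (1 - \<rho>) * t\<^sup>2 - (\<rho> * P + (1 - \<rho>) * t)\<^sup>2 = \<rho> * (1 - \<rho>) * (P - t)\<^sup>2"
          by (simp add: power2_eq_square algebra_simps)
        moreover have "0 \<le> \<rho> * (1 - \<rho>) * (P - t)\<^sup>2" using \<rho> by simp
        ultimately show ?thesis by linarith
      qed
      also have "(1 - \<rho>) * t\<^sup>2 = (e\<^sup>2 * K2\<^sup>2 / (1 - \<rho>)) * V\<^sup>2"
        using \<rho> by (simp add: t_def power2_eq_square)
      finally show ?thesis .
    qed
    have "C_minus \<Sigma> \<eta> = C_minus \<Sigma> (inverse z *\<^sub>C A_minus \<Sigma> \<eta> + B_minus_ext e w)" using eq\<eta> by (rule arg_cong)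
    then have c: "inverse z *\<^sub>C C_minus \<Sigma> (A_minus \<Sigma> \<eta>) + C_minus \<Sigma> (B_minus_ext e w) = C_minus \<Sigma> \<eta>"
      by (simp add: bounded_clinearD[OF ops(3)])
    have a: "inverse z *\<^sub>C e *\<^sub>R A_minus \<Sigma> \<eta> + e *\<^sub>R B_minus_ext e w = e *\<^sub>R \<eta>"
      using eq\<eta> by (simp only: sC flip: scaleR_add_right)
    \<comment> \<open>The recursion merges the second slot into e \<eta>. The last slot has the same
      norm because |z| = 1, hence 2 |\<eta>|^2 below.\<close>
    have "inverse z *\<^sub>C E_ext e \<eta> + C_ext e \<xi> + G_ext e w = (y, e *\<^sub>R \<eta>, e *\<^sub>R \<xi>, e *\<^sub>R u, e *\<^sub>R inverse z *\<^sub>C \<eta>)"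
      using c a by (simp add: E_ext_def C_ext_def G_ext_def scaleC_Pair y_def w sC add_ac)
    then have "(norm (inverse z *\<^sub>C E_ext e \<eta> + C_ext e \<xi> + G_ext e w))\<^sup>2
        = (norm y)\<^sup>2 + e\<^sup>2 * (2 * (norm \<eta>)\<^sup>2 + (norm \<xi>)\<^sup>2 + P\<^sup>2)"
      using z by (simp add: norm_prod_def norm_scaleC norm_inverse P_def power_mult_distrib distrib_left)
    also have "\<dots> \<le> (\<rho> * P\<^sup>2 + (e\<^sup>2 * K2\<^sup>2 / (1 - \<rho>)) * V\<^sup>2) + e\<^sup>2 * (Q * P\<^sup>2 + Q * V\<^sup>2)"
    proof (rule add_mono[OF ysq mult_left_mono])
      have "(norm \<eta>)\<^sup>2 \<le> (K1 * (P + V))\<^sup>2" "(norm \<xi>)\<^sup>2 \<le> (K1 * (P + V))\<^sup>2" using n\<eta> n\<xi> by (auto intro: power_mono)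
      moreover have "(K1 * (P + V))\<^sup>2 \<le> K1\<^sup>2 * (2 * P\<^sup>2 + 2 * V\<^sup>2)"
        unfolding power_mult_distrib using sum_squares_bound[of P V] by (intro mult_left_mono) (auto simp: power2_sum)
      ultimately have "2 * (norm \<eta>)\<^sup>2 + (norm \<xi>)\<^sup>2 \<le> 3 * (K1\<^sup>2 * (2 * P\<^sup>2 + 2 * V\<^sup>2))" by linarith
      also have "\<dots> = 6 * K1\<^sup>2 * P\<^sup>2 + 6 * K1\<^sup>2 * V\<^sup>2" by (simp add: algebra_simps)
      finally have "2 * (norm \<eta>)\<^sup>2 + (norm \<xi>)\<^sup>2 \<le> 6 * K1\<^sup>2 * P\<^sup>2 + 6 * K1\<^sup>2 * V\<^sup>2" .
      then show "2 * (norm \<eta>)\<^sup>2 + (norm \<xi>)\<^sup>2 + P\<^sup>2 \<le> Q * P\<^sup>2 + Q * V\<^sup>2"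
        using zero_le_power2[of V] unfolding Q_def distrib_right by linarith
    qed simp
    also have "\<dots> = (\<rho> + e\<^sup>2 * Q) * P\<^sup>2 + (e\<^sup>2 * K2\<^sup>2 / (1 - \<rho>) + e\<^sup>2 * Q) * V\<^sup>2" by (simp add: algebra_simps)
    also have "\<dots> \<le> 1 * P\<^sup>2 + 1 * V\<^sup>2"
    proof (intro add_mono mult_right_mono)
      have "Q / T \<le> 1" using T by simp
      then have q: "e\<^sup>2 * Q \<le> 1 - \<rho>" unfolding e2 using \<rho> mult_left_mono[of "Q / T" 1 "1 - \<rho>"] by simp
      then show "\<rho> + e\<^sup>2 * Q \<le> 1" by simp
      have "e\<^sup>2 * K2\<^sup>2 / (1 - \<rho>) = K2\<^sup>2 / T" unfolding e2 using \<rho> by simp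
      moreover have "e\<^sup>2 * Q \<le> Q / T" unfolding e2 using \<rho> T mult_right_mono[of "1 - \<rho>" 1 "Q / T"] by simp
      moreover have "K2\<^sup>2 / T + Q / T = 1" using T by (simp add: T_def flip: add_divide_distrib)
      ultimately show "e\<^sup>2 * K2\<^sup>2 / (1 - \<rho>) + e\<^sup>2 * Q \<le> 1" by linarith
    qed simp_all
    also have "\<dots> = (norm w)\<^sup>2" by (simp add: nw)
    finally have "norm (inverse z *\<^sub>C E_ext e \<eta> + C_ext e \<xi> + G_ext e w) \<le> norm w" by (rule power2_le_imp_le) simp
    moreover have "P \<le> norm w" "V \<le> norm w" using norm_fst_le[of u "(vm, vp)"] norm_snd_le[of "(vm, vp)" u]
      by (simp_all add: P_def V_def w)
    then have "K1 * (P + V) \<le> K1 * (norm w + norm w)" using K1 by (intro mult_left_mono add_mono) auto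
    then have "norm \<eta> \<le> (2 * K1) * norm w" "norm \<xi> \<le> (2 * K1) * norm w" using n\<eta> n\<xi> by auto
    ultimately show ?thesis using eq\<eta> eq\<xi> by blast
  qed
  moreover have "0 < 2 * K1" using K1 by simp
  ultimately show ?thesis using e0 by blast
qed

text \<open>The storage operator of the extended system serves unchanged: with the new inputs set to
  zero, the outputs e x_-(n), e x_+(n), e u(n) contribute exactly e^2 times the squared norm of
  \<open>R_op\<close>.\<close>

lemma strict_solution_if_sup_norm_less_1:
  assumes F: "sup_norm_circle (transfer_fun \<Sigma>) < 1"
  shows "\<exists>H. admissible_H H \<and> (\<exists>\<epsilon>>0. dissipative H (\<epsilon>\<^sup>2))"
proof -
  define \<rho> where "\<rho> = max 0 (sup_norm_circle (transfer_fun \<Sigma>))"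
  have \<rho>: "0 \<le> \<rho>" "\<rho> < 1" using F by (auto simp: \<rho>_def)
  have "norm (transfer_fun \<Sigma> z u) \<le> \<rho> * norm u" if "cmod z = 1" for z u
    by (rule order_trans[OF transfer_fun_le_sup[OF that] mult_right_mono]) (auto simp: \<rho>_def)
  from ext_frequency_response[OF \<rho> this] obtain e K' where e: "0 < e" and K': "0 < K'"
    and freq: "\<forall>z w. cmod z = 1 \<longrightarrow> (\<exists>\<eta> \<xi>. \<eta> = inverse z *\<^sub>C A_minus \<Sigma> \<eta> + B_minus_ext e w \<and>
      inverse z *\<^sub>C \<xi> = A_plus \<Sigma> \<xi> + B_plus_ext e w \<and> norm \<eta> \<le> K' * norm w \<and> norm \<xi> \<le> K' * norm w \<and>
      norm (inverse z *\<^sub>C E_ext e \<eta> + C_ext e \<xi> + G_ext e w) \<le> norm w)" by blast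
  interpret ext_minus: decaying "A_minus \<Sigma>" "B_minus_ext e" D r
    by unfold_locales (rule minus.A ext_ops minus.D minus.r minus.decay)+
  interpret ext_plus: decaying "A_plus \<Sigma>" "B_plus_ext e" D r
    by unfold_locales (rule plus.A ext_ops minus.D minus.r plus.decay)+
  \<comment> \<open>The impulse x / e reaches x with energy |x|^2 / e^2, and the first output sample
    already shows x with energy at least e^2 |x|^2; hence the last two parameters.\<close>
  interpret ext: minimal_system "A_minus \<Sigma>" "B_minus_ext e" "A_plus \<Sigma>" "B_plus_ext e" D r "E_ext e" "C_ext e" "G_ext e"
    K' "1 / e\<^sup>2" "e\<^sup>2"
  proof (unfold_locales, goal_cases)
    case 1 show ?case by (rule ext_ops)
  next case 2 show ?case by (rule ext_ops)
  next case 3 show ?case by (rule ext_ops)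
  next case 4 show ?case by (rule K')
  next case 5 then show ?case by (rule freq[rule_format])
  next case 6 show ?case by simp
  next case 7 show ?case using e by simp
  next
    case (8 x)
    let ?v = "(0, (1 / e) *\<^sub>R x, 0) :: 'u \<times> 'xm \<times> 'xp"
    have "B_minus_ext e 0 = 0" "B_minus_ext e ?v = x"
      using e by (simp_all add: B_minus_ext_def bounded_clinear_zero[OF ops(2)])
    moreover have "(norm ?v)\<^sup>2 = 1 / e\<^sup>2 * (norm x)\<^sup>2" by (simp add: norm_prod_def power_divide)
    moreover note minus.control_of_single[of "B_minus_ext e" ?v]
    ultimately show ?case by (intro exI[of _ "\<lambda>n. if n = 0 then ?v else 0"]) (simp only: simp_thms order_refl)
  next
    case (9 x)
    let ?v = "(0, 0, (1 / e) *\<^sub>R x) :: 'u \<times> 'xm \<times> 'xp"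
    have "B_plus_ext e 0 = 0" "B_plus_ext e ?v = x"
      using e by (simp_all add: B_plus_ext_def bounded_clinear_zero[OF ops(5)])
    moreover have "(norm ?v)\<^sup>2 = 1 / e\<^sup>2 * (norm x)\<^sup>2" by (simp add: norm_prod_def power_divide)
    moreover note plus.control_of_single[of "B_plus_ext e" ?v]
    ultimately show ?case by (intro exI[of _ "\<lambda>n. if n = 0 then ?v else 0"]) (simp only: simp_thms order_refl)
  next
    case (10 x)
    have "e\<^sup>2 * (norm x)\<^sup>2 \<le> (norm (E_ext e x))\<^sup>2" by (simp add: E_ext_def norm_prod_def power_mult_distrib)
    also have "\<dots> \<le> energy (\<lambda>n. E_ext e ((A_minus \<Sigma> ^^ n) x))"
      using sum_le_energy[OF minus.l2seq_observation(1)[OF ext_ops(3)], of "{0}" e x] by simp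
    finally show ?case .
  next
    case (11 x)
    have "e\<^sup>2 * (norm x)\<^sup>2 \<le> (norm (C_ext e x))\<^sup>2" by (simp add: C_ext_def norm_prod_def power_mult_distrib)
    also have "\<dots> \<le> energy (\<lambda>n. C_ext e ((A_plus \<Sigma> ^^ n) x))"
      using sum_le_energy[OF plus.l2seq_observation(1)[OF ext_ops(4)], of "{0}" e x] by simp
    finally show ?case .
  qed
  obtain H where H: "admissible_H H" and dis: "\<And>xm xp w.
      inner (H (xm, A_plus \<Sigma> xp + B_plus_ext e w)) (xm, A_plus \<Sigma> xp + B_plus_ext e w) + (norm (ext.out xm xp w))\<^sup>2
      \<le> inner (H (A_minus \<Sigma> xm + B_minus_ext e w, xp)) (A_minus \<Sigma> xm + B_minus_ext e w, xp) + (norm w)\<^sup>2"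
    using ext.storage_operator by blast
  have "dissipative H (e\<^sup>2)" unfolding dissipative_def
  proof (intro allI)
    fix xm xp u
    let ?w = "(u, 0, 0) :: 'u \<times> 'xm \<times> 'xp" and ?x = "A_minus \<Sigma> xm + B_minus \<Sigma> u"
    let ?y = "C_minus \<Sigma> (A_minus \<Sigma> xm) + C_plus \<Sigma> xp + (C_minus \<Sigma> (B_minus \<Sigma> u) + D_op \<Sigma> u)"
    have B: "B_minus_ext e ?w = B_minus \<Sigma> u" "B_plus_ext e ?w = B_plus \<Sigma> u"
      by (simp_all add: B_minus_ext_def B_plus_ext_def)
    have "ext.out xm xp ?w = (?y, e *\<^sub>R ?x, e *\<^sub>R xp, e *\<^sub>R u, e *\<^sub>R xm)"
      by (simp add: ext.out_def E_ext_def C_ext_def G_ext_def B scaleR_add_right)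
    then have "(norm (ext.out xm xp ?w))\<^sup>2 = (norm ?y)\<^sup>2 + e\<^sup>2 * ((norm ?x)\<^sup>2 + (norm xp)\<^sup>2 + (norm u)\<^sup>2) + e\<^sup>2 * (norm xm)\<^sup>2"
      by (simp only: norm_prod_def fst_conv snd_conv) (simp add: power_mult_distrib distrib_left)
    \<comment> \<open>The contribution of e x_-(n+1), which served observability, is
      dropped.\<close>
    moreover have "0 \<le> e\<^sup>2 * (norm xm)\<^sup>2" by simp
    moreover have "(norm ?w)\<^sup>2 = (norm u)\<^sup>2" by (simp add: norm_prod_def)
    ultimately show "inner (H (xm, A_plus \<Sigma> xp + B_plus \<Sigma> u)) (xm, A_plus \<Sigma> xp + B_plus \<Sigma> u) + (norm ?y)\<^sup>2
      + e\<^sup>2 * ((norm ?x)\<^sup>2 + (norm xp)\<^sup>2 + (norm u)\<^sup>2) \<le> inner (H (?x, xp)) (?x, xp) + (norm u)\<^sup>2"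
      using dis[of xm xp ?w] unfolding B by linarith
  qed
  with H e show ?thesis by blast
qed

end

theorem theorem7p3:
  fixes \<Sigma> :: "('xm::chilbert_space, 'xp::chilbert_space, 'u::chilbert_space, 'y::chilbert_space) bicausal"
  assumes "bicausal_system \<Sigma>"
    and "exp_stable (A_plus \<Sigma>)"
    and "exp_stable (A_minus \<Sigma>)"
  shows "(l2_exactly_minimal \<Sigma> \<longrightarrow>
            (sup_norm_circle (transfer_fun \<Sigma>) \<le> 1 \<longleftrightarrow>
              (\<exists>H. admissible_H H \<and> bicausal_KYP \<Sigma> H)))
       \<and> (sup_norm_circle (transfer_fun \<Sigma>) < 1 \<longleftrightarrow>
              (\<exists>H. admissible_H H \<and> strict_bicausal_KYP \<Sigma> H))"
proof -
  obtain D r K where "stable_bicausal \<Sigma> D r K" using stable_bicausal_exists[OF assms] by blast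
  then interpret stable_bicausal \<Sigma> D r K .
  have "sup_norm_circle (transfer_fun \<Sigma>) \<le> 1" if "admissible_H H" "bicausal_KYP \<Sigma> H" for H
    using sup_norm_le_if_dissipative[of H 0] that KYP_iff(1) by simp
  moreover have "sup_norm_circle (transfer_fun \<Sigma>) < 1" if H: "admissible_H H" "strict_bicausal_KYP \<Sigma> H" for H
  proof -
    obtain \<epsilon> where "0 < \<epsilon>" "dissipative H (\<epsilon>\<^sup>2)" using KYP_iff(2) H by blast
    then have "sup_norm_circle (transfer_fun \<Sigma>) \<le> sqrt (max 0 (1 - \<epsilon>\<^sup>2))" "sqrt (max 0 (1 - \<epsilon>\<^sup>2)) < 1"
      using sup_norm_le_if_dissipative[OF H(1)] by auto
    then show ?thesis by (rule le_less_trans)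
  qed
  ultimately show ?thesis
    using solution_if_sup_norm_le_1 strict_solution_if_sup_norm_less_1 KYP_iff by blast
qed

end
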